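(* Let $\gamma\subset\mathbf R^2$ be a simple closed centrally-symmetric $C^2$ curve of positive curvature, oriented counterclockwise, with phase cylinder $\mathbf A$ and billiard ball map $T:\mathbf A\to\mathbf A$. Let $\alpha\subset\mathbf A$ be a continuous rotational $T$-invariant curve of rotation number $1/4$ consisting of $4$-periodic points of $T$, and let $\mathcal A\subset\mathbf A$ be the domain bounded by $\alpha$ and the boundary component $\{\delta=0\}$ of the phase cylinder. Suppose that the restriction of $T$ to $\mathcal A$ has a measurable monotone invariant sub-bundle (of oriented tangent lines). Then $\gamma$ is an ellipse.
   Context: The phase cylinder $\mathbf A$ is the space of all oriented lines intersecting the interior of the domain bounded by $\gamma$. It carries two systems of coordinates. (1) $(\cos\delta,s)$: $s$ is the arclength parameter (modulo the length of $\gamma$) of the point $\gamma(s)$ at which the line enters the domain and $\delta\in(0,\pi)$ is the angle between $\gamma'(s)$ and the direction of the line; the boundary components of $\mathbf A$ are $\{\delta=0\}$ and $\{\delta=\pi\}$. (2) $(p,\varphi)$: $\varphi\in\mathbf R/2\pi\mathbf Z$ is the angle between the right unit normal of the oriented line and the horizontal axis, and $p$ is the signed distance from the origin to the line in the direction of this normal. The billiard ball map $T$ sends an oriented line to the oriented line obtained from it by reflection in $\gamma$ at the point where it leaves the domain. A curve in $\mathbf A$ is rotational if it is simple, closed and winds once around the cylinder; it is invariant if $T$ maps it onto itself; the rotation number is normalized so that an orbit with rotation number $1/4$ consisting of $4$-periodic points makes exactly one counterclockwise turn around $\gamma$ in $4$ reflections. A sub-bundle $\mathcal L$ over $\mathcal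 A$ assigns to every $x\in\mathcal A$ an oriented line $l(x)\subset T_x\mathcal A$; it is measurable if $l(x)$ depends measurably on $x$. It is invariant under $T$ if $DT$ maps the oriented line $l(x)$ onto the oriented line $l(T(x))$ for every $x\in\mathcal A$. It is monotone with respect to the vertical foliation $\{s=\mathrm{const}\}$ (respectively $\{\varphi=\mathrm{const}\}$) if for every $x\in\mathcal A$ the line $l(x)$ is not tangent to the leaf of that foliation through $x$ and the orientation of $l(x)$ is given by $ds>0$ (respectively $d\varphi>0$). In the theorem, "monotone" means monotone with respect to either of these two vertical foliations (for measurable $T$-invariant sub-bundles the two notions coincide). Circles are regarded as ellipses. *)

theory Defs
  imports "HOL-Analysis.Analysis" "HOL-Complex_Analysis.Winding_Numbers"
begin

text \<open>
  The Euclidean plane is the type \<^typ>\<open>complex\<close>; \<^term>\<open>\<i> * u\<close> is \<open>u\<close> turned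
  counterclockwise by a right angle, and \<open>\<bullet>\<close> is the real inner product.
  A closed curve of length \<open>L\<close> is an \<open>L\<close>-periodic arclength parametrization
  \<open>\<gamma> :: real \<Rightarrow> complex\<close>, so the parameter \<open>s\<close> is meant modulo \<open>L\<close>.
\<close>

abbreviation velocity :: "(real \<Rightarrow> complex) \<Rightarrow> real \<Rightarrow> complex" where
  "velocity \<gamma> s \<equiv> vector_derivative \<gamma> (at s)"

definition C2_curve :: "(real \<Rightarrow> complex) \<Rightarrow> bool" where
  "C2_curve \<gamma> \<longleftrightarrow> \<gamma> C1_differentiable_on UNIV \<and> velocity \<gamma> C1_differentiable_on UNIV"

definition simple_closed_arclength :: "(real \<Rightarrow> complex) \<Rightarrow> real \<Rightarrow> bool" where
  "simple_closed_arclength \<gamma> L \<longleftrightarrow>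
     L > 0 \<and> (\<forall>s. \<gamma> (s + L) = \<gamma> s) \<and> simple_path (\<lambda>t. \<gamma> (L * t)) \<and>
     (\<forall>s. norm (velocity \<gamma> s) = 1)"

definition counterclockwise :: "(real \<Rightarrow> complex) \<Rightarrow> real \<Rightarrow> bool" where
  "counterclockwise \<gamma> L \<longleftrightarrow>
     (\<forall>z \<in> inside (range \<gamma>). winding_number (\<lambda>t. \<gamma> (L * t)) z = 1)"

text \<open>Signed curvature of a unit-speed curve: \<open>\<gamma>'' = \<kappa> \<i> \<gamma>'\<close>.\<close>

definition curvature :: "(real \<Rightarrow> complex) \<Rightarrow> real \<Rightarrow> real" where
  "curvature \<gamma> s = vector_derivative (velocity \<gamma>) (at s) \<bullet> (\<i> * velocity \<gamma> s)"

definition centrally_symmetric :: "complex set \<Rightarrow> bool" where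
  "centrally_symmetric S \<longleftrightarrow> (\<exists>c. \<forall>z\<in>S. 2 * c - z \<in> S)"

definition is_ellipse :: "complex set \<Rightarrow> bool" where
  "is_ellipse S \<longleftrightarrow>
     (\<exists>c u a b. norm u = 1 \<and> a > 0 \<and> b > 0 \<and>
        S = {z. (((z - c) \<bullet> u) / a)\<^sup>2 + (((z - c) \<bullet> (\<i> * u)) / b)\<^sup>2 = 1})"


text \<open>
  An oriented line is a pair \<open>(n, p)\<close>, where \<open>n = cis \<phi>\<close> is its right unit normal and
  \<open>p\<close> the signed distance from the origin. These are the coordinates \<open>(p, \<phi>)\<close>, with the
  angle \<open>\<phi>\<close> modulo \<open>2 * pi\<close> replaced by the point \<open>cis \<phi>\<close> of the unit circle. Only
  pairs with \<open>norm n = 1\<close> are meaningful; they form a cylinder embedded in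
  \<^typ>\<open>complex \<times> real\<close>, which supplies topology and differentiable structure.
\<close>

type_synonym oriented_line = "complex \<times> real"

definition direction :: "oriented_line \<Rightarrow> complex" where
  "direction x = \<i> * fst x"

definition points_of :: "oriented_line \<Rightarrow> complex set" where
  "points_of x = {z. z \<bullet> fst x = snd x}"

definition line_through :: "complex \<Rightarrow> complex \<Rightarrow> oriented_line" where
  "line_through q u = (- \<i> * u, q \<bullet> (- \<i> * u))"

definition phase_cylinder :: "(real \<Rightarrow> complex) \<Rightarrow> oriented_line set" where
  "phase_cylinder \<gamma> = {x. norm (fst x) = 1 \<and> points_of x \<inter> inside (range \<gamma>) \<noteq> {}}"

text \<open>
  The curves considered are strictly convex, so a line of the phase cylinder meets the curve in
  exactly two points.
\<close>

definition entry_point :: "(real \<Rightarrow> complex) \<Rightarrow> oriented_line \<Rightarrow> complex" where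
  "entry_point \<gamma> x = (THE z. z \<in> range \<gamma> \<inter> points_of x \<and>
     (\<forall>w \<in> range \<gamma> \<inter> points_of x. z \<bullet> direction x \<le> w \<bullet> direction x))"

definition exit_point :: "(real \<Rightarrow> complex) \<Rightarrow> oriented_line \<Rightarrow> complex" where
  "exit_point \<gamma> x = (THE z. z \<in> range \<gamma> \<inter> points_of x \<and>
     (\<forall>w \<in> range \<gamma> \<inter> points_of x. w \<bullet> direction x \<le> z \<bullet> direction x))"

definition tangent_at :: "(real \<Rightarrow> complex) \<Rightarrow> complex \<Rightarrow> complex" where
  "tangent_at \<gamma> q = (THE t. \<exists>s. \<gamma> s = q \<and> t = velocity \<gamma> s)"

text \<open>Reflection in the tangent line directed by the unit vector \<open>t\<close>.\<close>

definition reflect :: "complex \<Rightarrow> complex \<Rightarrow> complex" where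
  "reflect t u = (2 * (t \<bullet> u)) *\<^sub>R t - u"

definition billiard_map :: "(real \<Rightarrow> complex) \<Rightarrow> oriented_line \<Rightarrow> oriented_line" where
  "billiard_map \<gamma> x =
     (let q = exit_point \<gamma> x in line_through q (reflect (tangent_at \<gamma> q) (direction x)))"

text \<open>
  The boundary component \<open>\<delta> = 0\<close> consists of the tangent lines oriented like the curve.
\<close>

definition boundary_delta_0 :: "(real \<Rightarrow> complex) \<Rightarrow> oriented_line set" where
  "boundary_delta_0 \<gamma> = range (\<lambda>s. line_through (\<gamma> s) (velocity \<gamma> s))"


text \<open>
  The projection \<^term>\<open>fst\<close> of the cylinder to the unit circle computes how often a loop winds
  around the cylinder; the sign depends on the direction in which the loop is traversed.
\<close>

definition rotational_curve :: "(real \<Rightarrow> complex) \<Rightarrow> oriented_line set \<Rightarrow> bool" where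
  "rotational_curve \<gamma> \<alpha> \<longleftrightarrow>
     (\<exists>c. simple_path c \<and> pathfinish c = pathstart c \<and> path_image c = \<alpha> \<and>
          \<alpha> \<subseteq> phase_cylinder \<gamma> \<and> winding_number (fst \<circ> c) 0 \<in> {1, - 1})"

text \<open>
  Average number of turns per reflection: \<open>s k\<close> is the parameter of the \<open>k\<close>-th
  reflection point, lifted to the real line so that each step advances counterclockwise by less
  than one turn. For a 4-periodic orbit the value \<open>1/4\<close> means one turn in 4 reflections.
\<close>

definition has_rotation_number ::
  "(real \<Rightarrow> complex) \<Rightarrow> real \<Rightarrow> oriented_line \<Rightarrow> real \<Rightarrow> bool" where
  "has_rotation_number \<gamma> L x \<rho> \<longleftrightarrow>
     (\<exists>s :: nat \<Rightarrow> real.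
        (\<forall>k. \<gamma> (s k) = entry_point \<gamma> ((billiard_map \<gamma> ^^ k) x) \<and>
             s k < s (Suc k) \<and> s (Suc k) < s k + L) \<and>
        (\<lambda>k. (s k - s 0) / (real k * L)) \<longlonglongrightarrow> \<rho>)"

text \<open>
  For a rotational curve \<open>\<alpha>\<close> exactly one component of its complement in the phase cylinder
  is adherent to \<open>\<delta> = 0\<close>.
\<close>

definition lower_domain :: "(real \<Rightarrow> complex) \<Rightarrow> oriented_line set \<Rightarrow> oriented_line set" where
  "lower_domain \<gamma> \<alpha> =
     {x \<in> phase_cylinder \<gamma> - \<alpha>.
        boundary_delta_0 \<gamma> \<subseteq> closure (connected_component_set (phase_cylinder \<gamma> - \<alpha>) x)}"


text \<open>
  An oriented line in a tangent plane of the cylinder is given by its positive unit vector.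
  Derivatives of maps on the cylinder are taken within \<^const>\<open>phase_cylinder\<close>; as linear maps on
  \<^typ>\<open>complex \<times> real\<close> they are not unique, but their values on tangent vectors are.
\<close>

definition tangent_plane :: "oriented_line \<Rightarrow> (complex \<times> real) set" where
  "tangent_plane x = {v. fst v \<bullet> fst x = 0}"

definition oriented_line_bundle ::
  "oriented_line set \<Rightarrow> (oriented_line \<Rightarrow> complex \<times> real) \<Rightarrow> bool" where
  "oriented_line_bundle M l \<longleftrightarrow> (\<forall>x\<in>M. l x \<in> tangent_plane x \<and> norm (l x) = 1)"

text \<open>
  Lebesgue measurability in the coordinates \<open>(\<phi>, p)\<close>; the embedded cylinder itself is a null
  set of \<^typ>\<open>complex \<times> real\<close>.
\<close>

definition measurable_bundle ::
  "oriented_line set \<Rightarrow> (oriented_line \<Rightarrow> complex \<times> real) \<Rightarrow> bool" where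
  "measurable_bundle M l \<longleftrightarrow>
     (\<lambda>(\<phi> :: real, p :: real). l (cis \<phi>, p))
       \<in> borel_measurable (lebesgue_on {(\<phi>, p). (cis \<phi>, p) \<in> M})"

definition invariant_bundle ::
  "(real \<Rightarrow> complex) \<Rightarrow> oriented_line set \<Rightarrow> (oriented_line \<Rightarrow> complex \<times> real) \<Rightarrow> bool" where
  "invariant_bundle \<gamma> M l \<longleftrightarrow>
     (\<forall>x\<in>M. \<exists>D c. (billiard_map \<gamma> has_derivative D) (at x within phase_cylinder \<gamma>) \<and>
        c > 0 \<and> D (l x) = c *\<^sub>R l (billiard_map \<gamma> x))"

text \<open>
  \<open>circle_differential \<gamma> \<eta> f x v d\<close>: the differential at \<open>x\<close> of the circle-valued coordinate
  \<open>\<theta>\<close> given by \<open>\<eta> (\<theta> y) = f y\<close> takes the value \<open>d\<close> on the tangent vector \<open>v\<close>; here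
  \<open>\<theta>\<close> is a real-valued branch near \<open>x\<close>, and \<open>\<eta>\<close> is a periodic parametrization of a simple
  closed curve.
\<close>

definition circle_differential ::
  "(real \<Rightarrow> complex) \<Rightarrow> (real \<Rightarrow> complex) \<Rightarrow> (oriented_line \<Rightarrow> complex) \<Rightarrow>
     oriented_line \<Rightarrow> complex \<times> real \<Rightarrow> real \<Rightarrow> bool" where
  "circle_differential \<gamma> \<eta> f x v d \<longleftrightarrow>
     (\<exists>\<theta> D. \<eta> (\<theta> x) = f x \<and> (\<forall>\<^sub>F y in at x within phase_cylinder \<gamma>. \<eta> (\<theta> y) = f y) \<and>
        (\<theta> has_derivative D) (at x within phase_cylinder \<gamma>) \<and> D v = d)"

definition ds :: "(real \<Rightarrow> complex) \<Rightarrow> oriented_line \<Rightarrow> complex \<times> real \<Rightarrow> real \<Rightarrow> bool" where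
  "ds \<gamma> = circle_differential \<gamma> \<gamma> (entry_point \<gamma>)"

definition dphi :: "(real \<Rightarrow> complex) \<Rightarrow> oriented_line \<Rightarrow> complex \<times> real \<Rightarrow> real \<Rightarrow> bool" where
  "dphi \<gamma> = circle_differential \<gamma> cis fst"

text \<open>
  The leaves \<open>s = const\<close> and \<open>\<phi> = const\<close> are tangent to the kernels of the differentials, so
  positivity expresses both transversality and the choice of orientation.
\<close>

definition s_monotone ::
  "(real \<Rightarrow> complex) \<Rightarrow> oriented_line set \<Rightarrow> (oriented_line \<Rightarrow> complex \<times> real) \<Rightarrow> bool" where
  "s_monotone \<gamma> M l \<longleftrightarrow> (\<forall>x\<in>M. \<exists>d>0. ds \<gamma> x (l x) d)"

definition phi_monotone ::
  "(real \<Rightarrow> complex) \<Rightarrow> oriented_line set \<Rightarrow> (oriented_line \<Rightarrow> complex \<times> real) \<Rightarrow> bool" where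
  "phi_monotone \<gamma> M l \<longleftrightarrow> (\<forall>x\<in>M. \<exists>d>0. dphi \<gamma> x (l x) d)"

end

theory Submission
  imports Defs "HOL-Complex_Analysis.Riemann_Mapping"
begin

text \<open>
  Parametrize the curve by its normal angle \<open>\<psi>\<close>, with support function \<open>h\<close> about the centre of symmetry.
  In terms of the normal angles of the impacts, reflection is a monotone twist condition, so two
  critical quadrilaterals cannot touch without coinciding. Hence the orbits of \<open>\<alpha>\<close> form a totally ordered
  one-parameter family that contains every 4-periodic orbit of rotation number \<open>1/4\<close>; a quadrilateral of
  \<open>\<alpha>\<close> and its rotation by a half turn cannot be strictly ordered, so all of them are parallelograms. Consequently
  \<open>\<alpha>\<close> is the graph \<open>\<delta> = d \<psi>\<close> with \<open>h \<psi> = R sin (d \<psi>)\<close> and \<open>d (\<psi> + \<pi>/2) = \<pi>/2 - d \<psi>\<close>.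

  A monotone invariant line field has a slope \<open>w = dp/d\<phi>\<close> that is bounded and satisfies, by the
  arithmetic-geometric mean inequality, \<open>w(Tx) p(Tx)\<^sup>2 - w(x) p(x)\<^sup>2 \<ge> K(x)\<close> for an explicit \<open>K\<close>. Since \<open>T\<close> preserves
  \<open>dp d\<phi>\<close>, the integral of \<open>K\<close> below \<open>\<alpha>\<close> is nonpositive. Integrating by parts and averaging over the shift by
  \<open>\<pi>/2\<close> turns this integral into a positive multiple of \<open>\<integral> (u'\<^sup>2 - 4 u\<^sup>2)\<close> with \<open>u = (h\<^sup>2)'\<close>, where \<open>u (\<psi> + \<pi>/2) = - u \<psi>\<close>. The
  Wirtinger inequality then forces \<open>h\<^sup>2 = a + b cos 2(\<psi> - z)\<close>, which is the support function of an ellipse.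
\<close>

subsection \<open>Periodic functions and circle-valued functions\<close>

text \<open>Only continuity of \<open>h2\<close> and measurability of the line field are available,
  and this shapes the analysis. The field is never differentiated: it enters through its slopes on
  the two lines meeting at one impact, and the two terms cancel after integration because incoming
  and outgoing lines carry the same measure \<open>dp d\<phi>\<close>. The cancellation needs
  integrable slopes. Boundedness comes from monotonicity: the reflection at the exit end bounds the
  slope of a line from above, the one at the entry end from below. Integration by parts uses an
  explicit potential in \<open>d\<close> and its first derivative, so the second derivative of
  \<open>d\<close> is never differentiated. Averaging over the shift by \<pi>/2 works because it
  replaces \<open>d\<close> by \<open>pi / 2 - d\<close>: in the coefficient of the square of the
  second derivative, the transcendental term \<open>moment_ss_cc d\<close> then adds up with its
  complement to the constant \<open>pi / 16\<close>. Angles are kept on the real line, so that a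
  4-periodic orbit of one turn is a point moved by exactly \<open>(2 * pi, 0)\<close>, and comparing
  orbits means comparing real numbers.\<close>

lemma shift_int:
  fixes f :: "real \<Rightarrow> real"
  assumes "\<And>x. f (x + T) = f x + w"
  shows "f (x + T * of_int k) = f x + w * of_int k"
proof (induction k rule: int_induct[where k = 0])
  case (step1 i)
  then show ?case using assms[of "x + T * of_int i"] by (simp add: algebra_simps)
next
  case (step2 i)
  then show ?case using assms[of "x + T * of_int (i - 1)"] by (simp add: algebra_simps)
qed simp

lemma periodic_int:
  assumes "\<And>x :: real. f (x + T) = f x"
  shows "f (x + T * of_int k) = f x"
proof (induction k rule: int_induct[where k = 0])
  case (step1 i)
  then show ?case using assms[of "x + T * of_int i"] by (simp add: algebra_simps)
next
  case (step2 i)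
  then show ?case using assms[of "x + T * of_int (i - 1)"] by (simp add: algebra_simps)
qed simp

lemma cis_add_pi: "cis (t + pi) = - cis t"
  by (simp add: complex_eq_iff)

lemma cis_add_2pi: "cis (t + 2 * pi) = cis t"
  by (simp add: complex_eq_iff)

lemma cis_add_2pi_int: "cis (t + 2 * pi * of_int k) = cis t"
  by (rule periodic_int[where f = cis and T = "2 * pi", OF cis_add_2pi])

lemma cis_has_vector_derivative: "(cis has_vector_derivative \<i> * cis t) (at t)"
  using has_derivative_cis[OF has_derivative_ident] by (simp add: has_vector_derivative_def)

lemma cis_norm_1:
  assumes "norm z = 1"
  obtains a where "z = cis a"
  using rcis_cmod_Arg[of z] assms that[of "Arg z"] by (simp add: rcis_def)

lemma cis_eq_imp_diff:
  assumes "cis a = cis b"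
  obtains n :: int where "a = b + 2 * pi * of_int n"
proof -
  have "sin a = sin b \<and> cos a = cos b" using assms by (simp add: complex_eq_iff)
  then show thesis using that sin_cos_eq_iff[of a b] by (auto simp: mult.commute mult.left_commute)
qed

text \<open>Numbers with the same \<open>cis\<close> are equal or at least \<open>2 * pi\<close>
  apart, so \<open>f\<close> has discrete range. This makes two lifts of one circle-valued map
  differ by a constant.\<close>

lemma constant_of_cis_constant:
  fixes f :: "'a::topological_space \<Rightarrow> real"
  assumes "connected S" "continuous_on S f" "\<And>x. x \<in> S \<Longrightarrow> cis (f x) = w" "x \<in> S" "y \<in> S"
  shows "f x = f y"
proof -
  have "f constant_on S"
  proof (rule continuous_discrete_range_constant[OF assms(1,2)])
    fix x assume x: "x \<in> S"
    show "\<exists>e>0. \<forall>y. y \<in> S \<and> f y \<noteq> f x \<longrightarrow> e \<le> norm (f y - f x)"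
    proof (intro exI[of _ "2 * pi"] conjI allI impI)
      fix y assume y: "y \<in> S \<and> f y \<noteq> f x"
      then have "cis (f y) = cis (f x)" using assms(3) x by simp
      then obtain n :: int where n: "f y = f x + 2 * pi * of_int n" by (rule cis_eq_imp_diff)
      then have "n \<noteq> 0" using y by auto
      then have "1 \<le> \<bar>of_int n :: real\<bar>" by linarith
      then show "2 * pi \<le> norm (f y - f x)" using n by (simp add: abs_mult)
    qed simp
  qed
  then show ?thesis using assms(4,5) by (auto simp: constant_on_def)
qed

lemma cis_Im_eq_sgn: "cis (Im l) = sgn (exp l)"
  by (simp add: exp_eq_polar[of l] sgn_div_norm norm_mult scaleR_conv_of_real)

subsection \<open>Antiderivatives and the Wirtinger inequality\<close>

text \<open>With a primitive on the whole line, shifts, periods and integrations by parts become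
  statements about derivatives.\<close>

lemma antiderivative_exists:
  fixes f :: "real \<Rightarrow> real"
  assumes "continuous_on UNIV f"
  obtains F where "\<And>x. (F has_real_derivative f x) (at x)"
proof
  fix x :: real
  define a where "a = min x 0 - 1"
  define b where "b = max x 0 + 1"
  have ab: "a < x" "x < b" "a \<le> 0" "0 \<le> b" by (auto simp: a_def b_def)
  have "((\<lambda>u. LBINT y=0..u. f y) has_vector_derivative f x) (at x within {a..b})"
    using interval_integral_FTC2[of a 0 b f x] ab assms
    by (auto intro: continuous_on_subset simp: zero_ereal_def)
  then show "((\<lambda>u. LBINT y=0..u. f y) has_real_derivative f x) (at x)"
    using ab at_within_interior[of x "{a..b}"] by (simp add: has_real_derivative_iff_has_vector_derivative)
qed

lemma antiderivative_periodic:
  fixes f F :: "real \<Rightarrow> real"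
  assumes F: "\<And>x. (F has_real_derivative f x) (at x)" and per: "\<And>x. f (x + T) = f x"
  shows "F (a + T) - F a = F (b + T) - F b"
proof -
  have "((\<lambda>x. F (x + T) - F x) has_real_derivative 0) (at x)" for x
  proof -
    have "((\<lambda>x. F (x + T)) has_real_derivative f (x + T)) (at x)"
      using F[of "x + T"] by (simp add: DERIV_shift)
    from DERIV_diff[OF this F[of x]] show ?thesis by (simp add: per)
  qed
  then show ?thesis using DERIV_isconst_all[of "\<lambda>x. F (x + T) - F x" a b] by simp
qed

lemma integral_eq_antiderivative:
  fixes f F :: "real \<Rightarrow> real"
  assumes F: "\<And>x. (F has_real_derivative f x) (at x)" and "a \<le> b"
  shows "integral {a..b} f = F b - F a"
  using assms
  by (intro integral_unique fundamental_theorem_of_calculus)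
     (auto simp flip: has_real_derivative_iff_has_vector_derivative intro: has_field_derivative_at_within)

text \<open>The square of \<open>f\<close> vanishes to second order at \<open>a\<close> while the
  cotangent has a simple pole. This disposes of the boundary terms in
  \<open>Wirtinger_equality\<close>.\<close>

lemma square_cot_tendsto_0:
  fixes f :: "real \<Rightarrow> real"
  assumes "(f has_real_derivative D) (at a)" "f a = 0"
  shows "(\<lambda>t. (f t)\<^sup>2 * (cos (2 * (t - a)) / sin (2 * (t - a)))) \<midarrow>a\<rightarrow> 0"
proof -
  have 1: "(\<lambda>t. f t / (t - a)) \<midarrow>a\<rightarrow> D"
    using assms by (simp add: has_field_derivative_iff)
  have "((\<lambda>t. sin (2 * (t - a))) has_real_derivative 2) (at a)"
    by (auto intro!: derivative_eq_intros)
  then have "(\<lambda>t. sin (2 * (t - a)) / (t - a)) \<midarrow>a\<rightarrow> 2"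
    by (simp add: has_field_derivative_iff)
  then have 2: "(\<lambda>t. inverse (sin (2 * (t - a)) / (t - a))) \<midarrow>a\<rightarrow> inverse 2"
    by (rule tendsto_inverse) simp
  have 3: "f \<midarrow>a\<rightarrow> 0" using DERIV_isCont[OF assms(1)] assms(2) by (simp add: isCont_def)
  have 4: "(\<lambda>t. cos (2 * (t - a))) \<midarrow>a\<rightarrow> cos (2 * (a - a))"
    by (intro tendsto_intros)
  have "(\<lambda>t. f t * (f t / (t - a)) * inverse (sin (2 * (t - a)) / (t - a)) * cos (2 * (t - a))) \<midarrow>a\<rightarrow> 0 * D * inverse 2 * cos (2 * (a - a))"
    by (intro tendsto_mult 1 2 3 4)
  moreover have "\<forall>\<^sub>F t in at a. f t * (f t / (t - a)) * inverse (sin (2 * (t - a)) / (t - a)) * cos (2 * (t - a))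
      = (f t)\<^sup>2 * (cos (2 * (t - a)) / sin (2 * (t - a)))"
  proof -
    have alg: "x * (x / r) * inverse (S / r) * C = x\<^sup>2 * (C / S)" if "r \<noteq> 0" for x r S C :: real
      using that by (cases "S = 0") (auto simp: power2_eq_square field_simps)
    show ?thesis unfolding eventually_at_filter by (intro always_eventually allI impI alg) simp
  qed
  ultimately show ?thesis using Lim_transform_eventually by fastforce
qed

text \<open>On an interval of length \<open>pi / 2\<close> starting at a zero \<open>z\<close> of
  \<open>U\<close>, a Riccati identity writes \<open>U'\<^sup>2 - 4 * U\<^sup>2\<close> as the
  derivative of \<open>2 * U\<^sup>2 * cot (2 * (t - z))\<close> plus the square of
  \<open>U' - 2 * U * cot (2 * (t - z))\<close>. The boundary terms vanish, so a nonpositive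
  integral kills the square and leaves a first-order equation solved by the sine.\<close>

lemma Wirtinger_equality:
  fixes U U' :: "real \<Rightarrow> real"
  assumes U: "\<And>x. (U has_real_derivative U' x) (at x)" and U': "continuous_on UNIV U'"
    and anti: "\<And>x. U (x + pi / 2) = - U x"
    and le: "integral {0..2 * pi} (\<lambda>x. (U' x)\<^sup>2 - 4 * (U x)\<^sup>2) \<le> 0"
  obtains C z where "\<And>x. U x = C * sin (2 * (x - z))"
proof -
  have contU: "isCont U x" for x using U DERIV_isCont by blast
  have "\<exists>z. U z = 0"
  proof (cases "U 0 \<le> 0")
    case True
    then show ?thesis using IVT[of U 0 0 "pi/2"] anti[of 0] contU by auto
  next
    case False
    then show ?thesis using IVT2[of U "pi/2" 0 0] anti[of 0] contU by auto
  qed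
  then obtain z where z: "U z = 0" by blast
  have anti': "U' (x + pi / 2) = - U' x" for x
  proof -
    have "((\<lambda>x. U (x + pi / 2)) has_real_derivative U' (x + pi / 2)) (at x)"
      using U[of "x + pi/2"] by (simp add: DERIV_shift)
    moreover have "((\<lambda>x. U (x + pi / 2)) has_real_derivative - U' x) (at x)"
      unfolding anti by (intro DERIV_minus U)
    ultimately show ?thesis by (rule DERIV_unique)
  qed
  define g where "g = (\<lambda>x. (U' x)\<^sup>2 - 4 * (U x)\<^sup>2)"
  have gc: "continuous_on UNIV g" unfolding g_def
    using contU by (intro continuous_intros U' continuous_at_imp_continuous_on) auto
  have gper: "g (x + pi / 2) = g x" for x by (simp add: g_def anti anti')
  obtain G where G: "\<And>x. (G has_real_derivative g x) (at x)" using antiderivative_exists[OF gc] by blast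
  have step: "G (a + pi / 2) - G a = G (z + pi / 2) - G z" for a
    using antiderivative_periodic[of G g "pi/2", OF G gper] by blast
  have "G (2 * pi) - G 0 = 4 * (G (z + pi / 2) - G z)"
    using step[of 0] step[of "pi/2"] step[of pi] step[of "pi + pi/2"] by (simp add: algebra_simps)
  moreover have "G (2 * pi) - G 0 \<le> 0"
    using le integral_eq_antiderivative[of G g 0 "2*pi", OF G] unfolding g_def by simp
  ultimately have Gle: "G (z + pi / 2) \<le> G z" by simp
  define w where "w = (\<lambda>t. (U t)\<^sup>2 * (cos (2 * (t - z)) / sin (2 * (t - z))))"
  define H where "H = (\<lambda>t. G t - 2 * (if t = z \<or> t = z + pi / 2 then 0 else w t))"
  have wz: "w \<midarrow>z\<rightarrow> 0" unfolding w_def by (rule square_cot_tendsto_0[OF U z])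
  have wz2: "w \<midarrow>(z + pi / 2)\<rightarrow> 0"
  proof -
    have "cos (2 * (t - (z + pi / 2))) / sin (2 * (t - (z + pi / 2))) = cos (2 * (t - z)) / sin (2 * (t - z))" for t
    proof -
      have "2 * (t - (z + pi / 2)) = 2 * (t - z) - pi" by (simp add: algebra_simps)
      then show ?thesis by (simp only: sin_diff cos_diff) simp
    qed
    then show ?thesis using square_cot_tendsto_0[OF U, of "z + pi/2"] z anti[of z] unfolding w_def by simp
  qed
  have dw: "(w has_real_derivative 2 * U t * U' t * (cos (2 * (t - z)) / sin (2 * (t - z)))
       - 2 * (U t)\<^sup>2 / (sin (2 * (t - z)))\<^sup>2) (at t)" if "z < t" "t < z + pi / 2" for t
  proof -
    have s: "sin (2 * (t - z)) \<noteq> 0" using that sin_gt_zero[of "2 * (t - z)"] by auto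
    have sc: "sin (2 * t - 2 * z) * sin (2 * t - 2 * z) + cos (2 * t - 2 * z) * cos (2 * t - 2 * z) = 1"
      by (metis power2_eq_square sin_cos_squared_add)
    show ?thesis unfolding w_def
      apply (rule derivative_eq_intros U refl s | use s in simp; fail)+
      using s
      apply (simp add: divide_simps)
      apply (simp add: power2_eq_square)
      apply (insert sc)
      apply algebra
      done
  qed
  have dH: "(H has_real_derivative (U' t - 2 * U t * (cos (2 * (t - z)) / sin (2 * (t - z))))\<^sup>2) (at t)"
    if t: "z < t" "t < z + pi / 2" for t
  proof -
    have s: "sin (2 * (t - z)) \<noteq> 0" using that sin_gt_zero[of "2 * (t - z)"] by auto
    have sc: "sin (2 * t - 2 * z) * sin (2 * t - 2 * z) + cos (2 * t - 2 * z) * cos (2 * t - 2 * z) = 1"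
      by (metis power2_eq_square sin_cos_squared_add)
    have *: "(U' t - 2 * U t * (cos (2 * (t - z)) / sin (2 * (t - z))))\<^sup>2 =
      g t - 2 * (2 * U t * U' t * (cos (2 * (t - z)) / sin (2 * (t - z)))
       - 2 * (U t)\<^sup>2 / (sin (2 * (t - z)))\<^sup>2)"
      using s unfolding g_def
      apply (simp add: divide_simps)
      apply (simp add: power2_eq_square)
      apply (insert sc)
      apply algebra
      done
    have "((\<lambda>t. G t - 2 * w t) has_real_derivative (U' t - 2 * U t * (cos (2 * (t - z)) / sin (2 * (t - z))))\<^sup>2) (at t)"
      unfolding * by (intro DERIV_diff G DERIV_cmult dw t)
    moreover have "\<forall>\<^sub>F s in nhds t. G s - 2 * w s = H s"
    proof -
      have "\<forall>\<^sub>F s in nhds t. s \<in> {z<..<z + pi / 2}"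
        using t by (intro eventually_nhds_in_open) auto
      then show ?thesis by eventually_elim (auto simp: H_def)
    qed
    ultimately show ?thesis by (subst (asm) DERIV_cong_ev[OF refl _ refl]) auto
  qed
  have contH: "isCont H t" if "z \<le> t" "t \<le> z + pi / 2" for t
  proof -
    have G0: "G \<midarrow>t\<rightarrow> G t" using DERIV_isCont[OF G] by (simp add: isCont_def)
    have "t = z \<or> t = z + pi / 2 \<or> (z < t \<and> t < z + pi / 2)" using that by linarith
    then consider "t = z" | "t = z + pi / 2" | "z < t" "t < z + pi / 2" by blast
    then show ?thesis
    proof cases
      case 3 then show ?thesis using dH DERIV_isCont by blast
    next
      case 1
      have "\<forall>\<^sub>F s in at z. s \<noteq> z \<and> s \<in> {..< z + pi/2}"
        unfolding eventually_at_filter using eventually_nhds_in_open[of "{..< z + pi/2}" z]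
        by (auto elim: eventually_mono)
      then have ev: "\<forall>\<^sub>F s in at z. G s - 2 * w s = H s"
        by eventually_elim (auto simp: H_def)
      have "(\<lambda>s. G s - 2 * w s) \<midarrow>z\<rightarrow> G z - 2 * 0"
        using G0 1 by (intro tendsto_intros wz) auto
      then have "H \<midarrow>z\<rightarrow> G z" using ev by (simp add: tendsto_cong)
      then show ?thesis unfolding 1 isCont_def by (simp add: H_def)
    next
      case 2
      have "\<forall>\<^sub>F s in at t. s \<noteq> t \<and> s \<in> {z<..}"
        unfolding eventually_at_filter using eventually_nhds_in_open[of "{z<..}" t] 2
        by (auto elim: eventually_mono)
      then have ev: "\<forall>\<^sub>F s in at t. G s - 2 * w s = H s"
        by eventually_elim (auto simp: H_def 2)
      have "(\<lambda>s. G s - 2 * w s) \<midarrow>t\<rightarrow> G t - 2 * 0"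
        using G0 wz2 unfolding 2 by (intro tendsto_intros) auto
      then have "H \<midarrow>t\<rightarrow> G t" using ev by (simp add: tendsto_cong)
      then show ?thesis unfolding isCont_def by (simp add: H_def 2)
    qed
  qed
  have mono: "H a \<le> H b" if "z \<le> a" "a \<le> b" "b \<le> z + pi / 2" for a b
  proof (rule DERIV_nonneg_imp_increasing_open[OF that(2)])
    fix x assume "a < x" "x < b"
    then show "\<exists>y. (H has_real_derivative y) (at x) \<and> 0 \<le> y" using dH[of x] that by force
  next
    show "continuous_on {a..b} H" using contH that by (intro continuous_at_imp_continuous_on) auto
  qed
  \<comment> \<open>The nondecreasing \<open>H\<close> starts at \<open>G z\<close> and ends at
    \<open>G (z + pi / 2)\<close>, which is no larger; so it is constant.\<close>
  have Hc: "H a = G z" if "z \<le> a" "a \<le> z + pi / 2" for a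
    using mono[of z a] mono[of a "z + pi/2"] that Gle by (simp add: H_def)
  have ode: "U' t = 2 * U t * (cos (2 * (t - z)) / sin (2 * (t - z)))" if t: "z < t" "t < z + pi / 2" for t
  proof -
    have "\<forall>\<^sub>F s in nhds t. H s = G z"
    proof -
      have "\<forall>\<^sub>F s in nhds t. s \<in> {z<..<z + pi / 2}"
        using t by (intro eventually_nhds_in_open) auto
      then show ?thesis by eventually_elim (auto simp: Hc)
    qed
    then have "(H has_real_derivative 0) (at t)"
      by (subst DERIV_cong_ev[OF refl _ refl]) auto
    then have "(U' t - 2 * U t * (cos (2 * (t - z)) / sin (2 * (t - z))))\<^sup>2 = 0"
      using DERIV_unique[OF dH[OF t]] by blast
    then show ?thesis by simp
  qed
  define C where "C = U (z + pi / 4)"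
  have U0: "U t = C * sin (2 * (t - z))" if t: "z < t" "t < z + pi / 2" for t
  proof -
    have s: "sin (2 * (t - z)) > 0" if "z < t" "t < z + pi / 2" for t
      using that sin_gt_zero[of "2 * (t - z)"] by auto
    have "(\<lambda>t. U t / sin (2 * (t - z))) t = (\<lambda>t. U t / sin (2 * (t - z))) (z + pi / 4)"
    proof (rule has_field_derivative_zero_constant[of "{z<..<z+pi/2}", THEN exE])
      show "convex {z<..<z + pi / 2}" by simp
      fix x assume x: "x \<in> {z<..<z + pi / 2}"
      have "((\<lambda>t. U t / sin (2 * (t - z))) has_real_derivative 0) (at x)"
        apply (rule derivative_eq_intros U refl | use s[of x] x in simp; fail)+
        using s[of x] x ode[of x] by (simp add: field_simps)
      then show "((\<lambda>t. U t / sin (2 * (t - z))) has_real_derivative 0) (at x within {z<..<z + pi / 2})"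
        by (rule has_field_derivative_at_within)
    next
      fix c assume "\<forall>x\<in>{z<..<z + pi / 2}. U x / sin (2 * (x - z)) = c"
      moreover have "t \<in> {z<..<z + pi / 2}" "z + pi/4 \<in> {z<..<z + pi / 2}" using t by auto
      ultimately show "(\<lambda>t. U t / sin (2 * (t - z))) t = (\<lambda>t. U t / sin (2 * (t - z))) (z + pi / 4)" by metis
    qed
    then show ?thesis using s[of t] t by (simp add: C_def field_simps)
  qed
  have U1: "U t = C * sin (2 * (t - z))" if t: "z \<le> t" "t < z + pi / 2" for t
    using U0[of t] z t by (cases "t = z") auto
  have shift: "U (t + pi / 2) = C * sin (2 * (t + pi / 2 - z)) \<longleftrightarrow> U t = C * sin (2 * (t - z))" for t
  proof -
    have "2 * (t + pi / 2 - z) = 2 * (t - z) + pi" by (simp add: algebra_simps)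
    then show ?thesis unfolding anti by (simp only: sin_add) simp
  qed
  have shiftn: "U (t + real n * (pi / 2)) = C * sin (2 * (t + real n * (pi / 2) - z)) \<longleftrightarrow> U t = C * sin (2 * (t - z))" for t n
  proof (induction n)
    case (Suc n)
    have "t + real (Suc n) * (pi / 2) = (t + real n * (pi / 2)) + pi / 2" by (simp add: algebra_simps)
    then show ?case using shift[of "t + real n * (pi / 2)"] Suc by (simp only:)
  qed simp
  have "U x = C * sin (2 * (x - z))" for x
  proof -
    define k where "k = \<lfloor>(x - z) / (pi / 2)\<rfloor>"
    define t where "t = x - of_int k * (pi / 2)"
    have "of_int k \<le> (x - z) / (pi / 2)" "(x - z) / (pi / 2) < of_int k + 1" unfolding k_def by linarith+
    then have "of_int k * (pi / 2) \<le> x - z" "x - z < (of_int k + 1) * (pi / 2)"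
      by (simp_all add: pos_le_divide_eq pos_divide_less_eq del: times_divide_eq_right)
    then have t: "z \<le> t" "t < z + pi / 2" by (simp_all add: t_def algebra_simps)
    show ?thesis
    proof (cases "k \<ge> 0")
      case True
      then have "x = t + real (nat k) * (pi / 2)" by (simp add: t_def)
      then show ?thesis using shiftn[of t "nat k"] U1[OF t] by simp
    next
      case False
      then have "t = x + real (nat (- k)) * (pi / 2)" by (simp add: t_def)
      then show ?thesis using shiftn[of x "nat (- k)"] U1[OF t] by simp
    qed
  qed
  then show thesis by (rule that)
qed

section \<open>The energy integral and its symmetrization by a quarter turn\<close>

definition moment_ss_cc :: "real \<Rightarrow> real" where
  "moment_ss_cc d = (d - sin d * cos d * ((cos d)\<^sup>2 - (sin d)\<^sup>2)) / 8"

definition moment_ssss :: "real \<Rightarrow> real" where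
  "moment_ssss d = (3 * d - 4 * sin d * cos d + sin d * cos d * ((cos d)\<^sup>2 - (sin d)\<^sup>2)) / 8"

lemma DERIV_moment_ss_cc:
  "(moment_ss_cc has_real_derivative (sin d)\<^sup>2 * (cos d)\<^sup>2) (at d within S)"
proof -
  have sc: "sin d * sin d + cos d * cos d = 1" by (metis power2_eq_square sin_cos_squared_add)
  show ?thesis unfolding moment_ss_cc_def [abs_def]
    apply (rule derivative_eq_intros refl | simp; fail)+
    apply (simp add: power2_eq_square)
    apply (insert sc)
    apply algebra
    done
qed

lemma DERIV_moment_ssss:
  "(moment_ssss has_real_derivative (sin d) ^ 4) (at d within S)"
proof -
  have sc: "sin d * sin d + cos d * cos d = 1" by (metis power2_eq_square sin_cos_squared_add)
  show ?thesis unfolding moment_ssss_def [abs_def]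
    apply (rule derivative_eq_intros refl | simp; fail)+
    apply (simp add: power2_eq_square power4_eq_xxxx)
    apply (insert sc)
    apply algebra
    done
qed

lemmas DERIV_moment_chain [derivative_intros] =
  DERIV_chain2[OF DERIV_moment_ss_cc] DERIV_chain2[OF DERIV_moment_ssss]

lemma moment_0 [simp]: "moment_ss_cc 0 = 0" "moment_ssss 0 = 0"
  by (simp_all add: moment_ss_cc_def moment_ssss_def)

text \<open>Integration by parts of \<open>(sin d) ^ 3 * sin d\<close>. The energy then contains
  only one transcendental quantity.\<close>

lemma moment_ssss_eq: "moment_ssss d = 3 * moment_ss_cc d - (sin d) ^ 3 * cos d"
proof -
  have sc: "sin d * sin d + cos d * cos d = 1" by (metis power2_eq_square sin_cos_squared_add)
  show ?thesis
    unfolding moment_ss_cc_def moment_ssss_def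
    apply (simp add: field_simps power2_eq_square power3_eq_cube)
    apply (insert sc)
    apply algebra
    done
qed

text \<open>The integrand is symmetric about \<open>pi / 4\<close>, and its integral over a quarter
  turn is \<open>pi / 16\<close>.\<close>

lemma moment_ss_cc_complement: "moment_ss_cc (pi / 2 - a) = pi / 16 - moment_ss_cc a"
proof -
  have co: "sin (pi / 2 - a) = cos a" "cos (pi / 2 - a) = sin a"
    by (simp_all add: sin_diff cos_diff)
  show ?thesis unfolding moment_ss_cc_def co by (simp add: field_simps)
qed

text \<open>\<open>x\<close> and \<open>y\<close> stand for the first two derivatives of \<open>d\<close>. The density is the inner integral of the energy for
  \<open>h = R sin d\<close>, divided by \<open>2 R\<^sup>4\<close>; the potential comes from integrating its symmetrization by parts to remove
  the terms linear in \<open>y\<close>.\<close>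

definition energy_density :: "real \<Rightarrow> real \<Rightarrow> real \<Rightarrow> real" where
  "energy_density d x y =
     ((sin d)\<^sup>2 + sin d * cos d * y - (sin d)\<^sup>2 * x\<^sup>2) *
     (sin d * cos d * y * moment_ss_cc d + ((sin d) ^ 3 * (cos d) ^ 3 - moment_ss_cc d) * x\<^sup>2)"

definition energy_potential :: "real \<Rightarrow> real \<Rightarrow> real" where
  "energy_potential d x =
     (sin d * cos d * moment_ss_cc d - pi / 16 * (cos d) ^ 3 * sin d) * x
   + (pi / 16 * (sin d) ^ 3 * cos d - sin d * cos d * moment_ss_cc d) * x ^ 3"

text \<open>Passing from \<open>(d, x, y)\<close> to \<open>(pi / 2 - d, - x, - y)\<close> is the
  effect of shifting the argument by \<open>pi / 2\<close>. In the sum the coefficient of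
  \<open>y\<^sup>2\<close> is \<open>pi / 16 * (sin d)\<^sup>2 * (cos d)\<^sup>2\<close>, which
  explains the factor \<open>pi / 64\<close>; the remainder is linear in \<open>y\<close> and
  exact.\<close>

lemma DERIV_energy_potential:
  assumes d: "(d has_real_derivative x t) (at t)" and x: "(x has_real_derivative y) (at t)"
  shows "((\<lambda>t. energy_potential (d t) (x t)) has_real_derivative
      (energy_density (d t) (x t) y + energy_density (pi / 2 - d t) (- x t) (- y)
        - pi / 64 * ((2 * sin (d t) * cos (d t) * y + 2 * ((cos (d t))\<^sup>2 - (sin (d t))\<^sup>2) * (x t)\<^sup>2)\<^sup>2
                     - 4 * (2 * sin (d t) * cos (d t) * x t)\<^sup>2))) (at t)"
proof -
  define S C A X where "S = sin (d t)" and "C = cos (d t)" and "A = moment_ss_cc (d t)" and "X = x t"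
  have c2: "C\<^sup>2 = 1 - S\<^sup>2" unfolding S_def C_def by (simp add: cos_squared_eq)
  have ev: "C ^ 4 = (1 - S\<^sup>2)\<^sup>2" "C ^ 3 = C * (1 - S\<^sup>2)"
    using c2 by (auto simp: power3_eq_cube power4_eq_xxxx power2_eq_square)
  have co: "sin (pi / 2 - a) = cos a" "cos (pi / 2 - a) = sin a" for a :: real
    by (simp_all add: sin_diff cos_diff)
  have s': "((\<lambda>t. sin (d t)) has_real_derivative C * X) (at t)"
    and c': "((\<lambda>t. cos (d t)) has_real_derivative - S * X) (at t)"
    and A': "((\<lambda>t. moment_ss_cc (d t)) has_real_derivative S\<^sup>2 * C\<^sup>2 * X) (at t)"
    unfolding S_def C_def X_def by (auto intro!: derivative_eq_intros d)
  \<comment> \<open>Sine, cosine and moment enter as abstract functions with prescribed derivatives;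
    what is left for the end is a polynomial identity modulo \<open>c2\<close>.\<close>
  have gen: "((\<lambda>t. (s t * c t * a t - pi / 16 * (c t) ^ 3 * s t) * x t
        + (pi / 16 * (s t) ^ 3 * c t - s t * c t * a t) * (x t) ^ 3) has_real_derivative
      ((C * C - S * S) * A + S * C * (S\<^sup>2 * C\<^sup>2) - pi / 16 * (C ^ 4 - 3 * C\<^sup>2 * S\<^sup>2)) * X * X
      + (S * C * A - pi / 16 * C ^ 3 * S) * y
      + ((pi / 16 * (3 * S\<^sup>2 * C\<^sup>2 - S ^ 4) - (C * C - S * S) * A - S * C * (S\<^sup>2 * C\<^sup>2)) * X * X ^ 3)
      + (pi / 16 * S ^ 3 * C - S * C * A) * (3 * X\<^sup>2 * y)) (at t)"
    if "(s has_real_derivative C * X) (at t)" "(c has_real_derivative - S * X) (at t)"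
      "(a has_real_derivative S\<^sup>2 * C\<^sup>2 * X) (at t)" "s t = S" "c t = C" "a t = A" for s c a
    by (rule derivative_eq_intros that(1,2,3) x refl)+
       (simp add: that(4,5,6) X_def[symmetric] algebra_simps power2_eq_square power3_eq_cube power4_eq_xxxx)
  have 1: "((\<lambda>t. energy_potential (d t) (x t)) has_real_derivative
      ((C * C - S * S) * A + S * C * (S\<^sup>2 * C\<^sup>2) - pi / 16 * (C ^ 4 - 3 * C\<^sup>2 * S\<^sup>2)) * X * X
      + (S * C * A - pi / 16 * C ^ 3 * S) * y
      + ((pi / 16 * (3 * S\<^sup>2 * C\<^sup>2 - S ^ 4) - (C * C - S * S) * A - S * C * (S\<^sup>2 * C\<^sup>2)) * X * X ^ 3)
      + (pi / 16 * S ^ 3 * C - S * C * A) * (3 * X\<^sup>2 * y)) (at t)"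
    unfolding energy_potential_def
    by (rule gen[OF s' c' A']) (simp_all add: S_def C_def A_def)
  show ?thesis
    apply (rule DERIV_cong[OF 1])
    unfolding energy_density_def co moment_ss_cc_complement
    unfolding S_def[symmetric] C_def[symmetric] A_def[symmetric] X_def[symmetric]
    using c2 by algebra
qed

text \<open>In terms of \<open>d\<close>, the function \<open>U\<close> below is the derivative of
  \<open>(sin d)\<^sup>2 = h\<^sup>2 / R\<^sup>2\<close>. It changes sign under the shift by
  \<open>pi / 2\<close>, so its lowest possible frequency is 2; hence the sharp constant 4 in the
  Wirtinger functional.\<close>

lemma energy_nonpos_imp_square_cosine:
  fixes h h1 h2 :: "real \<Rightarrow> real"
  assumes h: "\<And>x. (h has_real_derivative h1 x) (at x)"
    and h1: "\<And>x. (h1 has_real_derivative h2 x) (at x)"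
    and h2: "continuous_on UNIV h2"
    and pos: "\<And>x. h x > 0"
    and R: "\<And>x. (h x)\<^sup>2 + (h (x + pi / 2))\<^sup>2 = R\<^sup>2" "R > 0"
    and d: "\<And>x. sin (d x) = h x / R" "\<And>x. cos (d x) = h (x + pi / 2) / R" "\<And>x. 0 < d x" "\<And>x. d x < pi / 2"
    and le: "integral {0..2 * pi} (\<lambda>x. h x * (h x + h2 x) *
      ((h x * h2 x + 2 * (h1 x)\<^sup>2) * moment_ss_cc (d x) - (h1 x)\<^sup>2 * moment_ssss (d x))) \<le> 0"
  obtains a b z where "\<And>x. (h x)\<^sup>2 = a + b * cos (2 * (x - z))"
proof -
  define k k1 k2 where "k = (\<lambda>x. h (x + pi / 2))" and "k1 = (\<lambda>x. h1 (x + pi / 2))" and "k2 = (\<lambda>x. h2 (x + pi / 2))"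
  have k: "(k has_real_derivative k1 x) (at x)" and k1: "(k1 has_real_derivative k2 x) (at x)" for x
    using h[of "x + pi/2"] h1[of "x + pi/2"] unfolding k_def k1_def k2_def by (simp_all add: DERIV_shift)
  have hk: "h x * h x + k x * k x = R * R" for x using R(1)[of x] by (simp add: k_def power2_eq_square)
  have hk1: "h x * h1 x + k x * k1 x = 0" for x
  proof -
    have "((\<lambda>x. h x * h x + k x * k x) has_real_derivative (2 * (h x * h1 x + k x * k1 x))) (at x)"
      by (auto intro!: derivative_eq_intros h k)
    moreover have "((\<lambda>x. h x * h x + k x * k x) has_real_derivative 0) (at x)" unfolding hk by simp
    ultimately have "2 * (h x * h1 x + k x * k1 x) = 0" by (rule DERIV_unique)
    then show ?thesis by simp
  qed
  \<comment> \<open>The scaled Wronskian of \<open>h\<close> and \<open>k\<close> is the derivative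
    of \<open>arctan (h / k)\<close>, because \<open>h\<^sup>2 + k\<^sup>2 = R\<^sup>2\<close>;
    \<open>d'\<close> identifies it with the derivative of \<open>d\<close>.\<close>
  define x where "x = (\<lambda>t. (h1 t * k t - h t * k1 t) / R\<^sup>2)"
  define y where "y = (\<lambda>t. (h2 t * k t - h t * k2 t) / R\<^sup>2)"
  have x': "(x has_real_derivative y t) (at t)" for t unfolding x_def y_def
    apply (rule derivative_eq_intros h h1 k k1 refl | use R in simp; fail)+
    using R(2) by (simp add: field_simps power2_eq_square)
  have h1eq: "h1 t = k t * x t" for t
  proof -
    have "R * R * h1 t = k t * (h1 t * k t - h t * k1 t)" using hk[of t] hk1[of t] by algebra
    then show ?thesis using R(2) by (simp add: x_def field_simps power2_eq_square)
  qed
  have k1eq: "k1 t = - h t * x t" for t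
  proof -
    have "R * R * k1 t = - h t * (h1 t * k t - h t * k1 t)" using hk[of t] hk1[of t] by algebra
    then show ?thesis using R(2) by (simp add: x_def field_simps power2_eq_square)
  qed
  have h2eq: "h2 t = k t * y t - h t * (x t)\<^sup>2" for t
  proof -
    have "((\<lambda>t. k t * x t) has_real_derivative (k t * y t - h t * (x t)\<^sup>2)) (at t)"
      by (auto intro!: derivative_eq_intros k x' simp: k1eq power2_eq_square algebra_simps)
    then show ?thesis using DERIV_unique[OF h1[of t]] unfolding h1eq[abs_def, symmetric] by (simp add: h1eq[symmetric])
  qed
  have hR: "h t = R * sin (d t)" and kR: "k t = R * cos (d t)" for t
    using d(1)[of t] d(2)[of t] R(2) by (auto simp: k_def field_simps)
  have dper: "d (t + pi / 2) = pi / 2 - d t" for t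
  proof -
    have "sin (d (t + pi / 2)) = sin (pi / 2 - d t)"
      using d(1)[of "t + pi/2"] d(2)[of t] by (simp add: sin_diff)
    then show ?thesis using d(3,4)[of "t + pi/2"] d(3,4)[of t] sin_inj_pi[of "d (t + pi/2)" "pi/2 - d t"] by auto
  qed
  have dd: "d = (\<lambda>t. arcsin (h t / R))"
  proof
    fix t show "d t = arcsin (h t / R)" using d(1)[of t] d(3,4)[of t] arcsin_sin[of "d t"] by simp
  qed
  have d': "(d has_real_derivative x t) (at t)" for t
  proof -
    have c: "sqrt (1 - (h t / R)\<^sup>2) = cos (d t)"
      unfolding d(1)[symmetric] using d(3,4)[of t] cos_gt_zero[of "d t"]
      by (simp add: cos_squared_eq[symmetric])
    have "cos (d t) > 0" using d(3,4)[of t] cos_gt_zero[of "d t"] by simp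
    moreover have "-1 < h t / R" "h t / R < 1"
    proof -
      show "-1 < h t / R" using pos[of t] R(2) by (smt (verit) divide_pos_pos)
      show "h t / R < 1" unfolding d(1)[symmetric] using d(3,4)[of t] 
        by (smt (verit) sin_monotone_2pi sin_pi_half pi_gt_zero)
    qed
    ultimately have "((\<lambda>t. arcsin (h t / R)) has_real_derivative inverse (cos (d t)) * (h1 t / R)) (at t)"
      using DERIV_chain2[where f = arcsin and g = "\<lambda>t. h t / R" and x = t, OF DERIV_arcsin] DERIV_cdivide[OF h[of t], of R]
      unfolding c by blast
    moreover have "inverse (cos (d t)) * (h1 t / R) = x t"
      using R(2) \<open>cos (d t) > 0\<close> by (simp add: h1eq kR field_simps)
    ultimately show ?thesis using dd by metis
  qed
  have x2: "x (t + pi / 2) = - x t" for t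
  proof -
    have "((\<lambda>t. d (t + pi / 2)) has_real_derivative x (t + pi / 2)) (at t)"
      using d'[of "t + pi/2"] by (simp add: DERIV_shift)
    moreover have "((\<lambda>t. d (t + pi / 2)) has_real_derivative - x t) (at t)"
      unfolding dper by (auto intro!: derivative_eq_intros d')
    ultimately show ?thesis by (rule DERIV_unique)
  qed
  have y2: "y (t + pi / 2) = - y t" for t
  proof -
    have "((\<lambda>t. x (t + pi / 2)) has_real_derivative y (t + pi / 2)) (at t)"
      using x'[of "t + pi/2"] by (simp add: DERIV_shift)
    moreover have "((\<lambda>t. x (t + pi / 2)) has_real_derivative - y t) (at t)"
      unfolding x2 by (intro DERIV_minus x')
    ultimately show ?thesis by (rule DERIV_unique)
  qed
  have contd: "continuous_on UNIV d" and contx: "continuous_on UNIV x" and conth: "continuous_on UNIV h" and contk: "continuous_on UNIV k"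
    using d' x' h k by (meson DERIV_isCont continuous_at_imp_continuous_on)+
  have contk2: "continuous_on UNIV k2" unfolding k2_def
    by (rule continuous_on_compose2[OF h2]) (auto intro: continuous_intros)
  have conty: "continuous_on UNIV y" unfolding y_def using R
    by (intro continuous_intros conth contk h2 contk2) auto
  define I where "I = (\<lambda>t. energy_density (d t) (x t) (y t))"
  have contA: "continuous_on UNIV (\<lambda>t. moment_ss_cc (d t))"
    using d' by (intro continuous_at_imp_continuous_on ballI DERIV_isCont) (auto intro!: derivative_eq_intros)
  have contI: "continuous_on UNIV I" unfolding I_def energy_density_def
    by (intro continuous_intros contd contx conty contA)
  have Ieq: "h t * (h t + h2 t) * ((h t * h2 t + 2 * (h1 t)\<^sup>2) * moment_ss_cc (d t) - (h1 t)\<^sup>2 * moment_ssss (d t)) = R ^ 4 * I t" for t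
  proof -
    define S C A where "S = sin (d t)" and "C = cos (d t)" and "A = moment_ss_cc (d t)"
    have sc: "S * S + C * C = 1" unfolding S_def C_def by (metis power2_eq_square sin_cos_squared_add)
    have e: "(h t * h2 t + 2 * (h1 t)\<^sup>2) * moment_ss_cc (d t) - (h1 t)\<^sup>2 * moment_ssss (d t)
        = R\<^sup>2 * (S * C * y t * A + (S ^ 3 * C ^ 3 - A) * (x t)\<^sup>2)"
      unfolding moment_ssss_eq h1eq h2eq hR kR unfolding S_def[symmetric] C_def[symmetric] A_def[symmetric]
      using sc by algebra
    have f: "h t * (h t + h2 t) = R\<^sup>2 * (S\<^sup>2 + S * C * y t - S\<^sup>2 * (x t)\<^sup>2)"
      unfolding h2eq hR kR unfolding S_def[symmetric] C_def[symmetric] by algebra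
    show ?thesis unfolding e f unfolding I_def energy_density_def S_def[symmetric] C_def[symmetric] A_def[symmetric] by algebra
  qed
  define U where "U = (\<lambda>t. 2 * sin (d t) * cos (d t) * x t)"
  define U' where "U' = (\<lambda>t. 2 * sin (d t) * cos (d t) * y t + 2 * ((cos (d t))\<^sup>2 - (sin (d t))\<^sup>2) * (x t)\<^sup>2)"
  have U: "(U has_real_derivative U' t) (at t)" for t unfolding U_def U'_def
    by (auto intro!: derivative_eq_intros d' x' simp: algebra_simps power2_eq_square)
  have contU': "continuous_on UNIV U'" unfolding U'_def
    by (intro continuous_intros contd contx conty)
  have contU: "continuous_on UNIV U" unfolding U_def
    by (intro continuous_intros contd contx conty)
  have anti: "U (t + pi / 2) = - U t" for t unfolding U_def dper x2 by (simp add: sin_diff cos_diff)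
  define g where "g = (\<lambda>t. (U' t)\<^sup>2 - 4 * (U t)\<^sup>2)"
  have contg: "continuous_on UNIV g" unfolding g_def by (intro continuous_intros contU contU')
  obtain J where J: "\<And>t. (J has_real_derivative I t) (at t)" using antiderivative_exists[OF contI] by blast
  obtain G where G: "\<And>t. (G has_real_derivative g t) (at t)" using antiderivative_exists[OF contg] by blast
  define P where "P = (\<lambda>t. energy_potential (d t) (x t))"
  have P: "(P has_real_derivative I t + I (t + pi / 2) - pi / 64 * g t) (at t)" for t
    using DERIV_energy_potential[OF d' x'] unfolding P_def I_def g_def U'_def U_def dper x2 y2 .
  have dper4: "d (t + 2 * pi) = d t" "x (t + 2 * pi) = x t" "I (t + 2 * pi) = I t" for t
  proof -
    have e: "t + 2 * pi = (((t + pi / 2) + pi / 2) + pi / 2) + pi / 2" by simp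
    have e1: "d (t + 2 * pi) = d t" "x (t + 2 * pi) = x t" "y (t + 2 * pi) = y t"
      unfolding e dper x2 y2 by simp_all
    show "d (t + 2 * pi) = d t" "x (t + 2 * pi) = x t" "I (t + 2 * pi) = I t" by (simp_all add: e1 I_def)
  qed
  have Jper: "J (0 + 2 * pi) - J 0 = J (pi / 2 + 2 * pi) - J (pi / 2)"
    by (rule antiderivative_periodic[OF J]) (rule dper4)
  have Pper: "P (2 * pi) = P 0" using dper4[of 0] by (simp add: P_def)
  have "((\<lambda>t. J t + J (t + pi / 2) - pi / 64 * G t - P t) has_real_derivative 0) (at t)" for t
  proof -
    have "((\<lambda>t. J (t + pi / 2)) has_real_derivative I (t + pi / 2)) (at t)"
      using J[of "t + pi/2"] by (simp add: DERIV_shift)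
    then show ?thesis by (auto intro!: derivative_eq_intros J G P)
  qed
  then have "(\<lambda>t. J t + J (t + pi / 2) - pi / 64 * G t - P t) (2 * pi) = (\<lambda>t. J t + J (t + pi / 2) - pi / 64 * G t - P t) 0"
    using DERIV_isconst_all by blast
  then have "pi / 64 * (G (2 * pi) - G 0) = 2 * (J (2 * pi) - J 0)"
    using Jper Pper by (simp add: field_simps)
  moreover have "J (2 * pi) - J 0 \<le> 0"
  proof -
    have "integral {0..2 * pi} (\<lambda>t. R ^ 4 * I t) \<le> 0" using le unfolding Ieq .
    then have "R ^ 4 * integral {0..2 * pi} I \<le> 0" by simp
    then have "integral {0..2 * pi} I \<le> 0" using R(2) by (simp add: mult_le_0_iff)
    then show ?thesis using integral_eq_antiderivative[of J I 0 "2*pi", OF J] by simp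
  qed
  ultimately have "G (2 * pi) - G 0 \<le> 0" by (smt (verit) pi_gt_zero mult_pos_pos divide_pos_pos)
  then have "integral {0..2 * pi} (\<lambda>t. (U' t)\<^sup>2 - 4 * (U t)\<^sup>2) \<le> 0"
    using integral_eq_antiderivative[of G g 0 "2*pi", OF G] by (simp add: g_def)
  then obtain C z where C: "\<And>t. U t = C * sin (2 * (t - z))"
    using Wirtinger_equality[OF U contU' anti] by blast
  \<comment> \<open>\<open>R\<^sup>2 * U\<close> is the derivative of \<open>h\<^sup>2\<close>, so
    subtracting a primitive of \<open>R\<^sup>2 * C * sin (2 * (t - z))\<close> must leave a
    constant.\<close>
  define f where "f = (\<lambda>t. (h t)\<^sup>2 + R\<^sup>2 * C / 2 * cos (2 * (t - z)))"
  have "(f has_real_derivative 0) (at t)" for t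
  proof -
    have "2 * h t * h1 t = R\<^sup>2 * (C * sin (2 * (t - z)))"
      unfolding C[symmetric] U_def h1eq hR kR by (simp add: power2_eq_square)
    then show ?thesis unfolding f_def
      by (auto intro!: derivative_eq_intros h simp: algebra_simps)
  qed
  then have "f t = f 0" for t using DERIV_isconst_all by blast
  then have "(h t)\<^sup>2 = f 0 + (- R\<^sup>2 * C / 2) * cos (2 * (t - z))" for t
    unfolding f_def by (smt (verit) mult_minus_left divide_minus_left)
  then show thesis by (rule that)
qed

subsection \<open>Convex curves parametrized by the normal angle\<close>

text \<open>The parameter is the angle of the outer normal \<open>cis t\<close>, and
  \<open>\<rho>\<close> is the radius of curvature as a function of it.\<close>

locale convex_curve =
  fixes g :: "real \<Rightarrow> complex" and \<rho> :: "real \<Rightarrow> real"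
  assumes g_deriv: "\<And>t. (g has_vector_derivative \<rho> t *\<^sub>R (\<i> * cis t)) (at t)"
    and rho_cont: "continuous_on UNIV \<rho>"
    and rho_pos: "\<And>t. \<rho> t > 0"
    and g_periodic: "\<And>t. g (t + 2 * pi) = g t"
begin

lemma g_periodic_int: "g (t + 2 * pi * of_int k) = g t"
  by (rule periodic_int[where f = g and T = "2 * pi", OF g_periodic])

lemma g_cont: "continuous_on S g"
  using g_deriv by (meson continuous_at_imp_continuous_on has_vector_derivative_continuous)

lemma cis_dot_cis [simp]: "cis a \<bullet> cis b = cos (a - b)"
  and i_cis_dot_cis [simp]: "(\<i> * cis a) \<bullet> cis b = sin (b - a)"
  and cis_dot_i_cis [simp]: "cis b \<bullet> (\<i> * cis a) = sin (b - a)"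
  and i_cis_dot_i_cis [simp]: "(\<i> * cis a) \<bullet> (\<i> * cis b) = cos (a - b)"
  by (simp_all add: inner_complex_def cos_diff sin_diff)

lemma height_deriv:
  "((\<lambda>t. g t \<bullet> cis \<phi>) has_real_derivative - (\<rho> t * sin (t - \<phi>))) (at t)"
proof -
  have "((\<lambda>t. g t \<bullet> cis \<phi>) has_vector_derivative (\<rho> t *\<^sub>R (\<i> * cis t)) \<bullet> cis \<phi>) (at t)"
    by (rule bounded_linear.has_vector_derivative[OF bounded_linear_inner_left g_deriv])
  moreover have "(\<rho> t *\<^sub>R (\<i> * cis t)) \<bullet> cis \<phi> = - (\<rho> t * sin (t - \<phi>))"
    using sin_minus[of "t - \<phi>"] by simp
  ultimately show ?thesis by (simp add: has_real_derivative_iff_has_vector_derivative)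
qed

lemma height_decreasing:
  assumes "\<phi> \<le> a" "a < b" "b \<le> \<phi> + pi"
  shows "g b \<bullet> cis \<phi> < g a \<bullet> cis \<phi>"
proof (rule DERIV_neg_imp_decreasing_open[OF assms(2)])
  fix x assume "a < x" "x < b"
  then have "sin (x - \<phi>) > 0" using assms by (intro sin_gt_zero) auto
  then show "\<exists>y. ((\<lambda>t. g t \<bullet> cis \<phi>) has_real_derivative y) (at x) \<and> y < 0"
    using height_deriv[of \<phi> x] rho_pos[of x] by (intro exI conjI) auto
qed (intro continuous_intros g_cont)

lemma height_increasing:
  assumes "\<phi> - pi \<le> a" "a < b" "b \<le> \<phi>"
  shows "g a \<bullet> cis \<phi> < g b \<bullet> cis \<phi>"
proof (rule DERIV_pos_imp_increasing_open[OF assms(2)])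
  fix x assume "a < x" "x < b"
  then have "sin (\<phi> - x) > 0" using assms by (intro sin_gt_zero) auto
  then have "sin (x - \<phi>) < 0" using sin_minus[of "\<phi> - x"] by simp
  then show "\<exists>y. ((\<lambda>t. g t \<bullet> cis \<phi>) has_real_derivative y) (at x) \<and> y > 0"
    using height_deriv[of \<phi> x] mult_pos_neg[OF rho_pos[of x]] by (intro exI[of _ "- (\<rho> x * sin (x - \<phi>))"] conjI) auto
qed (intro continuous_intros g_cont)

lemma reduce_mod_2pi:
  obtains k :: int where "a \<le> t + 2 * pi * of_int k" "t + 2 * pi * of_int k < a + 2 * pi"
proof
  define k where "k = - \<lfloor>(t - a) / (2 * pi)\<rfloor>"
  have "of_int (- k) \<le> (t - a) / (2 * pi)" "(t - a) / (2 * pi) < of_int (- k) + 1" unfolding k_def by linarith+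
  then have "of_int (- k) * (2 * pi) \<le> t - a" "t - a < (of_int (- k) + 1) * (2 * pi)"
    by (simp_all add: pos_le_divide_eq pos_divide_less_eq del: times_divide_eq_right of_int_minus)
  then show "a \<le> t + 2 * pi * of_int k" "t + 2 * pi * of_int k < a + 2 * pi" by (simp_all add: algebra_simps)
qed

text \<open>The height in direction \<open>cis \<psi>\<close> rises during the half turn before
  \<open>\<psi>\<close> and falls during the half turn after it; every parameter can be moved by
  full turns into that range.\<close>

lemma support_le: "g t \<bullet> cis \<psi> \<le> g \<psi> \<bullet> cis \<psi>"
proof -
  obtain k :: int where k: "\<psi> - pi \<le> t + 2 * pi * of_int k" "t + 2 * pi * of_int k < \<psi> - pi + 2 * pi"
    using reduce_mod_2pi by blast
  let ?t = "t + 2 * pi * of_int k"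
  have "g ?t \<bullet> cis \<psi> \<le> g \<psi> \<bullet> cis \<psi>"
    using height_increasing[of \<psi> ?t \<psi>] height_decreasing[of \<psi> \<psi> ?t] k
    by (cases "?t < \<psi>"; cases "?t = \<psi>") auto
  then show ?thesis by (simp add: g_periodic_int)
qed

lemma support_eqD:
  assumes "g t \<bullet> cis \<psi> = g \<psi> \<bullet> cis \<psi>"
  obtains k :: int where "t = \<psi> + 2 * pi * of_int k"
proof -
  obtain k :: int where k: "\<psi> - pi \<le> t + 2 * pi * of_int k" "t + 2 * pi * of_int k < \<psi> - pi + 2 * pi"
    using reduce_mod_2pi by blast
  let ?t = "t + 2 * pi * of_int k"
  have "?t = \<psi>"
    using height_increasing[of \<psi> ?t \<psi>] height_decreasing[of \<psi> \<psi> ?t] k assms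
    by (cases "?t < \<psi>"; cases "?t = \<psi>") (auto simp: g_periodic_int)
  then show ?thesis using that[of "-k"] by (simp add: algebra_simps)
qed

lemma g_eqD:
  assumes "g a = g b"
  obtains k :: int where "a = b + 2 * pi * of_int k"
  using support_eqD[of a b] assms by auto

lemma g_eq_close: "g a = g b \<Longrightarrow> \<bar>a - b\<bar> < 2 * pi \<Longrightarrow> a = b"
proof -
  assume "g a = g b" "\<bar>a - b\<bar> < 2 * pi"
  then obtain k :: int where k: "a = b + 2 * pi * of_int k" using g_eqD by blast
  then have "2 * pi * \<bar>of_int k :: real\<bar> < 2 * pi" using \<open>\<bar>a - b\<bar> < 2 * pi\<close> by (simp add: abs_mult)
  then have "k = 0" by (auto simp: mult_less_cancel_left1)
  then show ?thesis using k by simp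
qed

lemma orthogonal_to_cis:
  assumes "z \<bullet> cis \<phi> = 0"
  shows "z = (z \<bullet> (\<i> * cis \<phi>)) *\<^sub>R (\<i> * cis \<phi>)"
proof -
  have "Re z * cos \<phi> + Im z * sin \<phi> = 0" using assms by (simp add: inner_complex_def)
  then have "Re z = (- Re z * sin \<phi> + Im z * cos \<phi>) * - sin \<phi>" "Im z = (- Re z * sin \<phi> + Im z * cos \<phi>) * cos \<phi>"
    using sin_cos_squared_add[of \<phi>] by algebra+
  then show ?thesis by (simp add: complex_eq_iff inner_complex_def)
qed

text \<open>The line through \<open>g a\<close> and \<open>g b\<close> directed towards
  \<open>g b\<close>, with right normal \<open>cis \<phi>\<close>. The inequalities choose lifts of
  the three angles; \<open>\<phi> - a\<close> and \<open>b - \<phi>\<close> are then the angles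
  between line and curve at the two ends.\<close>

definition chord :: "real \<Rightarrow> real \<Rightarrow> real \<Rightarrow> bool" where
  "chord a \<phi> b \<longleftrightarrow> g a \<bullet> cis \<phi> = g b \<bullet> cis \<phi> \<and> a < \<phi> \<and> \<phi> < a + pi \<and> \<phi> < b \<and> b < \<phi> + pi"

text \<open>Pairing \<open>g b - g a\<close> with the outer normal at \<open>b\<close> gives
  \<open>r * sin (b - \<phi>)\<close>, nonnegative by the support property. It is not zero, since
  \<open>g\<close> is injective on parameters less than a turn apart.\<close>

lemma chord_length:
  assumes "chord a \<phi> b"
  obtains r where "r > 0" "g b - g a = r *\<^sub>R (\<i> * cis \<phi>)"
proof -
  define r where "r = (g b - g a) \<bullet> (\<i> * cis \<phi>)"
  have r: "g b - g a = r *\<^sub>R (\<i> * cis \<phi>)" unfolding r_def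
    by (rule orthogonal_to_cis) (use assms in \<open>simp add: chord_def inner_diff_left\<close>)
  have "(g b - g a) \<bullet> cis b \<ge> 0" using support_le[of a b] by (simp add: inner_diff_left)
  then have 1: "r * sin (b - \<phi>) \<ge> 0" unfolding r by simp
  have "sin (b - \<phi>) > 0" using assms by (intro sin_gt_zero) (auto simp: chord_def)
  then have "r \<ge> 0" using 1 by (simp add: zero_le_mult_iff)
  moreover have "r \<noteq> 0"
  proof
    assume "r = 0"
    then have "g a = g b" using r by simp
    then show False using g_eq_close[of a b] assms by (auto simp: chord_def)
  qed
  ultimately show thesis using that r by simp
qed

lemma chord_exists_forward:
  assumes "a < \<phi>" "\<phi> < a + pi"
  shows "\<exists>!b. chord a \<phi> b"
proof -
  have 1: "g (\<phi> + pi) \<bullet> cis \<phi> < g a \<bullet> cis \<phi>"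
    using height_increasing[of \<phi> "\<phi> - pi" a] assms g_periodic[of "\<phi> - pi"] by (simp add: algebra_simps)
  have 2: "g a \<bullet> cis \<phi> < g \<phi> \<bullet> cis \<phi>"
    using height_increasing[of \<phi> a \<phi>] assms by simp
  have "\<exists>b. \<phi> \<le> b \<and> b \<le> \<phi> + pi \<and> g b \<bullet> cis \<phi> = g a \<bullet> cis \<phi>"
    by (rule IVT2') (use 1 2 in \<open>auto intro!: continuous_intros g_cont\<close>)
  then obtain b where b: "\<phi> \<le> b" "b \<le> \<phi> + pi" "g b \<bullet> cis \<phi> = g a \<bullet> cis \<phi>" by blast
  then have "chord a \<phi> b" using 1 2 assms unfolding chord_def by (cases "b = \<phi>"; cases "b = \<phi> + pi") auto
  moreover have "b' = b" if "chord a \<phi> b'" for b'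
    using that \<open>chord a \<phi> b\<close> height_decreasing[of \<phi> b b'] height_decreasing[of \<phi> b' b]
    unfolding chord_def by (cases "b < b'"; cases "b = b'") auto
  ultimately show ?thesis by blast
qed

lemma chord_exists_backward:
  assumes "\<phi> < b" "b < \<phi> + pi"
  shows "\<exists>!a. chord a \<phi> b"
proof -
  have 1: "g (\<phi> - pi) \<bullet> cis \<phi> < g b \<bullet> cis \<phi>"
    using height_decreasing[of \<phi> b "\<phi> + pi"] assms g_periodic[of "\<phi> - pi"] by (simp add: algebra_simps)
  have 2: "g b \<bullet> cis \<phi> < g \<phi> \<bullet> cis \<phi>"
    using height_decreasing[of \<phi> \<phi> b] assms by simp
  have "\<exists>a. \<phi> - pi \<le> a \<and> a \<le> \<phi> \<and> g a \<bullet> cis \<phi> = g b \<bullet> cis \<phi>"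
    by (rule IVT') (use 1 2 in \<open>auto intro!: continuous_intros g_cont\<close>)
  then obtain a where a: "\<phi> - pi \<le> a" "a \<le> \<phi>" "g a \<bullet> cis \<phi> = g b \<bullet> cis \<phi>" by blast
  then have "chord a \<phi> b" using 1 2 assms unfolding chord_def by (cases "a = \<phi>"; cases "a = \<phi> - pi") auto
  moreover have "a' = a" if "chord a' \<phi> b" for a'
    using that \<open>chord a \<phi> b\<close> height_increasing[of \<phi> a a'] height_increasing[of \<phi> a' a]
    unfolding chord_def by (cases "a < a'"; cases "a = a'") auto
  ultimately show ?thesis by blast
qed

text \<open>On the arc from \<open>a\<close> to \<open>b\<close> the height in direction
  \<open>cis \<phi>\<close> is at least that of the chord. A chord from the same point with larger
  angle ends strictly below that height, hence beyond \<open>b\<close>.\<close>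

lemma chord_twist_forward:
  assumes "chord a \<phi> b" "chord a \<phi>' b'" "\<phi> < \<phi>'"
  shows "b < b'"
proof (rule ccontr)
  assume "\<not> b < b'"
  obtain r where r: "r > 0" "g b' - g a = r *\<^sub>R (\<i> * cis \<phi>')" using chord_length[OF assms(2)] by blast
  have "sin (\<phi>' - \<phi>) > 0" using assms by (intro sin_gt_zero) (auto simp: chord_def)
  moreover have "(g b' - g a) \<bullet> cis \<phi> = - (r * sin (\<phi>' - \<phi>))" unfolding r using sin_minus[of "\<phi>' - \<phi>"] by simp
  ultimately have "g b' \<bullet> cis \<phi> < g a \<bullet> cis \<phi>"
    using mult_pos_pos[OF r(1), of "sin (\<phi>' - \<phi>)"] by (simp add: inner_diff_left)
  moreover have "g b' \<bullet> cis \<phi> \<ge> g a \<bullet> cis \<phi>"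
  proof (cases "b' \<le> \<phi>")
    case True
    then show ?thesis using height_increasing[of \<phi> a b'] assms by (auto simp: chord_def)
  next
    case False
    then show ?thesis using height_decreasing[of \<phi> b' b] assms \<open>\<not> b < b'\<close>
      by (cases "b = b'") (auto simp: chord_def)
  qed
  ultimately show False by simp
qed

lemma chord_twist_backward:
  assumes "chord a \<phi> b" "chord a' \<phi>' b" "\<phi> < \<phi>'"
  shows "a < a'"
proof (rule ccontr)
  assume "\<not> a < a'"
  obtain r where r: "r > 0" "g b - g a' = r *\<^sub>R (\<i> * cis \<phi>')" using chord_length[OF assms(2)] by blast
  have "sin (\<phi>' - \<phi>) > 0" using assms by (intro sin_gt_zero) (auto simp: chord_def)
  moreover have "(g b - g a') \<bullet> cis \<phi> = - (r * sin (\<phi>' - \<phi>))" unfolding r using sin_minus[of "\<phi>' - \<phi>"] by simp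
  ultimately have "g b \<bullet> cis \<phi> < g a' \<bullet> cis \<phi>"
    using mult_pos_pos[OF r(1), of "sin (\<phi>' - \<phi>)"] by (simp add: inner_diff_left)
  moreover have "g a' \<bullet> cis \<phi> \<le> g b \<bullet> cis \<phi>"
  proof (cases "\<phi> - pi \<le> a'")
    case True
    then show ?thesis using height_increasing[of \<phi> a' a] assms \<open>\<not> a < a'\<close>
      by (cases "a = a'") (auto simp: chord_def)
  next
    case False
    then show ?thesis using height_decreasing[of \<phi> b "a' + 2 * pi"] assms
      by (auto simp: chord_def g_periodic)
  qed
  ultimately show False by simp
qed

lemma chord_shift: "chord (a + 2 * pi) (\<phi> + 2 * pi) (b + 2 * pi) \<longleftrightarrow> chord a \<phi> b"
  unfolding chord_def g_periodic cis_add_2pi by auto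

end

subsection \<open>The bounce map and its four-periodic orbits\<close>

text \<open>Relative to \<open>C\<close>, the set \<open>A\<close> is closed as well as open. In the
  applications \<open>B\<close> is a closed relaxation of \<open>A\<close>, usually with weak
  instead of strict inequalities.\<close>

lemma connected_subset_open:
  assumes "connected C" "open A" "closed B" "C \<inter> B \<subseteq> A" "A \<subseteq> B" "C \<inter> A \<noteq> {}"
  shows "C \<subseteq> A"
proof (rule ccontr)
  assume "\<not> C \<subseteq> A"
  then have "C \<inter> (- B) \<noteq> {}" using assms(4) by blast
  moreover have "C \<subseteq> A \<union> - B" "A \<inter> - B \<inter> C = {}" using assms(4,5) by auto
  ultimately show False
    using connectedD[OF assms(1,2) open_Compl[OF assms(3)]] assms(6) by blast
qed

context convex_curve
begin

text \<open>An impact is the pair of the normal angle at the reflection point and the angle \<delta>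
  between tangent and ray. \<open>incoming\<close> and \<open>outgoing\<close> give the coordinates
  (\<phi>, p) of the two lines through it, lifted to the real line.\<close>

definition incoming :: "real \<times> real \<Rightarrow> real \<times> real" where
  "incoming y = (fst y - snd y, g (fst y) \<bullet> cis (fst y - snd y))"

definition outgoing :: "real \<times> real \<Rightarrow> real \<times> real" where
  "outgoing y = (fst y + snd y, g (fst y) \<bullet> cis (fst y + snd y))"

definition strip :: "(real \<times> real) set" where
  "strip = UNIV \<times> {0<..<pi}"

text \<open>The billiard map on impacts, lifted to the universal cover. The law of reflection is
  built in: one and the same \<open>snd\<close> serves for the line that arrives and the line that
  leaves.\<close>

definition bounce :: "real \<times> real \<Rightarrow> real \<times> real" where
  "bounce y = (let b = (THE b. chord (fst y) (fst y + snd y) b) in (b, b - fst y - snd y))"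

definition unbounce :: "real \<times> real \<Rightarrow> real \<times> real" where
  "unbounce y = (let a = (THE a. chord a (fst y - snd y) (fst y)) in (a, fst y - snd y - a))"

lemma mem_strip: "y \<in> strip \<longleftrightarrow> 0 < snd y \<and> snd y < pi"
  by (cases y) (simp add: strip_def)

lemma open_strip: "open strip"
  unfolding strip_def by (intro open_Times) auto

lemma bounce_props:
  assumes "y \<in> strip"
  shows "chord (fst y) (fst y + snd y) (fst (bounce y))" "fst (bounce y) = fst y + snd y + snd (bounce y)"
    "bounce y \<in> strip"
proof -
  have "\<exists>!b. chord (fst y) (fst y + snd y) b"
    using assms by (intro chord_exists_forward) (auto simp: mem_strip)
  then have *: "chord (fst y) (fst y + snd y) (THE b. chord (fst y) (fst y + snd y) b)" by (rule theI')
  show 1: "chord (fst y) (fst y + snd y) (fst (bounce y))" using * by (simp add: bounce_def Let_def)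
  show 2: "fst (bounce y) = fst y + snd y + snd (bounce y)" by (simp add: bounce_def Let_def)
  show "bounce y \<in> strip" using 1 2 by (auto simp: mem_strip chord_def)
qed

lemma unbounce_props:
  assumes "y \<in> strip"
  shows "chord (fst (unbounce y)) (fst y - snd y) (fst y)" "snd (unbounce y) = fst y - snd y - fst (unbounce y)"
    "unbounce y \<in> strip"
proof -
  have "\<exists>!a. chord a (fst y - snd y) (fst y)"
    using assms by (intro chord_exists_backward) (auto simp: mem_strip)
  then have *: "chord (THE a. chord a (fst y - snd y) (fst y)) (fst y - snd y) (fst y)" by (rule theI')
  show 1: "chord (fst (unbounce y)) (fst y - snd y) (fst y)" using * by (simp add: unbounce_def Let_def)
  show 2: "snd (unbounce y) = fst y - snd y - fst (unbounce y)" by (simp add: unbounce_def Let_def)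
  show "unbounce y \<in> strip" using 1 2 by (auto simp: mem_strip chord_def)
qed

lemma bounce_unique:
  assumes "y \<in> strip" "chord (fst y) (fst y + snd y) b"
  shows "bounce y = (b, b - fst y - snd y)"
proof -
  have "\<exists>!b. chord (fst y) (fst y + snd y) b"
    using assms by (intro chord_exists_forward) (auto simp: mem_strip)
  then have "fst (bounce y) = b" using bounce_props(1)[OF assms(1)] assms(2) by blast
  then show ?thesis using bounce_props(2)[OF assms(1)] by (simp add: prod_eq_iff)
qed

lemma incoming_bounce: "y \<in> strip \<Longrightarrow> incoming (bounce y) = outgoing y"
  using bounce_props[of y] by (simp add: incoming_def outgoing_def chord_def)

lemma outgoing_unbounce: "y \<in> strip \<Longrightarrow> outgoing (unbounce y) = incoming y"
  using unbounce_props[of y] by (simp add: incoming_def outgoing_def chord_def)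

text \<open>During the half turn after \<phi> the height is strictly decreasing, so a line
  determines its exit point.\<close>

lemma inj_on_incoming: "inj_on incoming strip"
proof (rule inj_onI)
  fix y z assume yz: "y \<in> strip" "z \<in> strip" "incoming y = incoming z"
  define \<phi> where "\<phi> = fst y - snd y"
  have \<phi>: "\<phi> = fst z - snd z" using yz by (simp add: incoming_def \<phi>_def)
  have "g (fst y) \<bullet> cis \<phi> = g (fst z) \<bullet> cis \<phi>" using yz(3) unfolding incoming_def \<phi>_def by (metis prod.inject)
  then have "fst y = fst z"
    using height_decreasing[of \<phi> "fst y" "fst z"] height_decreasing[of \<phi> "fst z" "fst y"] yz \<phi>
    by (cases "fst y < fst z"; cases "fst y = fst z") (auto simp: mem_strip \<phi>_def)
  then show "y = z" using \<phi> by (simp add: \<phi>_def prod_eq_iff)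
qed

lemma inj_on_outgoing: "inj_on outgoing strip"
proof (rule inj_onI)
  fix y z assume yz: "y \<in> strip" "z \<in> strip" "outgoing y = outgoing z"
  define \<phi> where "\<phi> = fst y + snd y"
  have \<phi>: "\<phi> = fst z + snd z" using yz by (simp add: outgoing_def \<phi>_def)
  have "g (fst y) \<bullet> cis \<phi> = g (fst z) \<bullet> cis \<phi>" using yz(3) unfolding outgoing_def \<phi>_def by (metis prod.inject)
  then have "fst y = fst z"
    using height_increasing[of \<phi> "fst y" "fst z"] height_increasing[of \<phi> "fst z" "fst y"] yz \<phi>
    by (cases "fst y < fst z"; cases "fst y = fst z") (auto simp: mem_strip \<phi>_def)
  then show "y = z" using \<phi> by (simp add: \<phi>_def prod_eq_iff)
qed

lemma continuous_on_g_comp [continuous_intros]: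
  "continuous_on S f \<Longrightarrow> continuous_on S (\<lambda>x. g (f x))"
  by (rule continuous_on_compose2[OF g_cont[of UNIV]]) auto

lemma continuous_on_incoming: "continuous_on S incoming"
  unfolding incoming_def by (intro continuous_intros)

lemma continuous_on_outgoing: "continuous_on S outgoing"
  unfolding outgoing_def by (intro continuous_intros)

lemma incoming_image_eq: "incoming ` strip = outgoing ` strip"
  using incoming_bounce outgoing_unbounce bounce_props(3) unbounce_props(3)
  by (metis (no_types, lifting) image_eqI image_subsetI subset_antisym)

text \<open>Invariance of domain. Since \<open>bounce\<close> is \<open>outgoing\<close> followed by
  this inverse, continuity of the billiard map needs no implicit function argument.\<close>

lemma continuous_on_inv_incoming: "continuous_on (incoming ` strip) (inv_into strip incoming)"
  by (rule continuous_on_inverse_open[OF open_strip continuous_on_incoming])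
     (auto intro: inv_into_f_f inj_on_incoming)

lemma bounce_eq_inv: "y \<in> strip \<Longrightarrow> bounce y = inv_into strip incoming (outgoing y)"
  using incoming_bounce[of y] bounce_props(3)[of y] inv_into_f_f[OF inj_on_incoming, of "bounce y"] by simp

lemma continuous_on_bounce: "continuous_on strip bounce"
proof (rule continuous_on_eq[where f = "\<lambda>y. inv_into strip incoming (outgoing y)"])
  show "continuous_on strip (\<lambda>y. inv_into strip incoming (outgoing y))"
    by (rule continuous_on_compose2[OF continuous_on_inv_incoming continuous_on_outgoing])
       (simp add: incoming_image_eq)
qed (simp add: bounce_eq_inv)

lemma mem_incoming_image:
  "(\<phi>, p) \<in> incoming ` strip \<longleftrightarrow> g (\<phi> + pi) \<bullet> cis \<phi> < p \<and> p < g \<phi> \<bullet> cis \<phi>"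
proof
  assume "(\<phi>, p) \<in> incoming ` strip"
  then obtain y where y: "y \<in> strip" "\<phi> = fst y - snd y" "p = g (fst y) \<bullet> cis \<phi>"
    by (auto simp: incoming_def)
  then show "g (\<phi> + pi) \<bullet> cis \<phi> < p \<and> p < g \<phi> \<bullet> cis \<phi>"
    using height_decreasing[of \<phi> \<phi> "fst y"] height_decreasing[of \<phi> "fst y" "\<phi> + pi"]
    by (auto simp: mem_strip)
next
  assume p: "g (\<phi> + pi) \<bullet> cis \<phi> < p \<and> p < g \<phi> \<bullet> cis \<phi>"
  have "\<exists>b. \<phi> \<le> b \<and> b \<le> \<phi> + pi \<and> g b \<bullet> cis \<phi> = p"
    by (rule IVT2') (use p in \<open>auto intro!: continuous_intros\<close>)
  then obtain b where b: "\<phi> \<le> b" "b \<le> \<phi> + pi" "g b \<bullet> cis \<phi> = p" by blast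
  then have "(b, b - \<phi>) \<in> strip" using p by (cases "b = \<phi>"; cases "b = \<phi> + pi") (auto simp: mem_strip)
  moreover have "incoming (b, b - \<phi>) = (\<phi>, p)" using b by (simp add: incoming_def)
  ultimately show "(\<phi>, p) \<in> incoming ` strip" by (metis image_eqI)
qed

lemma incoming_shift_int: "incoming (y + (2 * pi * of_int k, 0)) = incoming y + (2 * pi * of_int k, 0)"
proof -
  have "cis (fst y + 2 * pi * of_int k - snd y) = cis (fst y - snd y)"
    using cis_add_2pi_int[of "fst y - snd y" k] by (simp add: algebra_simps)
  then show ?thesis by (simp add: incoming_def g_periodic_int)
qed

lemma bounce_shift:
  assumes "\<And>a \<phi> b. chord (a + s) (\<phi> + s) (b + s) \<longleftrightarrow> chord a \<phi> b" "y \<in> strip"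
  shows "bounce (y + (s, 0)) = bounce y + (s, 0)"
proof -
  have "chord (fst (y + (s, 0))) (fst (y + (s, 0)) + snd (y + (s, 0))) (fst (bounce y) + s)"
    using bounce_props(1)[OF assms(2)] assms(1)[of "fst y" "fst y + snd y" "fst (bounce y)"]
    by (simp add: algebra_simps)
  moreover have "y + (s, 0) \<in> strip" using assms(2) by (simp add: mem_strip)
  ultimately have "bounce (y + (s, 0)) = (fst (bounce y) + s, fst (bounce y) + s - fst (y + (s, 0)) - snd (y + (s, 0)))"
    by (rule bounce_unique[rotated])
  then show ?thesis using bounce_props(2)[OF assms(2)] by (simp add: prod_eq_iff)
qed

lemma iter_strip: "y \<in> strip \<Longrightarrow> (bounce ^^ k) y \<in> strip"
  by (induction k) (auto intro: bounce_props)

lemma iter_shift: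
  assumes "\<And>a \<phi> b. chord (a + s) (\<phi> + s) (b + s) \<longleftrightarrow> chord a \<phi> b" "y \<in> strip"
  shows "(bounce ^^ k) (y + (s, 0)) = (bounce ^^ k) y + (s, 0)"
  by (induction k) (auto simp: bounce_shift assms iter_strip)

text \<open>Moving by exactly one turn, and not by some multiple of it, is rotation number 1/4 in
  the lift.\<close>

definition four_periodic :: "real \<times> real \<Rightarrow> bool" where
  "four_periodic y \<longleftrightarrow> y \<in> strip \<and> (bounce ^^ 4) y = y + (2 * pi, 0)"

abbreviation impact :: "nat \<Rightarrow> real \<times> real \<Rightarrow> real" where
  "impact k y \<equiv> fst ((bounce ^^ k) y)"

lemma four_periodic_iter:
  assumes "four_periodic y"
  shows "(bounce ^^ (k + 4)) y = (bounce ^^ k) y + (2 * pi, 0)"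
  using assms iter_shift[of "2 * pi" y k] unfolding four_periodic_def funpow_add by (simp add: chord_shift)

lemma four_periodic_le:
  assumes y: "four_periodic y" and z: "four_periodic z" and le: "\<And>k. k < 4 \<Longrightarrow> impact k y \<le> impact k z"
  shows "impact k y \<le> impact k z"
proof (induction k rule: less_induct)
  case (less k)
  show ?case
  proof (cases "k < 4")
    case False
    then have "k = (k - 4) + 4" "k - 4 < k" by auto
    then show ?thesis using less[of "k - 4"] four_periodic_iter[OF y, of "k - 4"] four_periodic_iter[OF z, of "k - 4"]
      by simp
  qed (rule le)
qed

text \<open>Reflection makes the incoming and outgoing angles at a common impact equal, whereas ordered
  neighbours would change them in opposite directions.\<close>

lemma four_periodic_touching:
  assumes y: "four_periodic y" and z: "four_periodic z" and le: "\<And>k. k < 4 \<Longrightarrow> impact k y \<le> impact k z"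
    and j: "j < 4" "impact j y = impact j z"
  shows "y = z"
proof -
  have ys: "(bounce ^^ k) y \<in> strip" and zs: "(bounce ^^ k) z \<in> strip" for k
    using y z iter_strip by (auto simp: four_periodic_def)
  \<comment> \<open>The orbits are compared at index \<open>j + 4\<close> instead of
    \<open>j\<close>, so that the preceding impact also has a natural number as index.\<close>
  define u v where "u = (bounce ^^ (j + 3)) y" and "v = (bounce ^^ (j + 3)) z"
  have uv: "u \<in> strip" "v \<in> strip" using ys zs by (auto simp: u_def v_def)
  have bu: "bounce u = (bounce ^^ (j + 4)) y" "bounce v = (bounce ^^ (j + 4)) z"
    by (simp_all add: u_def v_def numeral_eq_Suc)
  have bbu: "bounce (bounce u) = (bounce ^^ (j + 5)) y" "bounce (bounce v) = (bounce ^^ (j + 5)) z"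
    by (simp_all add: u_def v_def numeral_eq_Suc)
  have "impact (j + 4) y = impact (j + 4) z"
    using j by (simp only: four_periodic_iter[OF y] four_periodic_iter[OF z]) simp
  then have eq: "fst (bounce u) = fst (bounce v)" by (simp only: bu)
  have before: "fst u \<le> fst v" and after: "fst (bounce (bounce u)) \<le> fst (bounce (bounce v))"
    unfolding bbu unfolding u_def v_def by (rule four_periodic_le[OF y z le]; assumption)+
  have cu: "chord (fst u) (fst (bounce u) - snd (bounce u)) (fst (bounce u))"
    and cv: "chord (fst v) (fst (bounce v) - snd (bounce v)) (fst (bounce v))"
    using bounce_props(1,2)[OF uv(1)] bounce_props(1,2)[OF uv(2)] by (auto simp: algebra_simps)
  have cu': "chord (fst (bounce u)) (fst (bounce u) + snd (bounce u)) (fst (bounce (bounce u)))"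
    and cv': "chord (fst (bounce v)) (fst (bounce v) + snd (bounce v)) (fst (bounce (bounce v)))"
    using bounce_props(1)[OF bounce_props(3)] uv by auto
  have "snd (bounce u) = snd (bounce v)"
  proof (rule linorder_cases[of "snd (bounce u)" "snd (bounce v)"])
    assume "snd (bounce u) < snd (bounce v)"
    then have "fst v < fst u" using chord_twist_backward[of "fst v" _ "fst (bounce u)" "fst u"] cu cv eq by auto
    then show ?thesis using before by simp
  next
    assume "snd (bounce u) > snd (bounce v)"
    then have "fst (bounce (bounce v)) < fst (bounce (bounce u))"
      using chord_twist_forward[of "fst (bounce u)"] cu' cv' eq by auto
    then show ?thesis using after by simp
  qed
  then have "(bounce ^^ (j + 4)) y = (bounce ^^ (j + 4)) z" using eq by (simp only: bu[symmetric] prod_eq_iff)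
  \<comment> \<open>Equal states at index \<open>j + 4\<close> are carried on to index 8, two full
    periods, where they return to translates of \<open>y\<close> and \<open>z\<close>.\<close>
  then have "(bounce ^^ (4 - j)) ((bounce ^^ (j + 4)) y) = (bounce ^^ (4 - j)) ((bounce ^^ (j + 4)) z)" by simp
  then have "(bounce ^^ ((4 - j) + (j + 4))) y = (bounce ^^ ((4 - j) + (j + 4))) z"
    by (metis comp_apply funpow_add)
  moreover have "(4 - j) + (j + 4) = 4 + 4" using j by simp
  ultimately have "(bounce ^^ (4 + 4)) y = (bounce ^^ (4 + 4)) z" by metis
  then show ?thesis
    unfolding four_periodic_iter[OF y] four_periodic_iter[OF z] using y z by (simp add: four_periodic_def)
qed

lemma continuous_on_iter: "continuous_on strip (bounce ^^ k)"
proof (induction k)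
  case (Suc k)
  have "continuous_on strip (\<lambda>y. bounce ((bounce ^^ k) y))"
    by (rule continuous_on_compose2[OF continuous_on_bounce Suc]) (auto intro: iter_strip)
  then show ?case by (simp add: comp_def)
qed (simp add: continuous_on_id)

lemma periodic_curve_unbounded:
  fixes f :: "real \<Rightarrow> real"
  assumes "continuous_on UNIV f" "\<And>t. f (t + 1) = f t + 2 * pi"
  shows "\<exists>T. \<forall>t\<le>T. f t < m" "\<exists>T. \<forall>t\<ge>T. f t > m"
proof -
  have fr: "f t = f (frac t) + 2 * pi * of_int \<lfloor>t\<rfloor>" for t using shift_int[of f 1 "2 * pi" "frac t" "\<lfloor>t\<rfloor>"] assms(2)
    by (simp add: frac_def)
  have "bounded (f ` {0..1})"
    by (intro compact_imp_bounded compact_continuous_image continuous_on_subset[OF assms(1)]) auto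
  then obtain B where B: "\<And>s. 0 \<le> s \<Longrightarrow> s \<le> 1 \<Longrightarrow> \<bar>f s\<bar> \<le> B" by (force simp: bounded_real)
  have B': "\<bar>f t - 2 * pi * of_int \<lfloor>t\<rfloor>\<bar> \<le> B" for t
    using B[of "frac t"] fr[of t] frac_lt_1[of t] by (simp add: frac_ge_0)
  have fl: "2 * pi * (t - 1) \<le> 2 * pi * of_int \<lfloor>t\<rfloor>" "2 * pi * of_int \<lfloor>t\<rfloor> \<le> 2 * pi * t" for t
  proof -
    have "t - 1 \<le> of_int \<lfloor>t\<rfloor>" "of_int \<lfloor>t\<rfloor> \<le> t" by linarith+
    then show "2 * pi * (t - 1) \<le> 2 * pi * of_int \<lfloor>t\<rfloor>" "2 * pi * of_int \<lfloor>t\<rfloor> \<le> 2 * pi * t"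
      by (auto intro!: mult_left_mono)
  qed
  have "f t < m" if "t \<le> (m - B) / (2 * pi) - 1" for t
  proof -
    have "t < (m - B) / (2 * pi)" using that by simp
    then have "2 * pi * t < m - B" by (simp add: pos_less_divide_eq mult.commute)
    then show ?thesis using B'[of t] fl(2)[of t] by linarith
  qed
  then show "\<exists>T. \<forall>t\<le>T. f t < m" by blast
  have "f t > m" if "t \<ge> (m + B) / (2 * pi) + 2" for t
  proof -
    have "t - 1 > (m + B) / (2 * pi)" using that by simp
    then have "2 * pi * (t - 1) > m + B" by (simp add: pos_divide_less_eq mult.commute)
    then show ?thesis using B'[of t] fl(1)[of t] by linarith
  qed
  then show "\<exists>T. \<forall>t\<ge>T. f t > m" by blast
qed

text \<open>The parameters whose orbits lie strictly before \<open>m\<close> at all four impacts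
  form an open set, nonempty because impacts tend to minus infinity. By
  \<open>four_periodic_touching\<close> its boundary can only be crossed where
  \<open>x t = m\<close>. Connectedness forces such a crossing, and injectivity leaves only
  one.\<close>

lemma periodic_family_ordered:
  fixes x :: "real \<Rightarrow> real \<times> real"
  assumes cont: "continuous_on UNIV x" and shift: "\<And>t. x (t + 1) = x t + (2 * pi, 0)"
    and per: "\<And>t. four_periodic (x t)" and inj: "inj x" and m: "four_periodic m"
  obtains \<tau> where "x \<tau> = m" "\<And>t k. t < \<tau> \<Longrightarrow> k < 4 \<Longrightarrow> impact k (x t) < impact k m"
    "\<And>t k. t > \<tau> \<Longrightarrow> k < 4 \<Longrightarrow> impact k (x t) > impact k m"
proof -
  define f where "f = (\<lambda>k t. impact k (x t))"
  have xs: "x t \<in> strip" for t using per by (simp add: four_periodic_def)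
  have fc: "continuous_on UNIV (f k)" for k unfolding f_def
    by (intro continuous_intros continuous_on_compose2[OF continuous_on_iter cont]) (use xs in auto)
  have fs: "f k (t + 1) = f k t + 2 * pi" for k t
    unfolding f_def shift using iter_shift[OF chord_shift xs] by simp
  define M where "M = (\<lambda>k. impact k m)"
  define lo hi lo' hi' where "lo = (\<Inter>k<4. {t. f k t < M k})" and "hi = (\<Inter>k<4. {t. f k t > M k})"
    and "lo' = (\<Inter>k<4. {t. f k t \<le> M k})" and "hi' = (\<Inter>k<4. {t. f k t \<ge> M k})"
  have op: "open lo" "open hi" unfolding lo_def hi_def
    by (intro open_INT ballI open_Collect_less fc continuous_intros; simp)+
  have cl: "closed lo'" "closed hi'" unfolding lo'_def hi'_def
    by (intro closed_INT ballI closed_Collect_le fc continuous_intros)+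
  have touch: "x t = m" if "t \<in> lo' - lo \<or> t \<in> hi' - hi" for t
    using that
  proof
    assume "t \<in> lo' - lo"
    then obtain j where "j < 4" "f j t = M j" "\<And>k. k < 4 \<Longrightarrow> f k t \<le> M k"
      unfolding lo_def lo'_def by force
    then show ?thesis using four_periodic_touching[OF per m, of t j] unfolding f_def M_def by blast
  next
    assume "t \<in> hi' - hi"
    then obtain j where "j < 4" "f j t = M j" "\<And>k. k < 4 \<Longrightarrow> f k t \<ge> M k"
      unfolding hi_def hi'_def by force
    then show ?thesis using four_periodic_touching[OF m per, of t j] unfolding f_def M_def by metis
  qed
  have "\<exists>T. \<forall>t\<le>T. t \<in> lo"
  proof -
    have "\<forall>k. \<exists>T. \<forall>t\<le>T. f k t < M k" using periodic_curve_unbounded(1)[OF fc fs] by blast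
    then obtain T where T: "\<And>k t. t \<le> T k \<Longrightarrow> f k t < M k" by metis
    have "t \<in> lo" if "t \<le> Min (T ` {..<4})" for t
    proof -
      have "f k t < M k" if "k < 4" for k
      proof -
        have "Min (T ` {..<4}) \<le> T k" using that by (intro Min_le) auto
        then show ?thesis using \<open>t \<le> Min (T ` {..<4})\<close> T by (meson order_trans)
      qed
      then show ?thesis by (simp add: lo_def)
    qed
    then show ?thesis by blast
  qed
  then obtain T1 where T1: "\<And>t. t \<le> T1 \<Longrightarrow> t \<in> lo" by blast
  have "\<exists>T. \<forall>t\<ge>T. t \<in> hi"
  proof -
    have "\<forall>k. \<exists>T. \<forall>t\<ge>T. f k t > M k" using periodic_curve_unbounded(2)[OF fc fs] by blast
    then obtain T where T: "\<And>k t. t \<ge> T k \<Longrightarrow> f k t > M k" by metis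
    have "t \<in> hi" if "t \<ge> Max (T ` {..<4})" for t
    proof -
      have "f k t > M k" if "k < 4" for k
      proof -
        have "T k \<le> Max (T ` {..<4})" using that by (intro Max_ge) auto
        then show ?thesis using \<open>t \<ge> Max (T ` {..<4})\<close> T by (meson order_trans)
      qed
      then show ?thesis by (simp add: hi_def)
    qed
    then show ?thesis by blast
  qed
  then obtain T2 where T2: "\<And>t. t \<ge> T2 \<Longrightarrow> t \<in> hi" by blast
  have sub: "lo \<subseteq> lo'" "hi \<subseteq> hi'" unfolding lo_def lo'_def hi_def hi'_def by force+
  have disj: "lo \<inter> hi = {}" by (auto simp: lo_def hi_def dest!: bspec[of "{..<4}" _ 0])
  have "\<exists>\<tau>. x \<tau> = m"
  proof (rule ccontr)
    assume "\<not> ?thesis"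
    then have "UNIV \<inter> lo' \<subseteq> lo" using touch by blast
    moreover have "UNIV \<inter> lo \<noteq> {}" using T1[of T1] by auto
    ultimately have "UNIV \<subseteq> lo" by (rule connected_subset_open[OF connected_UNIV op(1) cl(1) _ sub(1)])
    then show False using T2[of T2] disj by blast
  qed
  then obtain \<tau> where \<tau>: "x \<tau> = m" by blast
  then have uniq: "t = \<tau>" if "x t = m" for t using injD[OF inj, of t \<tau>] that \<tau> by simp
  have "{..<\<tau>} \<subseteq> lo"
  proof (rule connected_subset_open[OF _ op(1) cl(1) _ sub(1)])
    show "{..<\<tau>} \<inter> lo' \<subseteq> lo" using touch uniq by fastforce
    have "min T1 \<tau> - 1 \<in> {..<\<tau>} \<inter> lo" using T1[of "min T1 \<tau> - 1"] by auto
    then show "{..<\<tau>} \<inter> lo \<noteq> {}" by blast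
  qed simp
  moreover have "{\<tau><..} \<subseteq> hi"
  proof (rule connected_subset_open[OF _ op(2) cl(2) _ sub(2)])
    show "{\<tau><..} \<inter> hi' \<subseteq> hi" using touch uniq by fastforce
    have "max T2 \<tau> + 1 \<in> {\<tau><..} \<inter> hi" using T2[of "max T2 \<tau> + 1"] by auto
    then show "{\<tau><..} \<inter> hi \<noteq> {}" by blast
  qed simp
  ultimately have "t < \<tau> \<Longrightarrow> k < 4 \<Longrightarrow> f k t < M k" "t > \<tau> \<Longrightarrow> k < 4 \<Longrightarrow> f k t > M k" for t k
    unfolding lo_def hi_def by (auto dest!: subsetD[of _ _ t])
  then show thesis using that[OF \<tau>] unfolding f_def M_def by blast
qed

end

context convex_curve
begin

lemma rho_periodic: "\<rho> (t + 2 * pi) = \<rho> t"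
proof -
  have "((\<lambda>t. g (t + 2 * pi)) has_vector_derivative \<rho> (t + 2 * pi) *\<^sub>R (\<i> * cis (t + 2 * pi))) (at t)"
  proof -
    have "((\<lambda>t. t + 2 * pi) has_vector_derivative 1) (at t)" by (auto intro!: derivative_eq_intros)
    from vector_diff_chain_at[OF this g_deriv[of "t + 2 * pi"]] show ?thesis by (simp add: comp_def)
  qed
  then have "\<rho> (t + 2 * pi) *\<^sub>R (\<i> * cis t) = \<rho> t *\<^sub>R (\<i> * cis t)"
    using vector_derivative_unique_at[OF _ g_deriv[of t]] by (simp add: g_periodic cis_add_2pi)
  then show ?thesis by (metis scaleR_right_imp_eq mult_eq_0_iff cis_neq_zero complex_i_not_zero)
qed

text \<open>The symmetry reverses heights, so the image of \<open>g (t + pi)\<close> has maximal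
  height in direction \<open>cis t\<close>; by strict convexity only \<open>g t\<close> has
  it.\<close>

lemma centrally_symmetric_antipode:
  assumes "\<And>z. z \<in> range g \<Longrightarrow> 2 * c - z \<in> range g"
  shows "g (t + pi) = 2 * c - g t"
proof -
  obtain s where s: "2 * c - g (t + pi) = g s" using assms by blast
  obtain u where u: "2 * c - g t = g u" using assms by blast
  have "g u \<bullet> cis (t + pi) \<le> g (t + pi) \<bullet> cis (t + pi)" by (rule support_le)
  then have "g t \<bullet> cis t \<le> g s \<bullet> cis t"
    unfolding cis_add_pi u[symmetric] s[symmetric] by (simp add: inner_diff_left)
  then have "g s \<bullet> cis t = g t \<bullet> cis t" using support_le[of s t] by simp
  then obtain k :: int where "s = t + 2 * pi * of_int k" by (rule support_eqD)
  then have "g s = g t" by (simp add: g_periodic_int)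
  then show ?thesis using s by (simp add: algebra_simps)
qed

end

subsection \<open>Centrally symmetric curves\<close>

locale symmetric_curve = convex_curve +
  fixes c :: complex
  assumes antipode: "g (t + pi) = 2 * c - g t"
begin

text \<open>Support function about the centre with its first two derivatives; the third definition
  solves \<open>\<rho> = h + h''\<close> for the second derivative.\<close>

definition h :: "real \<Rightarrow> real" where "h t = (g t - c) \<bullet> cis t"
definition h1 :: "real \<Rightarrow> real" where "h1 t = (g t - c) \<bullet> (\<i> * cis t)"
definition h2 :: "real \<Rightarrow> real" where "h2 t = \<rho> t - h t"

lemma i_cis_deriv: "((\<lambda>t. \<i> * cis t) has_vector_derivative - cis t) (at t)"
  using has_vector_derivative_mult_right[OF cis_has_vector_derivative, of \<i>] by simp

lemma q_deriv: "((\<lambda>t. g t - c) has_vector_derivative \<rho> t *\<^sub>R (\<i> * cis t)) (at t)"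
  using has_vector_derivative_diff[OF g_deriv has_vector_derivative_const] by simp

lemma h_deriv: "(h has_real_derivative h1 t) (at t)"
proof -
  have "((\<lambda>t. (g t - c) \<bullet> cis t) has_vector_derivative
      (g t - c) \<bullet> (\<i> * cis t) + (\<rho> t *\<^sub>R (\<i> * cis t)) \<bullet> cis t) (at t)"
    by (rule bounded_bilinear.has_vector_derivative[OF bounded_bilinear_inner q_deriv cis_has_vector_derivative])
  then show ?thesis by (simp add: h_def[abs_def] h1_def has_real_derivative_iff_has_vector_derivative)
qed

lemma h1_deriv: "(h1 has_real_derivative h2 t) (at t)"
proof -
  have "((\<lambda>t. (g t - c) \<bullet> (\<i> * cis t)) has_vector_derivative
      (g t - c) \<bullet> (- cis t) + (\<rho> t *\<^sub>R (\<i> * cis t)) \<bullet> (\<i> * cis t)) (at t)"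
    by (rule bounded_bilinear.has_vector_derivative[OF bounded_bilinear_inner q_deriv i_cis_deriv])
  then show ?thesis
    by (simp add: h_def h1_def[abs_def] h2_def has_real_derivative_iff_has_vector_derivative)
qed

lemma h_cont: "continuous_on UNIV h" and h1_cont: "continuous_on UNIV h1" and h2_cont: "continuous_on UNIV h2"
proof -
  show h: "continuous_on UNIV h" "continuous_on UNIV h1"
    using h_deriv h1_deriv by (meson DERIV_isCont continuous_at_imp_continuous_on)+
  show "continuous_on UNIV h2" unfolding h2_def by (intro continuous_intros rho_cont h)
qed

lemma q_antipode: "g (t + pi) - c = - (g t - c)"
  by (simp add: antipode)

lemma h_periodic: "h (t + pi) = h t" and h1_periodic: "h1 (t + pi) = h1 t"
  unfolding h_def h1_def q_antipode cis_add_pi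
  by (simp_all only: inner_minus_left inner_minus_right mult_minus_right minus_minus)

lemma h_pos: "h t > 0"
proof -
  have "g (t + pi) \<bullet> cis t < g t \<bullet> cis t" by (rule height_decreasing) auto
  moreover have "(2 * c) \<bullet> cis t = 2 * (c \<bullet> cis t)" by (simp add: inner_complex_def algebra_simps)
  ultimately show ?thesis by (simp add: antipode h_def inner_diff_left)
qed

lemma q_dot_cis: "(g t - c) \<bullet> cis (t + e) = h t * cos e + h1 t * sin e"
  and q_dot_i_cis: "(g t - c) \<bullet> (\<i> * cis (t + e)) = h1 t * cos e - h t * sin e"
proof -
  have "cis (t + e) = cos e *\<^sub>R cis t + sin e *\<^sub>R (\<i> * cis t)"
    by (simp add: complex_eq_iff cos_add sin_add)
  then show "(g t - c) \<bullet> cis (t + e) = h t * cos e + h1 t * sin e"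
    by (simp add: inner_add_right h_def h1_def)
  have "\<i> * cis (t + e) = cos e *\<^sub>R (\<i> * cis t) - sin e *\<^sub>R cis t"
    by (simp add: complex_eq_iff cos_add sin_add)
  then show "(g t - c) \<bullet> (\<i> * cis (t + e)) = h1 t * cos e - h t * sin e"
    by (simp add: inner_diff_right h_def h1_def)
qed

lemma chord_antipode: "chord (a + pi) (\<phi> + pi) (b + pi) \<longleftrightarrow> chord a \<phi> b"
  unfolding chord_def antipode cis_add_pi by (auto simp: inner_diff_left)

text \<open>The only reflection angle that a centrally symmetric quadrilateral orbit can have at
  normal angle \<open>t\<close>, as \<open>half_turn_orbit\<close> shows; it is defined whether or
  not that orbit exists.\<close>

definition d :: "real \<Rightarrow> real" where "d t = arctan (h t / h (t + pi / 2))"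

lemma d_bounds: "0 < d t" "d t < pi / 2"
  unfolding d_def using h_pos arctan_ubound by auto

lemma d_mem_strip: "(t, d t) \<in> strip"
  using d_bounds[of t] by (auto simp: mem_strip)

lemma d_cont: "continuous_on S d"
  unfolding d_def using h_pos
  by (intro continuous_intros continuous_on_compose2[OF h_cont]) (auto simp: less_imp_neq[symmetric])

text \<open>Two bounces advance the normal angle by \<open>pi\<close>, so the two reflection angles
  add up to \<open>pi / 2\<close>. Expanded in \<open>h\<close> and \<open>h1\<close>, the chord
  conditions of two consecutive sides combine linearly into one equation for \<open>tan e\<close>
  and one between the values of \<open>h1\<close>.\<close>

lemma half_turn_orbit:
  assumes y: "y \<in> strip" and ret: "(bounce ^^ 2) y = y + (pi, 0)"
  shows "snd y = d (fst y)" "bounce y = (fst y + pi / 2, pi / 2 - snd y)"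
    "h1 (fst y + pi / 2) * cos (snd y) = - h1 (fst y) * sin (snd y)"
proof -
  define t e where "t = fst y" and "e = snd y"
  have b2: "bounce (bounce y) = (t + pi, e)" using ret by (simp add: numeral_2_eq_2 t_def e_def prod_eq_iff)
  note p = bounce_props[OF y] bounce_props[OF bounce_props(3)[OF y]]
  have "fst (bounce y) = t + e + snd (bounce y)" "t + pi = fst (bounce y) + snd (bounce y) + e"
    using p(2,5) b2 by (simp_all add: t_def e_def)
  then have bq: "bounce y = (t + pi / 2, pi / 2 - e)" by (simp add: prod_eq_iff field_simps)
  then show "bounce y = (fst y + pi / 2, pi / 2 - snd y)" by (simp add: t_def e_def)
  have e: "0 < e" "e < pi / 2" using y p(3) by (auto simp: bq mem_strip e_def)
  have c1: "chord t (t + e) (t + pi / 2)" using p(1) by (simp add: bq t_def e_def)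
  have eq: "(t + pi / 2) + (pi / 2 - e) = t + pi + - e" by simp
  have c2: "chord (t + pi / 2) (t + pi + - e) (t + pi)" using p(4) unfolding b2 unfolding bq fst_conv snd_conv eq .
  have e1: "(g t - c) \<bullet> cis (t + e) = (g (t + pi / 2) - c) \<bullet> cis ((t + pi / 2) + (e - pi / 2))"
    using c1 by (simp add: chord_def inner_diff_left)
  have e2: "(g (t + pi / 2) - c) \<bullet> cis ((t + pi / 2) + (pi / 2 - e)) = (g (t + pi) - c) \<bullet> cis ((t + pi) + (- e))"
    using c2 unfolding chord_def inner_diff_left eq by simp
  have "h t * cos e + h1 t * sin e = h (t + pi / 2) * sin e - h1 (t + pi / 2) * cos e"
    using e1 unfolding q_dot_cis by (simp add: cos_diff sin_diff)
  moreover have "h (t + pi / 2) * sin e + h1 (t + pi / 2) * cos e = h t * cos e - h1 t * sin e"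
    using e2 unfolding q_dot_cis h_periodic h1_periodic by (simp add: cos_diff sin_diff)
  ultimately have e3: "h t * cos e = h (t + pi / 2) * sin e" and e4: "h1 (t + pi / 2) * cos e = - h1 t * sin e"
    by linarith+
  show "h1 (fst y + pi / 2) * cos (snd y) = - h1 (fst y) * sin (snd y)" using e4 by (simp add: t_def e_def)
  have "cos e > 0" using e by (intro cos_gt_zero) auto
  then have "tan e = h t / h (t + pi / 2)" using e3 h_pos[of "t + pi / 2"] by (simp add: tan_def field_simps)
  then show "snd y = d (fst y)" using arctan_tan[of e] e by (simp add: d_def t_def[symmetric] e_def[symmetric])
qed

end

section \<open>Curves with a parallelogram orbit through every point\<close>

locale quarter_curve = symmetric_curve +
  assumes quarter: "bounce (t, d t) = (t + pi / 2, d (t + pi / 2))"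
    and quarter_h1: "h1 (t + pi / 2) * cos (d t) = - h1 t * sin (d t)"
begin

lemma d_quarter: "d (t + pi / 2) = pi / 2 - d t"
  using bounce_props(2)[OF d_mem_strip, of t] by (simp add: quarter)

lemma sin_d_pos: "sin (d t) > 0" and cos_d_pos: "cos (d t) > 0"
  using d_bounds[of t] by (auto intro: sin_gt_zero2 cos_gt_zero)

lemma h_cos_d: "h t * cos (d t) = h (t + pi / 2) * sin (d t)"
proof -
  have "tan (d t) = h t / h (t + pi / 2)" by (simp add: d_def tan_arctan)
  then show ?thesis using cos_d_pos[of t] h_pos[of "t + pi / 2"] by (simp add: tan_def field_simps)
qed

text \<open>The tangents at normal angles \<open>t\<close> and \<open>t + pi / 2\<close> meet at a
  right angle, at this squared distance from the centre. The equations for \<open>d\<close> and for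
  \<open>h1\<close> make its derivative vanish, so the orthoptic curve is a circle, of radius
  \<open>R\<close> below.\<close>

lemma orthoptic_constant: "(h t)\<^sup>2 + (h (t + pi / 2))\<^sup>2 = (h 0)\<^sup>2 + (h (pi / 2))\<^sup>2"
proof -
  have "((\<lambda>t. (h t)\<^sup>2 + (h (t + pi / 2))\<^sup>2) has_real_derivative 0) (at t)" for t
  proof -
    have "sin (d t) * cos (d t) * (h t * h1 t + h (t + pi / 2) * h1 (t + pi / 2)) = 0"
      using h_cos_d[of t] quarter_h1[of t] by algebra
    then have z: "h t * h1 t + h (t + pi / 2) * h1 (t + pi / 2) = 0"
      using sin_d_pos[of t] cos_d_pos[of t] by simp
    have "((\<lambda>t. h (t + pi / 2)) has_real_derivative h1 (t + pi / 2)) (at t)"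
      using h_deriv[of "t + pi/2"] by (simp add: DERIV_shift)
    then have "((\<lambda>t. (h t)\<^sup>2 + (h (t + pi / 2))\<^sup>2) has_real_derivative 2 * (h t * h1 t + h (t + pi / 2) * h1 (t + pi / 2))) (at t)"
      by (auto intro!: derivative_eq_intros h_deriv)
    then show ?thesis by (simp add: z)
  qed
  then show ?thesis using DERIV_isconst_all[of "\<lambda>t. (h t)\<^sup>2 + (h (t + pi / 2))\<^sup>2" t 0] by simp
qed

definition R :: real where "R = sqrt ((h 0)\<^sup>2 + (h (pi / 2))\<^sup>2)"

lemma R_pos: "R > 0"
  using h_pos[of 0] by (simp add: R_def add_pos_nonneg)

lemma orthoptic: "(h t)\<^sup>2 + (h (t + pi / 2))\<^sup>2 = R\<^sup>2"
  unfolding R_def orthoptic_constant[of t] by simp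

lemma sin_d: "sin (d t) = h t / R" and cos_d: "cos (d t) = h (t + pi / 2) / R"
proof -
  have "(h t)\<^sup>2 = (R * sin (d t))\<^sup>2"
    using h_cos_d[of t] orthoptic[of t] sin_cos_squared_add[of "d t"] by algebra
  then have "h t = R * sin (d t)"
    using h_pos[of t] R_pos sin_d_pos[of t] by (simp add: power2_eq_iff_nonneg)
  then show "sin (d t) = h t / R" using R_pos by simp
  have "(h (t + pi / 2))\<^sup>2 = (R * cos (d t))\<^sup>2"
    using h_cos_d[of t] orthoptic[of t] sin_cos_squared_add[of "d t"] by algebra
  then have "h (t + pi / 2) = R * cos (d t)"
    using h_pos[of "t + pi / 2"] R_pos cos_d_pos[of t] by (simp add: power2_eq_iff_nonneg)
  then show "cos (d t) = h (t + pi / 2) / R" using R_pos by simp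
qed

text \<open>The domain between \<delta> = 0 and the invariant curve, in lifted impact
  coordinates.\<close>

definition lower :: "(real \<times> real) set" where
  "lower = {y. 0 < snd y \<and> snd y < d (fst y)}"

lemma lower_subset_strip: "lower \<subseteq> strip"
  using d_bounds(2) by (auto simp: lower_def mem_strip) (smt (verit) pi_gt_zero)

lemma open_lower: "open lower"
proof -
  have "lower = {y. 0 < snd y} \<inter> {y. snd y < d (fst y)}" by (auto simp: lower_def)
  moreover have "continuous_on UNIV (\<lambda>y :: real \<times> real. d (fst y))"
    by (rule continuous_on_compose2[OF d_cont[of UNIV]]) (auto intro: continuous_intros)
  then have "open {y :: real \<times> real. 0 < snd y}" "open {y :: real \<times> real. snd y < d (fst y)}"
    by (auto intro!: open_Collect_less continuous_intros)
  ultimately show ?thesis by auto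
qed

lemma quarter_chord: "chord t (t + d t) (t + pi / 2)"
  using bounce_props(1)[OF d_mem_strip, of t] by (simp add: quarter)

lemma quarter_chord': "chord (t - pi / 2) (t - d t) t"
proof -
  have "t - pi / 2 + d (t - pi / 2) = t - d t" using d_quarter[of "t - pi / 2"] by simp
  moreover have "t - pi / 2 + pi / 2 = t" by simp
  ultimately show ?thesis using quarter_chord[of "t - pi / 2"] by metis
qed

text \<open>By the forward twist, an angle below \<open>d\<close> advances the normal angle by less
  than \<open>pi / 2\<close>. If the next angle were at least \<open>d b\<close>, the backward twist
  would place the previous impact at least \<open>pi / 2\<close> before \<open>b\<close>.\<close>

lemma bounce_lower:
  assumes "y \<in> lower"
  shows "bounce y \<in> lower"
proof -
  have y: "y \<in> strip" using assms lower_subset_strip by blast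
  note p = bounce_props[OF y]
  define b where "b = fst (bounce y)"
  have "b < fst y + pi / 2"
    using chord_twist_forward[OF p(1) quarter_chord] assms by (simp add: lower_def b_def)
  have cb: "chord (fst y) (b - snd (bounce y)) b" using p(1,2) by (simp add: b_def algebra_simps)
  have "snd (bounce y) < d b"
  proof (rule ccontr)
    assume "\<not> ?thesis"
    then consider "snd (bounce y) = d b" | "b - snd (bounce y) < b - d b" by fastforce
    then have "fst y \<le> b - pi / 2"
    proof cases
      case 1
      then show ?thesis using chord_exists_backward[of "b - d b" b] d_bounds[of b] cb quarter_chord'[of b]
        by (metis add.commute add_less_cancel_left diff_less_eq less_add_same_cancel2 order_refl cb chord_def)
    next
      case 2
      then show ?thesis using chord_twist_backward[OF cb quarter_chord'] by simp
    qed
    then show False using \<open>b < fst y + pi / 2\<close> by simp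
  qed
  then show ?thesis using p(3) by (simp add: lower_def mem_strip b_def)
qed

lemma unbounce_lower:
  assumes "y \<in> lower"
  shows "unbounce y \<in> lower"
proof -
  have y: "y \<in> strip" using assms lower_subset_strip by blast
  note p = unbounce_props[OF y]
  define a where "a = fst (unbounce y)"
  have "fst y - pi / 2 < a"
    using chord_twist_backward[OF quarter_chord' p(1)] assms by (simp add: lower_def a_def)
  have "a + snd (unbounce y) = fst y - snd y" using p(2) by (simp add: a_def)
  then have ca: "chord a (a + snd (unbounce y)) (fst y)" using p(1) by (simp add: a_def)
  have "snd (unbounce y) < d a"
  proof (rule ccontr)
    assume "\<not> ?thesis"
    then consider "snd (unbounce y) = d a" | "a + d a < a + snd (unbounce y)" by fastforce
    then have "a + pi / 2 \<le> fst y"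
    proof cases
      case 1
      then have "chord a (a + d a) (fst y)" using ca by simp
      then show ?thesis using chord_exists_forward[of a "a + d a"] quarter_chord[of a] by (metis chord_def order_refl)
    next
      case 2
      then show ?thesis using chord_twist_forward[OF quarter_chord ca] by simp
    qed
    then show False using \<open>fst y - pi / 2 < a\<close> by simp
  qed
  then show ?thesis using p(3) by (simp add: lower_def mem_strip a_def)
qed

text \<open>The bound that remains in \<open>slope_inequality\<close> once the slopes are
  eliminated. Multiplied by the density \<open>\<rho> t * sin e\<close>, it has a primitive in
  \<open>e\<close> built from the two moments.\<close>

definition energy :: "real \<Rightarrow> real \<Rightarrow> real" where
  "energy t e = 2 * h t * sin e * ((h t * h2 t + 2 * (h1 t)\<^sup>2) * (cos e)\<^sup>2 - (h1 t)\<^sup>2 * (sin e)\<^sup>2)"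

text \<open>Here \<open>w1\<close>, \<open>w2\<close> are the slopes \<open>dp/d\<phi>\<close> of an invariant line field before and after a reflection,
  measured with the origin moved to the centre of symmetry, and \<open>a\<close>, \<open>b\<close> the corresponding
  increments of \<open>\<phi>\<close>. The weight \<open>p\<close> is the Jacobi field of the confocal foliation when the curve is an
  ellipse, the only case in which the arithmetic-geometric mean inequality is sharp throughout.\<close>

lemma slope_inequality:
  assumes ab: "a > 0" "b > 0" and e: "0 < e" "e < pi"
    and w1: "w1 = - \<rho> t * sin e * (1 + b / a) / 2 + (g t - c) \<bullet> (\<i> * cis (t - e))"
    and w2: "w2 = \<rho> t * sin e * (1 + a / b) / 2 + (g t - c) \<bullet> (\<i> * cis (t + e))"
  shows "energy t e \<le> w2 * ((g t - c) \<bullet> cis (t + e))\<^sup>2 - w1 * ((g t - c) \<bullet> cis (t - e))\<^sup>2"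
proof -
  define P1 P2 where "P1 = (g t - c) \<bullet> cis (t - e)" and "P2 = (g t - c) \<bullet> cis (t + e)"
  define s C where "s = sin e" and "C = cos e"
  have s: "s > 0" using e by (auto simp: s_def intro: sin_gt_zero)
  have P1: "P1 = h t * C - h1 t * s" and P2: "P2 = h t * C + h1 t * s"
    using q_dot_cis[of t "- e"] q_dot_cis[of t e] by (simp_all add: P1_def P2_def s_def C_def)
  have u1: "w1 = - \<rho> t * s * (1 + b / a) / 2 + (h1 t * C + h t * s)"
    and u2: "w2 = \<rho> t * s * (1 + a / b) / 2 + (h1 t * C - h t * s)"
    using w1 w2 q_dot_i_cis[of t "- e"] q_dot_i_cis[of t e] by (simp_all add: s_def C_def)
  \<comment> \<open>The ratio \<open>a / b\<close> is all that is unknown in \<open>w1\<close> and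
    \<open>w2\<close>; this square bounds its contribution by a term free of it.\<close>
  have "0 \<le> (a * P2 - b * P1)\<^sup>2 / (a * b)" using ab by simp
  also have "\<dots> = a / b * P2\<^sup>2 + b / a * P1\<^sup>2 - 2 * P1 * P2"
    using ab by (simp add: field_simps power2_eq_square)
  finally have "2 * P1 * P2 \<le> a / b * P2\<^sup>2 + b / a * P1\<^sup>2" by simp
  then have "\<rho> t * s / 2 * (2 * P1 * P2) \<le> \<rho> t * s / 2 * (a / b * P2\<^sup>2 + b / a * P1\<^sup>2)"
    using s rho_pos[of t] by (intro mult_left_mono) auto
  then have "\<rho> t * s / 2 * (P1\<^sup>2 + P2\<^sup>2 + 2 * P1 * P2) + (h1 t * C - h t * s) * P2\<^sup>2 - (h1 t * C + h t * s) * P1\<^sup>2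
      \<le> w2 * P2\<^sup>2 - w1 * P1\<^sup>2"
  proof -
    define k X Y where "k = \<rho> t * s / 2" and "X = b / a" and "Y = a / b"
    have W: "w1 = - k * (1 + X) + (h1 t * C + h t * s)" "w2 = k * (1 + Y) + (h1 t * C - h t * s)"
      using u1 u2 by (simp_all add: k_def X_def Y_def)
    then show ?thesis using \<open>\<rho> t * s / 2 * (2 * P1 * P2) \<le> _\<close>
      unfolding k_def[symmetric] X_def[symmetric] Y_def[symmetric] W by (simp add: algebra_simps)
  qed
  moreover have "\<rho> t = h t + h2 t" by (simp add: h2_def)
  then have "\<rho> t * s / 2 * (P1\<^sup>2 + P2\<^sup>2 + 2 * P1 * P2) + (h1 t * C - h t * s) * P2\<^sup>2 - (h1 t * C + h t * s) * P1\<^sup>2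
     = energy t e"
    unfolding energy_def s_def[symmetric] C_def[symmetric] P1 P2 by algebra
  ultimately show ?thesis unfolding P1_def P2_def by simp
qed

text \<open>With \<open>a = h z\<close> and \<open>b = h (z + pi / 2)\<close> the hypothesis becomes
  \<open>h\<^sup>2 = a\<^sup>2 cos\<^sup>2 + b\<^sup>2 sin\<^sup>2\<close>, and the point with
  normal angle \<open>z + t\<close> has axis coordinates \<open>a\<^sup>2 cos t / h\<close> and
  \<open>b\<^sup>2 sin t / h\<close>.\<close>

lemma range_eq_ellipse:
  assumes E: "\<And>t. (h t)\<^sup>2 = A + B * cos (2 * (t - z))"
  shows "is_ellipse (range g)"
proof -
  define a where "a = h z"
  define b where "b = h (z + pi / 2)"
  have a: "a > 0" and b: "b > 0" using h_pos by (auto simp: a_def b_def)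
  have a2: "a\<^sup>2 = A + B" using E[of z] by (simp add: a_def)
  have b2: "b\<^sup>2 = A - B" using E[of "z + pi/2"] by (simp add: b_def)
  have H: "(h (z + t))\<^sup>2 = a\<^sup>2 * (cos t)\<^sup>2 + b\<^sup>2 * (sin t)\<^sup>2" for t
  proof -
    have "(h (z + t))\<^sup>2 = A + B * ((cos t)\<^sup>2 - (sin t)\<^sup>2)" unfolding E by (simp add: cos_double)
    then show ?thesis unfolding a2 b2 using sin_cos_squared_add[of t] by algebra
  qed
  have HH: "h (z + t) * h1 (z + t) = (b\<^sup>2 - a\<^sup>2) * (sin t * cos t)" for t
  proof -
    have "((\<lambda>t. (h t)\<^sup>2) has_real_derivative 2 * (h (z + t) * h1 (z + t))) (at (z + t))"
      by (auto intro!: derivative_eq_intros h_deriv)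
    moreover have "((\<lambda>t. (h t)\<^sup>2) has_real_derivative - 2 * B * sin (2 * t)) (at (z + t))"
      unfolding E by (auto intro!: derivative_eq_intros)
    ultimately have "2 * (h (z + t) * h1 (z + t)) = - 2 * B * sin (2 * t)" by (rule DERIV_unique)
    then show ?thesis by (simp add: a2 b2 sin_double)
  qed
  have X: "(g (z + t) - c) \<bullet> cis z = a\<^sup>2 * cos t / h (z + t)" for t
  proof -
    have e: "(g (z + t) - c) \<bullet> cis z = h (z + t) * cos t - h1 (z + t) * sin t"
      using q_dot_cis[of "z + t" "- t"] by simp
    have "h (z + t) * (h (z + t) * cos t - h1 (z + t) * sin t) = a\<^sup>2 * cos t"
      using H[of t] HH[of t] sin_cos_squared_add[of t] by algebra
    then show ?thesis using h_pos[of "z + t"] unfolding e by (metis less_irrefl nonzero_mult_div_cancel_left)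
  qed
  have Y: "(g (z + t) - c) \<bullet> (\<i> * cis z) = b\<^sup>2 * sin t / h (z + t)" for t
  proof -
    have e: "(g (z + t) - c) \<bullet> (\<i> * cis z) = h1 (z + t) * cos t + h (z + t) * sin t"
      using q_dot_i_cis[of "z + t" "- t"] by simp
    have "h (z + t) * (h1 (z + t) * cos t + h (z + t) * sin t) = b\<^sup>2 * sin t"
      using H[of t] HH[of t] sin_cos_squared_add[of t] by algebra
    then show ?thesis using h_pos[of "z + t"] unfolding e by (metis less_irrefl nonzero_mult_div_cancel_left)
  qed
  have S: "(a * cos t / h (z + t))\<^sup>2 + (b * sin t / h (z + t))\<^sup>2 = 1" for t
  proof -
    have "(a * cos t / h (z + t))\<^sup>2 + (b * sin t / h (z + t))\<^sup>2
        = (a\<^sup>2 * (cos t)\<^sup>2 + b\<^sup>2 * (sin t)\<^sup>2) / (h (z + t))\<^sup>2"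
      by (simp add: power_divide power_mult_distrib add_divide_distrib)
    then show ?thesis unfolding H[symmetric] using h_pos[of "z + t"] by simp
  qed
  have "range g = {w. (((w - c) \<bullet> cis z) / a)\<^sup>2 + (((w - c) \<bullet> (\<i> * cis z)) / b)\<^sup>2 = 1}"
  proof (intro equalityI subsetI)
    fix w assume "w \<in> range g"
    then obtain t where "w = g t" by blast
    then have w: "w = g (z + (t - z))" by simp
    show "w \<in> {w. (((w - c) \<bullet> cis z) / a)\<^sup>2 + (((w - c) \<bullet> (\<i> * cis z)) / b)\<^sup>2 = 1}"
      unfolding w mem_Collect_eq X Y using a b S[of "t - z"] by (simp add: power2_eq_square)
  next
    fix w assume "w \<in> {w. (((w - c) \<bullet> cis z) / a)\<^sup>2 + (((w - c) \<bullet> (\<i> * cis z)) / b)\<^sup>2 = 1}"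
    define x y where "x = (w - c) \<bullet> cis z" and "y = (w - c) \<bullet> (\<i> * cis z)"
    have w: "(x / a)\<^sup>2 + (y / b)\<^sup>2 = 1" using \<open>w \<in> _\<close> by (simp add: x_def y_def)
    \<comment> \<open>The length of the normal vector \<open>(x / a\<^sup>2, y / b\<^sup>2)\<close>
      of the ellipse at \<open>w\<close>; the direction of this vector supplies the parameter
      \<open>t\<close>.\<close>
    define r where "r = sqrt ((x / a\<^sup>2)\<^sup>2 + (y / b\<^sup>2)\<^sup>2)"
    have "r \<noteq> 0"
    proof
      assume "r = 0"
      then have "(x / a\<^sup>2)\<^sup>2 = 0 \<and> (y / b\<^sup>2)\<^sup>2 = 0" by (simp add: r_def sum_power2_eq_zero_iff)
      then have "x = 0" "y = 0" using a b by auto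
      then show False using w by simp
    qed
    then have r: "r > 0" by (simp add: r_def order_less_le)
    have "(x / a\<^sup>2 / r)\<^sup>2 + (y / b\<^sup>2 / r)\<^sup>2 = 1"
      using r unfolding power_divide add_divide_distrib[symmetric] by (simp add: r_def power_divide)
    then obtain t where t: "x / a\<^sup>2 / r = cos t" "y / b\<^sup>2 / r = sin t"
      using sincos_total_2pi by (metis (no_types))
    have ct: "cos t = x / (a\<^sup>2 * r)" and st: "sin t = y / (b\<^sup>2 * r)" using t by (simp_all add: field_simps)
    have "(h (z + t))\<^sup>2 = ((x / a)\<^sup>2 + (y / b)\<^sup>2) / r\<^sup>2"
      unfolding H ct st using a b r by (simp add: field_simps power2_eq_square)
    then have "(h (z + t))\<^sup>2 = (1 / r)\<^sup>2" unfolding w by (simp add: power_divide)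
    then have hr: "h (z + t) = 1 / r" using h_pos[of "z + t"] r by (simp add: power2_eq_iff_nonneg)
    have "(g (z + t) - c) \<bullet> cis z = x" "(g (z + t) - c) \<bullet> (\<i> * cis z) = y"
      unfolding X Y hr ct st using a b r by simp_all
    then have "(w - g (z + t)) \<bullet> cis z = 0" "(w - g (z + t)) \<bullet> (\<i> * cis z) = 0"
      by (simp_all add: x_def y_def inner_diff_left)
    then have "w = g (z + t)" using orthogonal_to_cis[of "w - g (z + t)" z] by simp
    then show "w \<in> range g" by blast
  qed
  then show ?thesis unfolding is_ellipse_def using a b
    by (intro exI[of _ c] exI[of _ "cis z"] exI[of _ a] exI[of _ b]) simp
qed

theorem ellipse_of_energy:
  assumes "integral {0..2 * pi} (\<lambda>t. integral {0..d t} (\<lambda>e. energy t e * (\<rho> t * sin e))) \<le> 0"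
  shows "is_ellipse (range g)"
proof -
  have inner: "integral {0..d t} (\<lambda>e. energy t e * (\<rho> t * sin e)) = 2 * (h t * (h t + h2 t) *
      ((h t * h2 t + 2 * (h1 t)\<^sup>2) * moment_ss_cc (d t) - (h1 t)\<^sup>2 * moment_ssss (d t)))" for t
  proof -
    define G where "G = (\<lambda>e. 2 * (h t * (h t + h2 t) *
      ((h t * h2 t + 2 * (h1 t)\<^sup>2) * moment_ss_cc e - (h1 t)\<^sup>2 * moment_ssss e)))"
    have "integral {0..d t} (\<lambda>e. energy t e * (\<rho> t * sin e)) = G (d t) - G 0"
    proof (rule integral_eq_antiderivative)
      fix e :: real
      have "(G has_real_derivative 2 * (h t * (h t + h2 t) *
        ((h t * h2 t + 2 * (h1 t)\<^sup>2) * ((sin e)\<^sup>2 * (cos e)\<^sup>2) - (h1 t)\<^sup>2 * (sin e) ^ 4))) (at e)"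
        unfolding G_def by (intro DERIV_cmult DERIV_diff DERIV_moment_ss_cc DERIV_moment_ssss)
      moreover have "\<rho> t = h t + h2 t" by (simp add: h2_def)
      then have "energy t e * (\<rho> t * sin e) = 2 * (h t * (h t + h2 t) *
        ((h t * h2 t + 2 * (h1 t)\<^sup>2) * ((sin e)\<^sup>2 * (cos e)\<^sup>2) - (h1 t)\<^sup>2 * (sin e) ^ 4))"
        unfolding energy_def by algebra
      ultimately show "(G has_real_derivative energy t e * (\<rho> t * sin e)) (at e)" by simp
    qed (use d_bounds[of t] in simp)
    then show ?thesis by (simp add: G_def)
  qed
  have "integral {0..2 * pi} (\<lambda>t. h t * (h t + h2 t) *
      ((h t * h2 t + 2 * (h1 t)\<^sup>2) * moment_ss_cc (d t) - (h1 t)\<^sup>2 * moment_ssss (d t))) \<le> 0"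
    using assms unfolding inner by simp
  then obtain A B z where "\<And>t. (h t)\<^sup>2 = A + B * cos (2 * (t - z))"
    using energy_nonpos_imp_square_cosine[of h h1 h2 R d] h_deriv h1_deriv h2_cont h_pos orthoptic R_pos
      sin_d cos_d d_bounds by blast
  then show ?thesis by (rule range_eq_ellipse)
qed

end

subsection \<open>Invariant measure and the integrated energy inequality\<close>

text \<open>Whole periods are removed from the shift; the part of the window that still reaches
  beyond \<open>T\<close> is moved back by one period.\<close>

lemma nn_integral_periodic_shift:
  fixes H :: "real \<Rightarrow> ennreal"
  assumes [measurable]: "H \<in> borel_measurable borel" and per: "\<And>x. H (x + T) = H x" and T: "T > 0"
  shows "(\<integral>\<^sup>+x. H (x + a) * indicator {0..<T} x \<partial>lborel) = (\<integral>\<^sup>+x. H x * indicator {0..<T} x \<partial>lborel)"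
proof -
  define k where "k = \<lfloor>a / T\<rfloor>"
  define b where "b = a - T * of_int k"
  have "of_int k \<le> a / T" "a / T < of_int k + 1" unfolding k_def by linarith+
  then have b: "0 \<le> b" "b < T" using T by (simp_all add: b_def pos_le_divide_eq pos_divide_less_eq algebra_simps)
  have Ha: "H (x + a) = H (x + b)" for x using periodic_int[of H T "x + b" k] per by (simp add: b_def)
  have "(\<integral>\<^sup>+x. H (x + a) * indicator {0..<T} x \<partial>lborel) = (\<integral>\<^sup>+x. H (b + 1 * x) * indicator {b..<b + T} (b + 1 * x) \<partial>lborel)"
    unfolding Ha by (intro nn_integral_cong) (auto simp: indicator_def add.commute)
  also have "\<dots> = (\<integral>\<^sup>+x. H x * indicator {b..<b + T} x \<partial>lborel)"
    using nn_integral_real_affine[of "\<lambda>x. H x * indicator {b..<b + T} x" 1 b] by simp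
  also have "\<dots> = (\<integral>\<^sup>+x. H x * indicator {b..<T} x + H x * indicator {T..<b + T} x \<partial>lborel)"
    using b by (intro nn_integral_cong) (auto simp: indicator_def)
  also have "\<dots> = (\<integral>\<^sup>+x. H x * indicator {b..<T} x \<partial>lborel) + (\<integral>\<^sup>+x. H x * indicator {T..<b + T} x \<partial>lborel)"
    by (intro nn_integral_add) auto
  also have "(\<integral>\<^sup>+x. H x * indicator {T..<b + T} x \<partial>lborel) = (\<integral>\<^sup>+x. H (T + 1 * x) * indicator {T..<b + T} (T + 1 * x) \<partial>lborel)"
    using nn_integral_real_affine[of "\<lambda>x. H x * indicator {T..<b + T} x" 1 T] by simp
  also have "\<dots> = (\<integral>\<^sup>+x. H x * indicator {0..<b} x \<partial>lborel)"
    by (intro nn_integral_cong) (auto simp: indicator_def add.commute[of T] per)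
  also have "(\<integral>\<^sup>+x. H x * indicator {b..<T} x \<partial>lborel) + (\<integral>\<^sup>+x. H x * indicator {0..<b} x \<partial>lborel)
      = (\<integral>\<^sup>+x. H x * indicator {b..<T} x + H x * indicator {0..<b} x \<partial>lborel)"
    by (intro nn_integral_add[symmetric]) auto
  also have "\<dots> = (\<integral>\<^sup>+x. H x * indicator {0..<T} x \<partial>lborel)"
    using b by (intro nn_integral_cong) (auto simp: indicator_def)
  finally show ?thesis .
qed

context convex_curve
begin

text \<open>\<open>leave 1\<close> and \<open>leave (-1)\<close> are the maps \<open>outgoing\<close> and \<open>incoming\<close>, with the angle \<open>\<tau> = - \<delta>\<close>
  in place of \<open>\<delta>\<close> to make the height increasing in the angle.\<close>

definition leave :: "real \<Rightarrow> real \<times> real \<Rightarrow> real \<times> real" where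
  "leave \<sigma> z = (fst z - \<sigma> * snd z, g (fst z) \<bullet> cis (fst z - \<sigma> * snd z))"

text \<open>The density of \<open>dp d\<phi>\<close> in impact coordinates, the same for incoming
  and outgoing lines.\<close>

definition weight :: "real \<times> real \<Rightarrow> real" where
  "weight z = \<rho> (fst z) * (- sin (snd z))"

definition cell :: "(real \<times> real) set" where
  "cell = {0..<2 * pi} \<times> {- pi..0}"

lemma continuous_on_rho_comp [continuous_intros]:
  "continuous_on S f \<Longrightarrow> continuous_on S (\<lambda>x. \<rho> (f x))"
  by (rule continuous_on_compose2[OF rho_cont]) auto

lemma leave_measurable [measurable]: "leave \<sigma> \<in> borel_measurable borel"
  unfolding leave_def by (intro borel_measurable_continuous_onI continuous_intros)

lemma weight_cont: "continuous_on S weight"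
  unfolding weight_def by (intro continuous_intros)

lemma weight_measurable [measurable]: "weight \<in> borel_measurable borel"
  by (rule borel_measurable_continuous_onI[OF weight_cont])

lemma cell_measurable [measurable]: "cell \<in> sets borel"
  unfolding cell_def by (intro borel_Times) auto

lemma weight_nonneg: "z \<in> cell \<Longrightarrow> weight z \<ge> 0"
  using rho_pos[of "fst z"] sin_ge_zero[of "- snd z"] by (auto simp: cell_def weight_def mult_le_0_iff)

text \<open>For fixed \<phi>, the substitution
  \<open>p = g (\<phi> + \<sigma> * \<tau>) \<bullet> cis \<phi>\<close> produces the weight; for
  fixed \<tau>, the shift from \<phi> to \<open>\<phi> + \<sigma> * \<tau>\<close> costs nothing by
  periodicity. The right-hand side does not contain \<sigma>, which is the invariance of
  \<open>dp d\<phi>\<close> under reflection.\<close>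

lemma measure_preserving:
  fixes u :: "real \<times> real \<Rightarrow> real"
  assumes u [measurable]: "u \<in> borel_measurable borel" and nn: "\<And>z. u z \<ge> 0"
    and per: "\<And>\<phi> p. u (\<phi> + 2 * pi, p) = u (\<phi>, p)" and \<sigma>: "\<sigma> = 1 \<or> \<sigma> = - 1"
  shows "(\<integral>\<^sup>+z. ennreal (u (leave \<sigma> z) * weight z) * indicator cell z \<partial>lborel) =
         (\<integral>\<^sup>+\<phi>. (\<integral>\<^sup>+p. ennreal (u (\<phi>, p) * indicator {g (\<phi> + pi) \<bullet> cis \<phi>..g \<phi> \<bullet> cis \<phi>} p) \<partial>lborel)
            * indicator {0..<2 * pi} \<phi> \<partial>lborel)" (is "?L = ?R")
proof -
  define H where "H = (\<lambda>\<psi> \<tau>. ennreal (u (leave \<sigma> (\<psi>, \<tau>)) * weight (\<psi>, \<tau>)))"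
  have Hm [measurable]: "(\<lambda>z. H (fst z) (snd z)) \<in> borel_measurable borel"
    unfolding H_def by simp
  have Hm' [measurable]: "(\<lambda>z. H (fst z) (snd z)) \<in> borel_measurable (lborel \<Otimes>\<^sub>M lborel)"
    using Hm by (simp add: lborel_prod)
  have inner: "(\<integral>\<^sup>+p. ennreal (u (\<phi>, p) * indicator {g (\<phi> + pi) \<bullet> cis \<phi>..g \<phi> \<bullet> cis \<phi>} p) \<partial>lborel)
      = (\<integral>\<^sup>+\<tau>. H (\<phi> + \<sigma> * \<tau>) \<tau> * indicator {- pi..0} \<tau> \<partial>lborel)" for \<phi>
  proof -
    define G where "G = (\<lambda>\<tau>. g (\<phi> + \<sigma> * \<tau>) \<bullet> cis \<phi>)"
    define G' where "G' = (\<lambda>\<tau>. \<rho> (\<phi> + \<sigma> * \<tau>) * (- sin \<tau>))"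
    have G: "(G has_real_derivative G' \<tau>) (at \<tau>)" for \<tau>
    proof -
      have "(G has_real_derivative - (\<rho> (\<phi> + \<sigma> * \<tau>) * sin (\<phi> + \<sigma> * \<tau> - \<phi>)) * \<sigma>) (at \<tau>)"
        unfolding G_def by (rule DERIV_chain2[OF height_deriv]) (auto intro!: derivative_eq_intros)
      then show ?thesis using \<sigma> by (auto simp: G'_def)
    qed
    have G0: "G 0 = g \<phi> \<bullet> cis \<phi>" by (simp add: G_def)
    have Gpi: "G (- pi) = g (\<phi> + pi) \<bullet> cis \<phi>"
      using \<sigma> g_periodic[of "\<phi> - pi"] by (auto simp: G_def add.commute)
    have [measurable]: "(\<lambda>p. u (\<phi>, p)) \<in> borel_measurable borel" by simp
    have "(\<integral>\<^sup>+p. ennreal (u (\<phi>, p) * indicator {G (- pi)..G 0} p) \<partial>lborel)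
        = (\<integral>\<^sup>+\<tau>. ennreal (u (\<phi>, G \<tau>) * G' \<tau> * indicator {- pi..0} \<tau>) \<partial>lborel)"
    proof (rule nn_integral_substitution)
      show "set_borel_measurable borel {G (- pi)..G 0} (\<lambda>p. u (\<phi>, p))"
        unfolding set_borel_measurable_def by measurable
      show "G' x \<ge> 0" if "x \<in> {- pi..0}" for x
        using that sin_ge_zero[of "- x"] rho_pos[of "\<phi> + \<sigma> * x"] by (auto simp: G'_def mult_le_0_iff)
      show "continuous_on {- pi..0} G'" unfolding G'_def by (intro continuous_intros)
    qed (use G in auto)
    also have "\<dots> = (\<integral>\<^sup>+\<tau>. H (\<phi> + \<sigma> * \<tau>) \<tau> * indicator {- pi..0} \<tau> \<partial>lborel)"
      unfolding H_def leave_def weight_def G_def G'_def by (intro nn_integral_cong) (simp add: indicator_def)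
    finally show ?thesis unfolding G0 Gpi .
  qed
  have Hper: "H (\<psi> + 2 * pi) \<tau> = H \<psi> \<tau>" for \<psi> \<tau>
  proof -
    have "\<psi> + 2 * pi - \<sigma> * \<tau> = (\<psi> - \<sigma> * \<tau>) + 2 * pi" by simp
    then show ?thesis unfolding H_def leave_def weight_def
      by (simp only: fst_conv snd_conv g_periodic rho_periodic per cis_add_2pi)
  qed
  have [measurable]: "(\<lambda>\<psi>. H \<psi> \<tau>) \<in> borel_measurable borel" for \<tau>
    using measurable_compose[OF _ Hm, of "\<lambda>\<psi>. (\<psi>, \<tau>)" borel] by simp
  have m2: "(\<lambda>(\<phi>, \<tau>). H (\<phi> + \<sigma> * \<tau>) \<tau> * indicator {- pi..0} \<tau> * indicator {0..<2 * pi} \<phi>)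
      \<in> borel_measurable (lborel \<Otimes>\<^sub>M lborel)"
  proof -
    have "(\<lambda>z. (fst z + \<sigma> * snd z, snd z)) \<in> borel_measurable (borel :: (real \<times> real) measure)"
      by (intro borel_measurable_continuous_onI continuous_intros)
    from measurable_compose[OF this Hm]
    have [measurable]: "(\<lambda>z. H (fst z + \<sigma> * snd z) (snd z)) \<in> borel_measurable (borel \<Otimes>\<^sub>M borel)"
      by (simp add: borel_prod)
    show ?thesis by (simp add: split_beta')
  qed
  have m3: "(\<lambda>(\<phi>, \<tau>). H \<phi> \<tau> * indicator {0..<2 * pi} \<phi> * indicator {- pi..0} \<tau>)
      \<in> borel_measurable (lborel \<Otimes>\<^sub>M lborel)"
    unfolding split_beta' by measurable
  have "?R = (\<integral>\<^sup>+\<phi>. (\<integral>\<^sup>+\<tau>. H (\<phi> + \<sigma> * \<tau>) \<tau> * indicator {- pi..0} \<tau> * indicator {0..<2 * pi} \<phi> \<partial>lborel) \<partial>lborel)"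
    unfolding inner
  proof (rule nn_integral_cong)
    fix \<phi> :: real
    have [measurable]: "(\<lambda>\<tau>. H (\<phi> + \<sigma> * \<tau>) \<tau> * indicator {- pi..0} \<tau>) \<in> borel_measurable lborel"
    proof -
      have "(\<lambda>\<tau>. (\<phi> + \<sigma> * \<tau>, \<tau>)) \<in> borel_measurable borel"
        by (intro borel_measurable_continuous_onI continuous_intros)
      from measurable_compose[OF this Hm] show ?thesis by simp
    qed
    show "(\<integral>\<^sup>+\<tau>. H (\<phi> + \<sigma> * \<tau>) \<tau> * indicator {- pi..0} \<tau> \<partial>lborel) * indicator {0..<2 * pi} \<phi>
      = (\<integral>\<^sup>+\<tau>. H (\<phi> + \<sigma> * \<tau>) \<tau> * indicator {- pi..0} \<tau> * indicator {0..<2 * pi} \<phi> \<partial>lborel)"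
      by (rule nn_integral_multc[symmetric]) measurable
  qed
  also have "\<dots> = (\<integral>\<^sup>+\<tau>. (\<integral>\<^sup>+\<phi>. H (\<phi> + \<sigma> * \<tau>) \<tau> * indicator {- pi..0} \<tau> * indicator {0..<2 * pi} \<phi> \<partial>lborel) \<partial>lborel)"
    using lborel_pair.Fubini'[OF m2] by simp
  also have "\<dots> = (\<integral>\<^sup>+\<tau>. (\<integral>\<^sup>+\<phi>. H \<phi> \<tau> * indicator {0..<2 * pi} \<phi> * indicator {- pi..0} \<tau> \<partial>lborel) \<partial>lborel)"
  proof (rule nn_integral_cong)
    fix \<tau> :: real
    have "(\<lambda>\<phi>. H (\<phi> + \<sigma> * \<tau>) \<tau>) \<in> borel_measurable borel"
      using measurable_compose[OF _ Hm, of "\<lambda>\<phi>. (\<phi> + \<sigma> * \<tau>, \<tau>)" borel] by simp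
    then have "(\<integral>\<^sup>+\<phi>. H (\<phi> + \<sigma> * \<tau>) \<tau> * indicator {- pi..0} \<tau> * indicator {0..<2 * pi} \<phi> \<partial>lborel)
      = (\<integral>\<^sup>+\<phi>. H (\<phi> + \<sigma> * \<tau>) \<tau> * indicator {0..<2 * pi} \<phi> \<partial>lborel) * indicator {- pi..0} \<tau>"
      by (subst nn_integral_multc[symmetric]) (auto simp: ac_simps)
    also have "(\<integral>\<^sup>+\<phi>. H (\<phi> + \<sigma> * \<tau>) \<tau> * indicator {0..<2 * pi} \<phi> \<partial>lborel) = (\<integral>\<^sup>+\<phi>. H \<phi> \<tau> * indicator {0..<2 * pi} \<phi> \<partial>lborel)"
      by (rule nn_integral_periodic_shift[where H = "\<lambda>\<phi>. H \<phi> \<tau>"]) (auto simp: Hper)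
    also have "\<dots> * indicator {- pi..0} \<tau> = (\<integral>\<^sup>+\<phi>. H \<phi> \<tau> * indicator {0..<2 * pi} \<phi> * indicator {- pi..0} \<tau> \<partial>lborel)"
      by (rule nn_integral_multc[symmetric]) auto
    finally show "(\<integral>\<^sup>+\<phi>. H (\<phi> + \<sigma> * \<tau>) \<tau> * indicator {- pi..0} \<tau> * indicator {0..<2 * pi} \<phi> \<partial>lborel)
      = (\<integral>\<^sup>+\<phi>. H \<phi> \<tau> * indicator {0..<2 * pi} \<phi> * indicator {- pi..0} \<tau> \<partial>lborel)" .
  qed
  also have "\<dots> = (\<integral>\<^sup>+z. (case z of (\<phi>, \<tau>) \<Rightarrow> H \<phi> \<tau> * indicator {0..<2 * pi} \<phi> * indicator {- pi..0} \<tau>) \<partial>(lborel \<Otimes>\<^sub>M lborel))"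
    using lborel_pair.nn_integral_snd[OF m3] by simp
  also have "\<dots> = ?L"
    unfolding lborel_prod by (intro nn_integral_cong) (auto simp: H_def cell_def indicator_def)
  finally show ?thesis by simp
qed

lemma compact_cell_closure: "compact ({0..2 * pi} \<times> {- pi..0} :: (real \<times> real) set)"
  by (intro compact_Times) auto

lemma continuous_bounded_on_cell:
  fixes f :: "real \<times> real \<Rightarrow> real"
  assumes "continuous_on UNIV f"
  obtains B where "B > 0" "\<And>z. z \<in> cell \<Longrightarrow> \<bar>f z\<bar> \<le> B"
proof -
  have "bounded (f ` ({0..2 * pi} \<times> {- pi..0}))"
    by (intro compact_imp_bounded compact_continuous_image continuous_on_subset[OF assms] compact_cell_closure) auto
  then obtain B where "B > 0" "\<And>z. z \<in> {0..2 * pi} \<times> {- pi..0} \<Longrightarrow> \<bar>f z\<bar> \<le> B"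
    unfolding bounded_pos by auto
  then show thesis using that[of B] by (auto simp: cell_def)
qed

lemma emeasure_cell: "emeasure lborel cell < \<infinity>"
proof -
  have "emeasure lborel cell \<le> emeasure lborel ({0..2 * pi} \<times> {- pi..0} :: (real \<times> real) set)"
    by (intro emeasure_mono) (auto simp: cell_def intro!: borel_closed compact_imp_closed compact_cell_closure)
  also have "\<dots> < \<infinity>" using compact_cell_closure emeasure_compact_finite by blast
  finally show ?thesis .
qed

lemma integrable_on_cell:
  fixes f :: "real \<times> real \<Rightarrow> real"
  assumes [measurable]: "f \<in> borel_measurable borel" and "\<And>z. z \<in> cell \<Longrightarrow> \<bar>f z\<bar> \<le> B"
  shows "integrable lborel (\<lambda>z. f z * indicator cell z)"
proof (rule integrableI_bounded_set[where A = cell and B = B])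
  show "AE z in lborel. z \<in> cell \<longrightarrow> norm (f z * indicator cell z) \<le> B"
    using assms(2) by (intro AE_I2) (auto simp: indicator_def)
qed (use emeasure_cell in auto)

lemma integral_invariant:
  fixes u :: "real \<times> real \<Rightarrow> real"
  assumes u [measurable]: "u \<in> borel_measurable borel" and bd: "\<And>z. \<bar>u z\<bar> \<le> M"
    and per: "\<And>\<phi> p. u (\<phi> + 2 * pi, p) = u (\<phi>, p)"
  shows "integrable lborel (\<lambda>z. u (leave \<sigma> z) * weight z * indicator cell z)"
    and "(\<integral>z. u (leave 1 z) * weight z * indicator cell z \<partial>lborel) =
         (\<integral>z. u (leave (- 1) z) * weight z * indicator cell z \<partial>lborel)"
proof -
  obtain B where B: "\<And>z. z \<in> cell \<Longrightarrow> \<bar>weight z\<bar> \<le> B"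
    using continuous_bounded_on_cell[OF weight_cont] by blast
  have int: "integrable lborel (\<lambda>z. v (leave \<sigma> z) * weight z * indicator cell z)"
    if [measurable]: "v \<in> borel_measurable borel" and "\<And>z. \<bar>v z\<bar> \<le> K" for v \<sigma> K
  proof (rule integrable_on_cell[where B = "K * B"])
    fix z assume "z \<in> cell"
    then show "\<bar>v (leave \<sigma> z) * weight z\<bar> \<le> K * B"
      unfolding abs_mult using that(2)[of "leave \<sigma> z"] B[of z] by (intro mult_mono) auto
  qed measurable
  show "integrable lborel (\<lambda>z. u (leave \<sigma> z) * weight z * indicator cell z)" by (rule int[OF u bd])
  have eq: "(\<integral>z. v (leave 1 z) * weight z * indicator cell z \<partial>lborel) =
         (\<integral>z. v (leave (- 1) z) * weight z * indicator cell z \<partial>lborel)"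
    if v [measurable]: "v \<in> borel_measurable borel" and K: "\<And>z. \<bar>v z\<bar> \<le> K" and nn: "\<And>z. v z \<ge> 0"
      and per: "\<And>\<phi> p. v (\<phi> + 2 * pi, p) = v (\<phi>, p)" for v K
  proof -
    have "(\<integral>z. v (leave \<sigma> z) * weight z * indicator cell z \<partial>lborel)
      = enn2real (\<integral>\<^sup>+z. ennreal (v (leave \<sigma> z) * weight z) * indicator cell z \<partial>lborel)" for \<sigma>
    proof -
      have "(\<integral>z. v (leave \<sigma> z) * weight z * indicator cell z \<partial>lborel)
        = enn2real (\<integral>\<^sup>+z. ennreal (v (leave \<sigma> z) * weight z * indicator cell z) \<partial>lborel)"
      proof (rule integral_eq_nn_integral)
        show "(\<lambda>z. v (leave \<sigma> z) * weight z * indicator cell z) \<in> borel_measurable lborel" by measurable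
        show "AE z in lborel. 0 \<le> v (leave \<sigma> z) * weight z * indicator cell z"
          using nn weight_nonneg by (intro AE_I2) (auto simp: indicator_def)
      qed
      also have "(\<lambda>z. ennreal (v (leave \<sigma> z) * weight z * indicator cell z))
        = (\<lambda>z. ennreal (v (leave \<sigma> z) * weight z) * indicator cell z)"
        by (simp add: fun_eq_iff indicator_def)
      finally show ?thesis .
    qed
    then show ?thesis
      using measure_preserving[OF v nn per, of 1] measure_preserving[OF v nn per, of "- 1"] by simp
  qed
  \<comment> \<open>Adding the bound \<open>M\<close> reduces a signed function to the nonnegative
    case.\<close>
  have "(\<integral>z. (u (leave 1 z) + M) * weight z * indicator cell z \<partial>lborel) =
         (\<integral>z. (u (leave (- 1) z) + M) * weight z * indicator cell z \<partial>lborel)"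
  proof (rule eq[where K = "2 * M" and v = "\<lambda>z. u z + M"])
    show "\<bar>u z + M\<bar> \<le> 2 * M" "u z + M \<ge> 0" for z using bd[of z] by linarith+
  qed (auto simp: per)
  moreover have "(\<integral>z. (u (leave \<sigma> z) + M) * weight z * indicator cell z \<partial>lborel)
      = (\<integral>z. u (leave \<sigma> z) * weight z * indicator cell z \<partial>lborel)
        + (\<integral>z. M * weight z * indicator cell z \<partial>lborel)" for \<sigma>
    using int[OF u bd, of \<sigma>] int[of "\<lambda>_. M" "\<bar>M\<bar>" \<sigma>]
    by (subst Bochner_Integration.integral_add[symmetric]) (auto simp: algebra_simps)
  ultimately show "(\<integral>z. u (leave 1 z) * weight z * indicator cell z \<partial>lborel) =
         (\<integral>z. u (leave (- 1) z) * weight z * indicator cell z \<partial>lborel)" by simp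
qed

text \<open>The measure formula is applied to the indicator of \<open>N\<close>. A null set of the
  plane need not be periodic, so \<open>r\<close> first reduces the angle to one period.\<close>

lemma AE_leave_not_in_null_set:
  assumes N: "N \<in> null_sets (lborel :: (real \<times> real) measure)" and \<sigma>: "\<sigma> = 1 \<or> \<sigma> = - 1"
    and r [measurable]: "r \<in> borel_measurable borel" and rper: "\<And>\<phi>. r (\<phi> + 2 * pi) = r \<phi>"
    and rid: "\<And>\<phi>. 0 \<le> \<phi> \<Longrightarrow> \<phi> < 2 * pi \<Longrightarrow> r \<phi> = \<phi>"
  shows "AE z in lborel. z \<in> cell \<and> weight z \<noteq> 0 \<longrightarrow> (r (fst (leave \<sigma> z)), snd (leave \<sigma> z)) \<notin> N"
proof -
  have Ns [measurable]: "N \<in> sets borel" using N by (auto simp: null_sets_def)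
  define n :: "real \<times> real \<Rightarrow> real" where "n = (\<lambda>z. indicator N (r (fst z), snd z))"
  have rm: "(\<lambda>z. (r (fst z), snd z)) \<in> borel_measurable (borel :: (real \<times> real) measure)"
    unfolding borel_prod[symmetric] by measurable
  have nm [measurable]: "n \<in> borel_measurable borel"
    unfolding n_def using measurable_compose[OF rm, of "indicator N" borel] by simp
  have "(\<integral>\<^sup>+z. ennreal (n (leave \<sigma> z) * weight z) * indicator cell z \<partial>lborel) =
         (\<integral>\<^sup>+\<phi>. (\<integral>\<^sup>+p. ennreal (n (\<phi>, p) * indicator {g (\<phi> + pi) \<bullet> cis \<phi>..g \<phi> \<bullet> cis \<phi>} p) \<partial>lborel)
            * indicator {0..<2 * pi} \<phi> \<partial>lborel)"
    by (rule measure_preserving[OF nm _ _ \<sigma>]) (auto simp: n_def rper)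
  also have "\<dots> \<le> (\<integral>\<^sup>+\<phi>. (\<integral>\<^sup>+p. indicator N (\<phi>, p) \<partial>lborel) \<partial>lborel)"
  proof (rule nn_integral_mono)
    fix \<phi> :: real
    have "(\<integral>\<^sup>+p. ennreal (n (\<phi>, p) * indicator {g (\<phi> + pi) \<bullet> cis \<phi>..g \<phi> \<bullet> cis \<phi>} p) \<partial>lborel)
        \<le> (\<integral>\<^sup>+p. indicator N (\<phi>, p) \<partial>lborel)" if "\<phi> \<in> {0..<2 * pi}"
      using that rid[of \<phi>] by (intro nn_integral_mono) (auto simp: n_def indicator_def)
    then show "(\<integral>\<^sup>+p. ennreal (n (\<phi>, p) * indicator {g (\<phi> + pi) \<bullet> cis \<phi>..g \<phi> \<bullet> cis \<phi>} p) \<partial>lborel)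
            * indicator {0..<2 * pi} \<phi> \<le> (\<integral>\<^sup>+p. indicator N (\<phi>, p) \<partial>lborel)"
      by (auto simp: indicator_def)
  qed
  also have "\<dots> = (\<integral>\<^sup>+z. indicator N z \<partial>(lborel \<Otimes>\<^sub>M lborel))"
    by (rule lborel.nn_integral_fst) (simp add: lborel_prod)
  also have "\<dots> = 0" using N by (simp add: lborel_prod null_sets_def)
  finally have "(\<integral>\<^sup>+z. ennreal (n (leave \<sigma> z) * weight z) * indicator cell z \<partial>lborel) = 0" by simp
  then have "AE z in lborel. ennreal (n (leave \<sigma> z) * weight z) * indicator cell z = 0"
    by (subst (asm) nn_integral_0_iff_AE) measurable
  then show ?thesis
  proof (rule AE_mp, intro AE_I2 impI)
    fix z assume "ennreal (n (leave \<sigma> z) * weight z) * indicator cell z = 0" and z: "z \<in> cell \<and> weight z \<noteq> 0"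
    then have "n (leave \<sigma> z) * weight z \<le> 0" by (simp add: indicator_def ennreal_eq_0_iff)
    moreover have "weight z > 0" using z weight_nonneg[of z] by auto
    ultimately have "n (leave \<sigma> z) \<le> 0" by (simp add: mult_le_0_iff)
    then show "(r (fst (leave \<sigma> z)), snd (leave \<sigma> z)) \<notin> N" by (auto simp: n_def indicator_def split: if_splits)
  qed
qed

end

section \<open>Integrating the energy inequality below the invariant curve\<close>

context quarter_curve
begin

lemma d_periodic_int: "d (t + 2 * pi * of_int k) = d t"
proof -
  have e: "t + 2 * pi * of_int k + pi / 2 = t + pi / 2 + 2 * pi * of_int k" by simp
  show ?thesis unfolding d_def h_def e g_periodic_int cis_add_2pi_int ..
qed

lemma d_periodic: "d (t + 2 * pi) = d t"
  using d_periodic_int[of t 1] by simp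

lemma lower_shift: "y + (2 * pi, 0) \<in> lower \<longleftrightarrow> y \<in> lower"
  by (simp add: lower_def d_periodic)

lemma incoming_shift: "incoming (y + (2 * pi, 0)) = incoming y + (2 * pi, 0)"
  using incoming_shift_int[of y 1] by simp

lemma incoming_lower_shift: "(\<phi> + 2 * pi, p) \<in> incoming ` lower \<longleftrightarrow> (\<phi>, p) \<in> incoming ` lower"
proof
  assume "(\<phi>, p) \<in> incoming ` lower"
  then obtain y where y: "y \<in> lower" "incoming y = (\<phi>, p)" by (metis imageE)
  then have "incoming (y + (2 * pi, 0)) = (\<phi> + 2 * pi, p)" by (simp add: incoming_shift)
  then show "(\<phi> + 2 * pi, p) \<in> incoming ` lower" using y lower_shift by (metis image_eqI)
next
  assume "(\<phi> + 2 * pi, p) \<in> incoming ` lower"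
  then obtain y where y: "y \<in> lower" "incoming y = (\<phi> + 2 * pi, p)" by (metis imageE)
  have "y = (y - (2 * pi, 0)) + (2 * pi, 0)" by simp
  then have "incoming (y - (2 * pi, 0)) = (\<phi>, p)" "y - (2 * pi, 0) \<in> lower"
    using y lower_shift incoming_shift by (metis (no_types, lifting) add_Pair add.right_neutral add_right_imp_eq)+
  then show "(\<phi>, p) \<in> incoming ` lower" by (metis image_eqI)
qed

lemma incoming_lower_shift_int:
  "(\<phi> + 2 * pi * of_int k, p) \<in> incoming ` lower \<longleftrightarrow> (\<phi>, p) \<in> incoming ` lower"
  using periodic_int[of "\<lambda>\<phi>. (\<phi>, p) \<in> incoming ` lower" "2 * pi"] incoming_lower_shift by simp

lemma outgoing_lower: "outgoing ` lower = incoming ` lower"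
proof (intro equalityI image_subsetI)
  fix y assume y: "y \<in> lower"
  then have "y \<in> strip" using lower_subset_strip by blast
  then show "outgoing y \<in> incoming ` lower" "incoming y \<in> outgoing ` lower"
    using incoming_bounce[of y] outgoing_unbounce[of y] bounce_lower[OF y] unbounce_lower[OF y]
    by (metis image_eqI)+
qed

lemma open_incoming_lower: "open (incoming ` lower)"
  by (rule invariance_of_domain[OF continuous_on_incoming open_lower])
     (rule inj_on_subset[OF inj_on_incoming lower_subset_strip])

lemma incoming_mem_iff: "y \<in> strip \<Longrightarrow> incoming y \<in> incoming ` lower \<longleftrightarrow> y \<in> lower"
  using inj_on_image_mem_iff[OF inj_on_incoming] lower_subset_strip by blast

lemma outgoing_mem_iff: "y \<in> strip \<Longrightarrow> outgoing y \<in> incoming ` lower \<longleftrightarrow> y \<in> lower"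
  unfolding outgoing_lower[symmetric] using inj_on_image_mem_iff[OF inj_on_outgoing] lower_subset_strip by blast

lemma centred_bounded:
  obtains Q where "\<And>t. norm (g t - c) \<le> Q"
proof -
  have "bounded (g ` {0..2 * pi})"
    by (intro compact_imp_bounded compact_continuous_image g_cont) auto
  then obtain B where "\<forall>x\<in>g ` {0..2 * pi}. norm x \<le> B" unfolding bounded_iff by blast
  then have B: "\<And>t. t \<in> {0..2 * pi} \<Longrightarrow> norm (g t) \<le> B" by blast
  have "norm (g t - c) \<le> B + norm c" for t
  proof -
    obtain k :: int where "0 \<le> t + 2 * pi * of_int k" "t + 2 * pi * of_int k < 0 + 2 * pi"
      using reduce_mod_2pi by blast
    then have "norm (g t) \<le> B" using B[of "t + 2 * pi * of_int k"] by (simp add: g_periodic_int)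
    then show ?thesis using norm_triangle_ineq4[of "g t" c] by simp
  qed
  then show thesis by (rule that)
qed

text \<open>The signed distance of a line from the centre of symmetry, in place of the
  origin.\<close>

definition offset :: "real \<times> real \<Rightarrow> real" where
  "offset z = snd z - c \<bullet> cis (fst z)"

lemma energy_cont: "continuous_on UNIV (\<lambda>z. energy (fst z) (- snd z))"
proof -
  have "continuous_on UNIV (\<lambda>z::real\<times>real. h (fst z))" "continuous_on UNIV (\<lambda>z::real\<times>real. h1 (fst z))"
    "continuous_on UNIV (\<lambda>z::real\<times>real. h2 (fst z))"
    by (rule continuous_on_compose2[OF h_cont] continuous_on_compose2[OF h1_cont] continuous_on_compose2[OF h2_cont];
        auto intro: continuous_intros)+
  then show ?thesis unfolding energy_def by (intro continuous_intros)
qed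

lemma integral_energy_fubini:
  assumes I: "integrable lborel (\<lambda>z. energy (fst z) (- snd z) * weight z * indicator cell z
      * indicator {z. - d (fst z) < snd z \<and> snd z < 0} z)" (is "integrable lborel ?k")
  shows "(\<integral>z. energy (fst z) (- snd z) * weight z * indicator cell z
      * indicator {z. - d (fst z) < snd z \<and> snd z < 0} z \<partial>lborel)
    = integral {0..2 * pi} (\<lambda>t. integral {0..d t} (\<lambda>e. energy t e * (\<rho> t * sin e)))"
proof -
  define J where "J = (\<lambda>t. integral {0..d t} (\<lambda>e. energy t e * (\<rho> t * sin e)))"
  have inner: "(\<integral>\<tau>. ?k (t, \<tau>) \<partial>lborel) = indicator {0..<2 * pi} t * J t" for t
  proof -
    define f where "f = (\<lambda>e. energy t e * (\<rho> t * sin e))"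
    have fc: "continuous_on {0..d t} f" unfolding f_def energy_def by (intro continuous_intros)
    have "(\<integral>\<tau>. ?k (t, \<tau>) \<partial>lborel) = (\<integral>\<tau>. indicator {0..<2 * pi} t * (f (0 + (- 1) * \<tau>) * indicator {0<..<d t} (0 + (- 1) * \<tau>)) \<partial>lborel)"
      using d_bounds[of t]
      by (intro Bochner_Integration.integral_cong refl) (auto simp: f_def weight_def cell_def indicator_def)
    also have "\<dots> = indicator {0..<2 * pi} t * (\<integral>\<tau>. f (0 + (- 1) * \<tau>) * indicator {0<..<d t} (0 + (- 1) * \<tau>) \<partial>lborel)"
      by simp
    also have "(\<integral>\<tau>. f (0 + (- 1) * \<tau>) * indicator {0<..<d t} (0 + (- 1) * \<tau>) \<partial>lborel)
        = (\<integral>e. f e * indicator {0<..<d t} e \<partial>lborel)"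
      using lborel_integral_real_affine[of "- 1" "\<lambda>e. f e * indicator {0<..<d t} e" 0] by simp
    also have "\<dots> = (LINT e:{0<..<d t}|lborel. f e)"
      by (simp add: set_lebesgue_integral_def mult.commute)
    also have "\<dots> = integral {0<..<d t} f"
    proof (rule set_borel_integral_eq_integral(2))
      have "set_integrable lborel {0..d t} f" by (rule borel_integrable_atLeastAtMost'[OF fc])
      then show "set_integrable lborel {0<..<d t} f" by (rule set_integrable_subset) auto
    qed
    also have "\<dots> = J t" unfolding J_def f_def by (rule integral_open_interval_real[symmetric])
    finally show ?thesis .
  qed
  have I': "integrable (lborel \<Otimes>\<^sub>M lborel) ?k" using I by (simp only: lborel_prod)
  have "integrable lborel (\<lambda>t. \<integral>\<tau>. ?k (t, \<tau>) \<partial>lborel)" by (rule lborel_pair.integrable_fst'[OF I'])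
  then have J: "set_integrable lborel {0..<2 * pi} J" unfolding inner by (simp add: set_integrable_def)
  have "(\<integral>z. ?k z \<partial>lborel) = (\<integral>z. ?k z \<partial>(lborel \<Otimes>\<^sub>M lborel))" by (simp only: lborel_prod)
  also have "\<dots> = (\<integral>t. (\<integral>\<tau>. ?k (t, \<tau>) \<partial>lborel) \<partial>lborel)" by (rule lborel_pair.integral_fst'[OF I', symmetric])
  also have "\<dots> = (LINT t:{0..<2 * pi}|lborel. J t)" unfolding inner by (simp add: set_lebesgue_integral_def)
  also have "\<dots> = integral {0..<2 * pi} J" by (rule set_borel_integral_eq_integral(2)[OF J])
  also have "\<dots> = integral {0..2 * pi} J"
  proof (rule integral_spike_set)
    have "{0..<2 * pi} - {0..2 * pi} = {}" "{0..2 * pi} - {0..<2 * pi} = {2 * pi}" by auto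
    then show "negligible {x \<in> {0..<2 * pi} - {0..2 * pi}. J x \<noteq> 0}" "negligible {x \<in> {0..2 * pi} - {0..<2 * pi}. J x \<noteq> 0}"
      by (auto intro: negligible_subset[of "{2 * pi}"])
  qed
  finally show ?thesis by (simp add: J_def)
qed

text \<open>Integrated against \<open>weight\<close>, the two terms on the right of
  \<open>ineq\<close> are integrals of one function of lines, over outgoing and over incoming lines,
  and cancel. The work lies in replacing the Lebesgue measurable \<open>W\<close> by a bounded
  periodic Borel function without changing it off a null set of lines.\<close>

theorem energy_nonpos:
  assumes Wm: "W \<in> borel_measurable (lebesgue_on (incoming ` lower))"
    and Wper: "\<And>\<phi> p k. W (\<phi> + 2 * pi * of_int k, p) = W (\<phi>, p)"
    and Wb: "\<And>y. y \<in> lower \<Longrightarrow> \<bar>W (incoming y)\<bar> \<le> C"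
    and ineq: "\<And>y. y \<in> lower \<Longrightarrow> energy (fst y) (snd y)
        \<le> W (outgoing y) * (offset (outgoing y))\<^sup>2 - W (incoming y) * (offset (incoming y))\<^sup>2"
  shows "integral {0..2 * pi} (\<lambda>t. integral {0..d t} (\<lambda>e. energy t e * (\<rho> t * sin e))) \<le> 0"
proof -
  define X where "X = incoming ` lower"
  have "open X" unfolding X_def by (rule open_incoming_lower)
  then have Xs [measurable]: "X \<in> sets borel" by simp
  have "(\<lambda>z. indicator X z *\<^sub>R W z) \<in> borel_measurable (completion lborel)"
    using Wm Xs unfolding X_def[symmetric] by (subst (asm) borel_measurable_restrict_space_iff) auto
  from completion_ex_borel_measurable_real[OF this] obtain V
    where V [measurable]: "V \<in> borel_measurable lborel" and VW: "AE z in lborel. indicator X z *\<^sub>R W z = V z" by blast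
  from AE_E[OF VW] obtain N where N0: "{z \<in> space lborel. \<not> indicator X z *\<^sub>R W z = V z} \<subseteq> N"
    "emeasure lborel N = 0" "N \<in> sets lborel" .
  then have N: "N \<in> null_sets lborel" by (simp add: null_sets_def)
  have NV: "V z = W z" if "z \<notin> N" "z \<in> X" for z
  proof -
    have "indicator X z *\<^sub>R W z = V z" using subsetD[OF N0(1), of z] that(1) by auto
    then show ?thesis using that(2) by simp
  qed
  define r :: "real \<Rightarrow> real" where "r = (\<lambda>\<phi>. \<phi> + 2 * pi * of_int (- \<lfloor>\<phi> / (2 * pi)\<rfloor>))"
  have rm [measurable]: "r \<in> borel_measurable borel" unfolding r_def by simp
  have rper: "r (\<phi> + 2 * pi) = r \<phi>" for \<phi>
  proof -
    have "\<lfloor>(\<phi> + 2 * pi) / (2 * pi)\<rfloor> = \<lfloor>\<phi> / (2 * pi)\<rfloor> + 1" by (simp add: add_divide_distrib)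
    then show ?thesis by (simp add: r_def algebra_simps)
  qed
  have rid: "r \<phi> = \<phi>" if "0 \<le> \<phi>" "\<phi> < 2 * pi" for \<phi>
  proof -
    have "\<lfloor>\<phi> / (2 * pi)\<rfloor> = 0" using that by (intro floor_unique) auto
    then show ?thesis by (simp add: r_def)
  qed
  \<comment> \<open>The Borel version \<open>V\<close> need be neither bounded nor periodic:
    truncation at \<open>C\<close> and evaluation at the reduced angle repair this, and
    \<open>UW\<close> shows that almost nothing is lost.\<close>
  define U where "U = (\<lambda>z. max (- C) (min C (V (r (fst z), snd z))) * (offset z)\<^sup>2 * indicator X z)"
  have "(\<lambda>z. (r (fst z), snd z)) \<in> borel_measurable (borel :: (real \<times> real) measure)"
    unfolding borel_prod[symmetric] by measurable
  from measurable_compose[OF this, of V borel] V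
  have [measurable]: "(\<lambda>z. V (r (fst z), snd z)) \<in> borel_measurable borel" by simp
  have [measurable]: "offset \<in> borel_measurable borel" unfolding offset_def
    by (intro borel_measurable_continuous_onI continuous_intros)
  have Um: "U \<in> borel_measurable borel" unfolding U_def by measurable
  obtain Q where Q: "\<And>t. norm (g t - c) \<le> Q" using centred_bounded by blast
  have off: "(offset z)\<^sup>2 \<le> Q\<^sup>2" if "z \<in> X" for z
  proof -
    from \<open>z \<in> X\<close> obtain y where "y \<in> lower" "z = incoming y" unfolding X_def by blast
    then have "offset z = (g (fst y) - c) \<bullet> cis (fst y - snd y)"
      by (simp add: offset_def incoming_def inner_diff_left)
    then have "\<bar>offset z\<bar> \<le> norm (g (fst y) - c) * norm (cis (fst y - snd y))"
      by (metis Cauchy_Schwarz_ineq2)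
    then have "\<bar>offset z\<bar> \<le> Q" using Q[of "fst y"] by simp
    then show ?thesis by (meson abs_le_square_iff abs_ge_self order_trans)
  qed
  have Ub: "\<bar>U z\<bar> \<le> \<bar>C\<bar> * Q\<^sup>2" for z
  proof (cases "z \<in> X")
    case True
    have "\<bar>max (- C) (min C (V (r (fst z), snd z)))\<bar> \<le> \<bar>C\<bar>" by (auto simp: max_def min_def)
    then show ?thesis unfolding U_def abs_mult using True off[OF True] by (auto intro!: mult_mono)
  qed (simp add: U_def)
  have Uper: "U (\<phi> + 2 * pi, p) = U (\<phi>, p)" for \<phi> p
    unfolding U_def offset_def X_def using incoming_lower_shift[of \<phi> p]
    by (simp add: rper cis_add_2pi indicator_def)
  have UW: "U z = W z * (offset z)\<^sup>2" if "z \<in> X" "(r (fst z), snd z) \<notin> N" for z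
  proof -
    obtain \<phi> p where z: "z = (\<phi>, p)" by (cases z)
    have "(r \<phi>, p) \<in> X" using that(1) unfolding z X_def r_def incoming_lower_shift_int .
    then have "V (r \<phi>, p) = W (r \<phi>, p)" using NV that(2) by (simp add: z)
    also have "\<dots> = W z" unfolding r_def Wper z ..
    finally have "V (r \<phi>, p) = W z" .
    moreover have "\<bar>W z\<bar> \<le> C" using that(1) Wb by (auto simp: X_def)
    then have "max (- C) (min C (W z)) = W z" by linarith
    ultimately show ?thesis using that(1) unfolding U_def by (simp add: z)
  qed
  have leave: "leave 1 z = outgoing (fst z, - snd z)" "leave (- 1) z = incoming (fst z, - snd z)" for z
    by (simp_all add: leave_def outgoing_def incoming_def)
  define k where "k = (\<lambda>z. energy (fst z) (- snd z) * weight z * indicator cell z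
      * indicator {z. - d (fst z) < snd z \<and> snd z < 0} z)"
  have ki: "integrable lborel k"
  proof -
    obtain B1 where B1: "\<And>z. z \<in> cell \<Longrightarrow> \<bar>energy (fst z) (- snd z) * weight z\<bar> \<le> B1"
      using continuous_bounded_on_cell[OF continuous_on_mult[OF energy_cont weight_cont]] by blast
    have [measurable]: "{z. - d (fst z) < snd z \<and> snd z < 0} \<in> sets borel"
    proof -
      have "{z. - d (fst z) < snd z \<and> snd z < 0} = {z. - d (fst z) < snd z} \<inter> {z. snd z < 0}" by auto
      moreover have "continuous_on UNIV (\<lambda>y :: real \<times> real. d (fst y))"
        by (rule continuous_on_compose2[OF d_cont[of UNIV]]) (auto intro: continuous_intros)
      then have "open {z :: real \<times> real. - d (fst z) < snd z}" "open {z :: real \<times> real. snd z < 0}"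
        by (auto intro!: open_Collect_less continuous_intros)
      ultimately show ?thesis by (metis borel_open open_Int)
    qed
    have [measurable]: "(\<lambda>z. energy (fst z) (- snd z)) \<in> borel_measurable borel"
      by (rule borel_measurable_continuous_onI[OF energy_cont])
    have "integrable lborel (\<lambda>z. (energy (fst z) (- snd z) * weight z
      * indicator {z. - d (fst z) < snd z \<and> snd z < 0} z) * indicator cell z)"
    proof (rule integrable_on_cell[where B = B1])
      fix z assume "z \<in> cell"
      then show "\<bar>energy (fst z) (- snd z) * weight z * indicator {z. - d (fst z) < snd z \<and> snd z < 0} z\<bar> \<le> B1"
        using B1[of z] by (auto simp: indicator_def)
    qed measurable
    then show ?thesis unfolding k_def by (simp add: ac_simps)
  qed
  have "(\<integral>z. k z \<partial>lborel) \<le> (\<integral>z. (U (leave 1 z) * weight z * indicator cell z) - (U (leave (- 1) z) * weight z * indicator cell z) \<partial>lborel)"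
  proof (rule integral_mono_AE[OF ki])
    show "integrable lborel (\<lambda>z. (U (leave 1 z) * weight z * indicator cell z) - (U (leave (- 1) z) * weight z * indicator cell z))"
      by (intro Bochner_Integration.integrable_diff integral_invariant(1)[OF Um Ub Uper])
    have "AE z in lborel. z \<in> cell \<and> weight z \<noteq> 0 \<longrightarrow> (r (fst (leave 1 z)), snd (leave 1 z)) \<notin> N"
      "AE z in lborel. z \<in> cell \<and> weight z \<noteq> 0 \<longrightarrow> (r (fst (leave (- 1) z)), snd (leave (- 1) z)) \<notin> N"
      by (rule AE_leave_not_in_null_set[OF N _ rm rper rid]; simp)+
    then show "AE z in lborel. k z \<le> (U (leave 1 z) * weight z * indicator cell z) - (U (leave (- 1) z) * weight z * indicator cell z)"
    proof eventually_elim
      fix z assume a: "z \<in> cell \<and> weight z \<noteq> 0 \<longrightarrow> (r (fst (leave 1 z)), snd (leave 1 z)) \<notin> N"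
        "z \<in> cell \<and> weight z \<noteq> 0 \<longrightarrow> (r (fst (leave (- 1) z)), snd (leave (- 1) z)) \<notin> N"
      define y where "y = (fst z, - snd z)"
      show "k z \<le> (U (leave 1 z) * weight z * indicator cell z) - (U (leave (- 1) z) * weight z * indicator cell z)"
      proof (cases "z \<in> cell \<and> weight z \<noteq> 0")
        case False
        then show ?thesis by (auto simp: k_def)
      next
        case True
        then have w: "weight z > 0" using weight_nonneg[of z] by simp
        have "snd z \<noteq> 0" "snd z \<noteq> - pi" using True by (auto simp: weight_def)
        then have ys: "y \<in> strip" using True by (auto simp: y_def mem_strip cell_def)
        show ?thesis
        proof (cases "y \<in> lower")
          case True
          then have "incoming y \<in> X" "outgoing y \<in> X" using incoming_mem_iff[OF ys] outgoing_mem_iff[OF ys] by (auto simp: X_def)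
          then have "U (leave 1 z) = W (outgoing y) * (offset (outgoing y))\<^sup>2" "U (leave (- 1) z) = W (incoming y) * (offset (incoming y))\<^sup>2"
            using UW a \<open>z \<in> cell \<and> weight z \<noteq> 0\<close> unfolding leave y_def by auto
          then have "energy (fst z) (- snd z) \<le> U (leave 1 z) - U (leave (- 1) z)"
            using ineq[OF True] by (simp add: y_def)
          then have "energy (fst z) (- snd z) * weight z \<le> (U (leave 1 z) - U (leave (- 1) z)) * weight z"
            using w by (intro mult_right_mono) auto
          moreover have "k z = energy (fst z) (- snd z) * weight z"
            using True \<open>z \<in> cell \<and> weight z \<noteq> 0\<close> by (auto simp: k_def lower_def y_def indicator_def)
          ultimately show ?thesis using \<open>z \<in> cell \<and> weight z \<noteq> 0\<close> by (simp add: algebra_simps)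
        next
          case False
          then have "incoming y \<notin> X" "outgoing y \<notin> X" using incoming_mem_iff[OF ys] outgoing_mem_iff[OF ys] by (auto simp: X_def)
          then have "U (leave 1 z) = 0" "U (leave (- 1) z) = 0" unfolding leave y_def by (auto simp: U_def)
          moreover have "k z = 0" using False by (auto simp: k_def lower_def y_def indicator_def)
          ultimately show ?thesis by simp
        qed
      qed
    qed
  qed
  also have "\<dots> = 0"
    using integral_invariant[OF Um Ub Uper] by (subst Bochner_Integration.integral_diff) auto
  finally show ?thesis using integral_energy_fubini ki unfolding k_def by simp
qed

end

subsection \<open>Turning number and normal angle\<close>

text \<open>Hopf's Umlaufsatz: the secant directions extend continuously to the closed strip
  \<open>s \<le> t \<le> s + L\<close>, with tangent directions on one side and their opposites on the other; seen from
  a lowest point of the curve all secants point upwards.\<close>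

lemma Hopf_turning_number:
  fixes \<gamma> v :: "real \<Rightarrow> complex" and \<theta> :: "real \<Rightarrow> real"
  assumes \<gamma>: "\<And>s. (\<gamma> has_vector_derivative v s) (at s)" and v: "continuous_on UNIV v"
    and L: "L > 0" and per: "\<And>s. \<gamma> (s + L) = \<gamma> s"
    and inj: "\<And>s t. s < t \<Longrightarrow> t < s + L \<Longrightarrow> \<gamma> s \<noteq> \<gamma> t"
    and \<theta>: "continuous_on UNIV \<theta>" "\<And>s. v s = cis (\<theta> s)"
  shows "\<bar>\<theta> (s + L) - \<theta> s\<bar> = 2 * pi"
proof -
  have vper: "v (s + L) = v s" for s
  proof -
    have "((\<lambda>s. s + L) has_vector_derivative 1) (at s)" by (auto intro!: derivative_eq_intros)
    from vector_diff_chain_at[OF this \<gamma>[of "s + L"]]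
    have "(\<gamma> has_vector_derivative v (s + L)) (at s)" by (simp add: comp_def per)
    then show ?thesis using \<gamma>[of s] by (rule vector_derivative_unique_at)
  qed
  \<comment> \<open>The mean velocity between two parameters: the secant quotient, continued across
    the diagonal by the velocity.\<close>
  define D where "D = (\<lambda>z. integral (cbox 0 1) (\<lambda>r. v (fst z + r * (snd z - fst z))))"
  have Dc: "continuous_on UNIV D" unfolding D_def
  proof (rule integral_continuous_on_param)
    show "continuous_on (UNIV \<times> cbox 0 1) (\<lambda>(z, r). v (fst z + r * (snd z - fst z)))"
      unfolding split_beta' by (intro continuous_on_compose2[OF v] continuous_intros) auto
  qed
  have Deq: "\<gamma> t - \<gamma> s = (t - s) *\<^sub>R D (s, t)" for s t
  proof -
    have "((\<lambda>r. (t - s) *\<^sub>R v (s + r * (t - s))) has_integral (\<gamma> (s + 1 * (t - s)) - \<gamma> (s + 0 * (t - s)))) {0..1}"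
    proof (rule fundamental_theorem_of_calculus)
      fix r :: real assume "r \<in> {0..1}"
      have "((\<lambda>r. s + r * (t - s)) has_vector_derivative (t - s)) (at r)"
        by (auto intro!: derivative_eq_intros)
      from vector_diff_chain_at[OF this \<gamma>]
      show "((\<lambda>r. \<gamma> (s + r * (t - s))) has_vector_derivative (t - s) *\<^sub>R v (s + r * (t - s))) (at r within {0..1})"
        by (auto simp: comp_def intro: has_vector_derivative_at_within)
    qed simp
    from integral_unique[OF this] show ?thesis by (simp add: D_def)
  qed
  have Dss: "D (s, s) = v s" for s by (simp add: D_def)
  define S where "S = {z :: real \<times> real. fst z \<le> snd z \<and> snd z \<le> fst z + L}"
  \<comment> \<open>Dividing the secant by \<open>(t - s) * (s + L - t)\<close> removes its zeros on
    both edges of the strip. Each branch expresses the quotient through \<open>D\<close> on the half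
    where its remaining denominator stays away from 0.\<close>
  define W where "W = (\<lambda>z. if snd z - fst z \<le> L / 2 then (1 / (fst z + L - snd z)) *\<^sub>R D z
      else - (1 / (snd z - fst z)) *\<^sub>R D (fst z + L, snd z))"
  have int1: "(1 / (s + L - t)) *\<^sub>R D (s, t) = (1 / ((t - s) * (s + L - t))) *\<^sub>R (\<gamma> t - \<gamma> s)" if "s < t" for s t
    unfolding Deq using that by simp
  have int2: "- (1 / (t - s)) *\<^sub>R D (s + L, t) = (1 / ((t - s) * (s + L - t))) *\<^sub>R (\<gamma> t - \<gamma> s)" if "t < s + L" for s t
  proof -
    have "\<gamma> t - \<gamma> s = (t - (s + L)) *\<^sub>R D (s + L, t)" using Deq[of t "s + L"] by (simp add: per)
    moreover have "1 / ((t - s) * (s + L - t)) * (t - (s + L)) = - (1 / (t - s))"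
    proof -
      have alg: "1 / (a * b) * (- b) = - (1 / a)" if "b \<noteq> 0" for a b :: real
        using that by (cases "a = 0") auto
      have "s + L - t \<noteq> 0" using that by simp
      from alg[OF this] show ?thesis by (simp only: minus_diff_eq)
    qed
    ultimately show ?thesis by (simp only: scaleR_scaleR)
  qed
  have Wint: "W (s, t) = (1 / ((t - s) * (s + L - t))) *\<^sub>R (\<gamma> t - \<gamma> s)" if "s < t" "t < s + L" for s t
    using int1[OF that(1)] int2[OF that(2)] by (simp add: W_def)
  have W0: "W (s, s) = (1 / L) *\<^sub>R v s" for s using L by (simp add: W_def Dss)
  have W1: "W (s, s + L) = - (1 / L) *\<^sub>R v s" for s using L by (simp add: W_def Dss vper)
  have Wc: "continuous_on S W" unfolding W_def
  proof (rule continuous_on_cases_le)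
    show "continuous_on {z \<in> S. snd z - fst z \<le> L / 2} (\<lambda>z. (1 / (fst z + L - snd z)) *\<^sub>R D z)"
      using L by (intro continuous_intros continuous_on_subset[OF Dc]) auto
    show "continuous_on {z \<in> S. L / 2 \<le> snd z - fst z} (\<lambda>z. - (1 / (snd z - fst z)) *\<^sub>R D (fst z + L, snd z))"
      using L by (intro continuous_intros continuous_on_compose2[OF Dc]) auto
    show "continuous_on S (\<lambda>z. snd z - fst z)" by (intro continuous_intros)
    fix z assume "z \<in> S" "snd z - fst z = L / 2"
    then have "fst z < snd z" "snd z < fst z + L" using L by auto
    then show "(1 / (fst z + L - snd z)) *\<^sub>R D z = - (1 / (snd z - fst z)) *\<^sub>R D (fst z + L, snd z)"
      using int1[of "fst z" "snd z"] int2[of "snd z" "fst z"] by simp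
  qed
  have Scases: "\<exists>s t. z = (s, t) \<and> (t = s \<or> t = s + L \<or> (s < t \<and> t < s + L))" if "z \<in> S" for z
    using that by (cases z) (auto simp: S_def)
  have vnz: "v s \<noteq> 0" for s by (simp add: \<theta>)
  have Wnz: "W z \<noteq> 0" if "z \<in> S" for z
    using Scases[OF that] L vnz inj[THEN not_sym] by (auto simp: W0 W1 Wint)
  have convS: "convex S"
  proof -
    have S2: "S = {z. (- 1, 1) \<bullet> z \<ge> 0} \<inter> {z. (- 1, 1) \<bullet> z \<le> L}" by (auto simp: S_def inner_prod_def)
    show ?thesis unfolding S2 by (intro convex_Int convex_halfspace_ge convex_halfspace_le)
  qed
  obtain l where lc: "continuous_on S l" and l: "\<And>z. z \<in> S \<Longrightarrow> W z = exp (l z)"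
    using continuous_logarithm_on_contractible[OF Wc convex_imp_contractible[OF convS] Wnz] by blast
  define \<Theta> where "\<Theta> = (\<lambda>z. Im (l z))"
  have \<Theta>c: "continuous_on S \<Theta>" unfolding \<Theta>_def by (intro continuous_intros lc)
  have cis\<Theta>: "cis (\<Theta> z) = sgn (W z)" if "z \<in> S" for z
    unfolding \<Theta>_def cis_Im_eq_sgn using l[OF that] by simp
  have inS: "(s, s) \<in> S" "(s, s + L) \<in> S" for s using L by (auto simp: S_def)
  have flipS: "(snd z, fst z + L) \<in> S" if "z \<in> S" for z using that by (auto simp: S_def)
  have anti: "W (snd z, fst z + L) = - W z" if z: "z \<in> S" for z
  proof -
    obtain s t where st: "z = (s, t)" "t = s \<or> t = s + L \<or> (s < t \<and> t < s + L)" using Scases[OF z] by blast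
    show ?thesis using st(2)
    proof (elim disjE)
      assume "s < t \<and> t < s + L"
      then show ?thesis unfolding st(1) fst_conv snd_conv using Wint[of s t] Wint[of t "s + L"]
        by (simp add: per mult.commute scaleR_right_diff_distrib)
    qed (auto simp: st(1) W0 W1 vper)
  qed
  \<comment> \<open>Exchanging the ends of a secant reverses it, so its direction turns by an odd
    multiple of \<open>pi\<close> that is constant on the strip. Two exchanges advance both
    parameters by \<open>L\<close>, hence the total turning is \<open>2 * k\<close>.\<close>
  define K where "K = (\<lambda>z. \<Theta> (snd z, fst z + L) - \<Theta> z)"
  have Kc: "continuous_on S K" unfolding K_def
    by (intro continuous_intros \<Theta>c continuous_on_compose2[OF \<Theta>c] image_subsetI flipS)
  have cisK: "cis (K z) = - 1" if "z \<in> S" for z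
  proof -
    have "cis (K z) = cis (\<Theta> (snd z, fst z + L)) / cis (\<Theta> z)" by (simp add: K_def cis_divide)
    also have "\<dots> = - 1" using cis\<Theta>[OF that] cis\<Theta>[OF flipS[OF that]] anti[OF that] Wnz[OF that]
      by (simp add: sgn_minus sgn_zero_iff)
    finally show ?thesis .
  qed
  define k where "k = K (0, 0)"
  have K: "K z = k" if "z \<in> S" for z
    unfolding k_def by (rule constant_of_cis_constant[OF convex_connected[OF convS] Kc cisK that inS(1)])
  have \<Theta>1: "\<Theta> (s, s + L) = \<Theta> (s, s) + k" for s using K[OF inS(1)[of s]] by (simp add: K_def)
  have \<Theta>2: "\<Theta> (s + L, s + L) = \<Theta> (s, s) + 2 * k" for s
    using K[OF inS(2)[of s]] \<Theta>1[of s] by (simp add: K_def)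
  have "\<Theta> (s, s) - \<theta> s = \<Theta> (t, t) - \<theta> t" for s t
  proof (rule constant_of_cis_constant[where S = UNIV and f = "\<lambda>s. \<Theta> (s, s) - \<theta> s" and w = 1])
    show "continuous_on UNIV (\<lambda>s. \<Theta> (s, s) - \<theta> s)"
      by (intro continuous_intros \<theta> continuous_on_compose2[OF \<Theta>c]) (auto simp: inS)
    fix s show "cis (\<Theta> (s, s) - \<theta> s) = 1"
      unfolding cis_divide[symmetric] cis\<Theta>[OF inS(1)] W0 using L by (simp add: \<theta>(2)[symmetric] vnz sgn_scaleR sgn_div_norm) (simp add: \<theta>(2))
  qed auto
  from this[of "s + L" s] have turn: "\<theta> (s + L) - \<theta> s = 2 * k" using \<Theta>2[of s] by simp
  have "\<exists>s0. \<forall>t. Im (\<gamma> s0) \<le> Im (\<gamma> t)"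
  proof -
    have gc: "continuous_on UNIV \<gamma>" using \<gamma> by (meson continuous_at_imp_continuous_on has_vector_derivative_continuous)
    have "\<exists>s0\<in>{0..L}. \<forall>t\<in>{0..L}. Im (\<gamma> s0) \<le> Im (\<gamma> t)"
      using L by (intro continuous_attains_inf continuous_intros continuous_on_subset[OF gc]) auto
    then obtain s0 where s0: "\<And>t. t \<in> {0..L} \<Longrightarrow> Im (\<gamma> s0) \<le> Im (\<gamma> t)" by blast
    have "Im (\<gamma> s0) \<le> Im (\<gamma> t)" for t
    proof -
      define n where "n = \<lfloor>t / L\<rfloor>"
      have "of_int n \<le> t / L" "t / L < of_int n + 1" unfolding n_def by linarith+
      then have "t + L * of_int (- n) \<in> {0..L}" using L by (simp add: pos_le_divide_eq pos_divide_less_eq algebra_simps)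
      then show ?thesis using s0 periodic_int[of \<gamma> L t "- n"] per by metis
    qed
    then show ?thesis by blast
  qed
  then obtain s0 where s0: "\<And>t. Im (\<gamma> s0) \<le> Im (\<gamma> t)" by blast
  have Imv: "Im (v s0) = 0"
  proof (rule DERIV_local_min[of "\<lambda>s. Im (\<gamma> s)" _ s0 1])
    have "((\<lambda>s. Im (\<gamma> s)) has_vector_derivative Im (v s0)) (at s0)"
      by (rule bounded_linear.has_vector_derivative[OF bounded_linear_Im \<gamma>])
    then show "((\<lambda>s. Im (\<gamma> s)) has_real_derivative Im (v s0)) (at s0)"
      by (simp add: has_real_derivative_iff_has_vector_derivative)
  qed (use s0 in auto)
  define I where "I = {s0..s0 + L}"
  have IS: "(s0, t) \<in> S" if "t \<in> I" for t using that by (auto simp: I_def S_def)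
  have ImW: "Im (W (s0, t)) \<ge> 0" if t: "t \<in> I" for t
  proof -
    have "t = s0 \<or> t = s0 + L \<or> (s0 < t \<and> t < s0 + L)" using t by (auto simp: I_def)
    then show ?thesis
    proof (elim disjE)
      assume "s0 < t \<and> t < s0 + L"
      then show ?thesis using s0[of t] by (simp add: Wint)
    qed (auto simp: W0 W1 Imv)
  qed
  \<comment> \<open>Multiplication by \<open>- \<i>\<close> takes the closed upper half-plane to the
    closed right one, where the principal argument is at most \<open>pi / 2\<close> in absolute
    value; this gives \<open>\<bar>k\<bar> \<le> pi\<close>.\<close>
  have Re: "Re (- \<i> * W (s0, t)) \<ge> 0" "- \<i> * W (s0, t) \<noteq> 0" if "t \<in> I" for t
    using ImW[OF that] Wnz[OF IS[OF that]] by auto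
  have nonpos: "- \<i> * W (s0, t) \<notin> \<real>\<^sub>\<le>\<^sub>0" if "t \<in> I" for t
    using Re[OF that] by (auto simp: complex_nonpos_Reals_iff complex_eq_iff)
  define A where "A = (\<lambda>t. Im (Ln (- \<i> * W (s0, t))))"
  have Ab: "\<bar>A t\<bar> \<le> pi / 2" if "t \<in> I" for t
    unfolding A_def using Re[OF that] Re_Ln_pos_le by blast
  have Wc0: "continuous_on I (\<lambda>t. W (s0, t))"
    by (intro continuous_on_compose2[OF Wc] continuous_intros) (use IS in auto)
  have Ac: "continuous_on I A" unfolding A_def
    by (intro continuous_intros Wc0) (use nonpos in auto)
  have "\<Theta> (s0, s0 + L) - A (s0 + L) = \<Theta> (s0, s0) - A s0"
  proof (rule constant_of_cis_constant[where S = I and f = "\<lambda>t. \<Theta> (s0, t) - A t" and w = \<i>])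
    show "continuous_on I (\<lambda>t. \<Theta> (s0, t) - A t)"
      by (intro continuous_intros Ac continuous_on_compose2[OF \<Theta>c]) (use IS in auto)
    fix t assume t: "t \<in> I"
    have "cis (A t) = sgn (- \<i> * W (s0, t))" unfolding A_def cis_Im_eq_sgn using Re(2)[OF t] by simp
    also have "\<dots> = - \<i> * sgn (W (s0, t))" by (simp add: sgn_mult sgn_div_norm norm_mult)
    finally show "cis (\<Theta> (s0, t) - A t) = \<i>"
      unfolding cis_divide[symmetric] cis\<Theta>[OF IS[OF t]] using Wnz[OF IS[OF t]] by (simp add: sgn_zero_iff field_simps)
  qed (use L in \<open>auto simp: I_def\<close>)
  then have "k = A (s0 + L) - A s0" using \<Theta>1[of s0] by simp
  then have kb: "\<bar>k\<bar> \<le> pi" using Ab[of s0] Ab[of "s0 + L"] L by (auto simp: I_def)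
  have "cis k = cis pi" using cisK[OF inS(1)[of 0]] by (simp add: k_def)
  then obtain n :: int where n: "k = pi + 2 * pi * of_int n" by (rule cis_eq_imp_diff)
  have "\<bar>k\<bar> = pi"
  proof -
    have "k = pi * (1 + 2 * of_int n)" using n by (simp add: algebra_simps)
    then have "pi * \<bar>1 + 2 * of_int n :: real\<bar> \<le> pi * 1" using kb by (simp add: abs_mult)
    then have "\<bar>1 + 2 * of_int n :: real\<bar> \<le> 1" by (simp only: mult_le_cancel_left_pos[OF pi_gt_zero])
    then have "n = 0 \<or> n = - 1" by linarith
    then show ?thesis using n by auto
  qed
  then show ?thesis using turn by (simp add: abs_mult)
qed

lemma simple_closed_arclength_inj:
  assumes "simple_closed_arclength \<gamma> L" "s < t" "t < s + L"
  shows "\<gamma> s \<noteq> \<gamma> t"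
proof
  assume eq: "\<gamma> s = \<gamma> t"
  have L: "L > 0" and per: "\<And>s. \<gamma> (s + L) = \<gamma> s" and lf: "loop_free (\<lambda>t. \<gamma> (L * t))"
    using assms(1) by (auto simp: simple_closed_arclength_def simple_path_def)
  have fr: "\<gamma> (L * frac (s / L)) = \<gamma> s" for s
    using periodic_int[of \<gamma> L s "- \<lfloor>s / L\<rfloor>"] per L by (simp add: frac_def algebra_simps)
  have "\<gamma> (L * frac (s / L)) = \<gamma> (L * frac (t / L))" using eq by (simp add: fr)
  moreover have "frac x \<in> {0..1}" "frac x \<noteq> 1" for x :: real
    using frac_lt_1[of x] frac_ge_0[of x] by auto
  ultimately have "frac (s / L) = frac (t / L)" using lf unfolding loop_free_def by metis
  then have "t / L - s / L = of_int (\<lfloor>t / L\<rfloor> - \<lfloor>s / L\<rfloor>)" by (simp add: frac_def)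
  moreover have "0 < t / L - s / L" "t / L - s / L < 1"
    using assms(2,3) L by (simp_all add: diff_divide_distrib[symmetric])
  ultimately have "0 < \<lfloor>t / L\<rfloor> - \<lfloor>s / L\<rfloor>" "\<lfloor>t / L\<rfloor> - \<lfloor>s / L\<rfloor> < 1" by linarith+
  then show False by simp
qed

text \<open>A primitive of the curvature is a continuous tangent angle. It is strictly increasing
  and, by \<open>Hopf_turning_number\<close>, gains exactly one turn per period, so it can serve as
  parameter; the derivative of its inverse is the radius of curvature.\<close>

lemma normal_angle_parametrization:
  assumes simple: "simple_closed_arclength \<gamma> L" and C2: "C2_curve \<gamma>" and curv: "\<And>s. curvature \<gamma> s > 0"
  obtains g \<rho> N where "convex_curve g \<rho>" "\<And>s. \<gamma> s = g (N s)" "\<And>s. velocity \<gamma> s = \<i> * cis (N s)"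
    "strict_mono N" "continuous_on UNIV N" "\<And>s. N (s + L) = N s + 2 * pi" "\<And>\<psi>. \<exists>s. N s = \<psi>"
    "\<And>s. (\<gamma> has_vector_derivative velocity \<gamma> s) (at s)"
proof -
  have L: "L > 0" and per: "\<And>s. \<gamma> (s + L) = \<gamma> s" and unit: "\<And>s. norm (velocity \<gamma> s) = 1"
    using simple by (auto simp: simple_closed_arclength_def)
  define v where "v = velocity \<gamma>"
  define v2 where "v2 = velocity v"
  have \<gamma>v: "(\<gamma> has_vector_derivative v s) (at s)" and vv: "(v has_vector_derivative v2 s) (at s)"
    and v2c: "continuous_on UNIV v2" for s
    using C2 unfolding C2_curve_def C1_differentiable_on_eq v2_def v_def
    by (auto simp: vector_derivative_works[symmetric])
  have vc: "continuous_on UNIV v" using vv by (meson continuous_at_imp_continuous_on has_vector_derivative_continuous)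
  define \<kappa> where "\<kappa> = (\<lambda>s. v2 s \<bullet> (\<i> * v s))"
  have \<kappa>: "\<kappa> s > 0" for s using curv[of s] by (simp add: \<kappa>_def curvature_def v2_def v_def)
  have \<kappa>c: "continuous_on UNIV \<kappa>" unfolding \<kappa>_def by (intro continuous_intros v2c vc)
  have v1: "v s \<bullet> v s = 1" for s using unit[of s] by (simp add: v_def dot_square_norm)
  have v2: "v2 s = \<kappa> s *\<^sub>R (\<i> * v s)" for s
  proof -
    have "((\<lambda>s. v s \<bullet> v s) has_vector_derivative (v s \<bullet> v2 s + v2 s \<bullet> v s)) (at s)"
      by (rule bounded_bilinear.has_vector_derivative[OF bounded_bilinear_inner vv vv])
    moreover have "((\<lambda>s. v s \<bullet> v s) has_vector_derivative 0) (at s)" unfolding v1 by simp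
    ultimately have "v s \<bullet> v2 s + v2 s \<bullet> v s = 0" by (rule vector_derivative_unique_at)
    then have 1: "v2 s \<bullet> v s = 0" by (simp add: inner_commute)
    obtain x y p q where xy: "v s = Complex x y" "v2 s = Complex p q" by (metis complex.exhaust)
    have "x * x + y * y = 1" "p * x + q * y = 0" using 1 v1[of s] by (simp_all add: xy inner_complex_def)
    then have "p = (- p * y + q * x) * - y" "q = (- p * y + q * x) * x" by algebra+
    then show ?thesis by (simp add: \<kappa>_def xy inner_complex_def complex_eq_iff)
  qed
  obtain F where F: "\<And>s. (F has_real_derivative \<kappa> s) (at s)" using antiderivative_exists[OF \<kappa>c] by blast
  \<comment> \<open>Rotating the velocity back by the accumulated curvature leaves a constant
    vector, which yields a lift of the direction without choosing logarithms.\<close>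
  have "((\<lambda>s. v s * cis (- F s)) has_vector_derivative 0) (at s)" for s
  proof -
    have "((\<lambda>s. - F s) has_derivative (\<lambda>h. - \<kappa> s * h)) (at s)"
      using DERIV_minus[OF F[of s]] unfolding has_field_derivative_def .
    from has_derivative_cis[OF this]
    have "((\<lambda>s. cis (- F s)) has_vector_derivative - \<kappa> s *\<^sub>R (\<i> * cis (- F s))) (at s)"
      by (simp add: has_vector_derivative_def mult.commute)
    from has_vector_derivative_mult[OF vv this]
    show ?thesis by (simp add: v2 scaleR_conv_of_real algebra_simps)
  qed
  then have "\<exists>E. \<forall>s\<in>UNIV. v s * cis (- F s) = E"
    by (intro has_derivative_zero_constant[of UNIV]) (simp_all add: has_vector_derivative_def)
  then obtain E where E: "\<And>s. v s * cis (- F s) = E" by blast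
  have vE: "v s = E * cis (F s)" for s
  proof -
    have "E * cis (F s) = v s * (cis (- F s) * cis (F s))" by (simp add: E[of s, symmetric] mult.assoc)
    then show ?thesis by (simp add: cis_mult)
  qed
  have "norm E = 1" using unit[of 0] vE[of 0] by (simp add: v_def norm_mult)
  then obtain e where e: "E = cis e" by (rule cis_norm_1)
  define \<theta> where "\<theta> = (\<lambda>s. F s + e)"
  have v\<theta>: "v s = cis (\<theta> s)" for s
    unfolding vE \<theta>_def e by (simp add: cis_mult add.commute)
  have \<theta>: "(\<theta> has_real_derivative \<kappa> s) (at s)" for s
    unfolding \<theta>_def by (auto intro!: derivative_eq_intros F)
  have \<theta>c: "continuous_on UNIV \<theta>" using \<theta> by (meson DERIV_isCont continuous_at_imp_continuous_on)
  have mono: "\<theta> a < \<theta> b" if "a < b" for a b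
    by (rule DERIV_pos_imp_increasing[OF that]) (use \<theta> \<kappa> in blast)
  have "\<bar>\<theta> (s + L) - \<theta> s\<bar> = 2 * pi" for s
    by (rule Hopf_turning_number[OF \<gamma>v vc L per simple_closed_arclength_inj[OF simple] \<theta>c v\<theta>])
  then have turn: "\<theta> (s + L) = \<theta> s + 2 * pi" for s using mono[of s "s + L"] L by (smt (verit))
  define N where "N = (\<lambda>s. \<theta> s - pi / 2)"
  have N: "(N has_real_derivative \<kappa> s) (at s)" for s
    unfolding N_def by (auto intro!: derivative_eq_intros \<theta>)
  have Nc: "continuous_on UNIV N" unfolding N_def by (intro continuous_intros \<theta>c)
  have Nmono: "strict_mono N" using mono by (auto simp: N_def strict_mono_def)
  have NL: "N (s + L) = N s + 2 * pi" for s by (simp add: N_def turn)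
  have vN: "v s = \<i> * cis (N s)" for s
    unfolding v\<theta> N_def by (simp add: complex_eq_iff cos_diff sin_diff)
  have Nint: "N (s + L * of_int n) = N s + 2 * pi * of_int n" for s and n :: int
    by (rule shift_int[where f = N and T = L and w = "2 * pi", OF NL])
  have surj: "\<exists>s. N s = \<psi>" for \<psi>
  proof -
    define n where "n = \<lfloor>(\<psi> - N 0) / (2 * pi)\<rfloor>"
    have "of_int n \<le> (\<psi> - N 0) / (2 * pi)" "(\<psi> - N 0) / (2 * pi) < of_int n + 1" unfolding n_def by linarith+
    then have "2 * pi * of_int n \<le> \<psi> - N 0" "\<psi> - N 0 \<le> 2 * pi * of_int n + 2 * pi"
      by (simp_all add: pos_le_divide_eq pos_divide_less_eq algebra_simps)
    moreover have "N 0 \<le> \<psi> - 2 * pi * of_int n" "\<psi> - 2 * pi * of_int n \<le> N L"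
      using calculation NL[of 0] by simp_all
    then have "\<exists>s. 0 \<le> s \<and> s \<le> L \<and> N s = \<psi> - 2 * pi * of_int n"
      using L by (intro IVT') (auto intro: continuous_on_subset[OF Nc])
    then obtain s where "N s = \<psi> - 2 * pi * of_int n" by blast
    then have "N (s + L * of_int n) = \<psi>" by (simp add: Nint)
    then show ?thesis by blast
  qed
  define M where "M = inv N"
  have NM: "N (M \<psi>) = \<psi>" and MN: "M (N s) = s" for \<psi> s
    using surj[of \<psi>] strict_mono_imp_inj_on[OF Nmono] unfolding M_def by (auto simp: f_inv_into_f inv_f_f intro!: f_inv_into_f)
  have NisC: "isCont N s" for s using N DERIV_isCont by blast
  have MisC: "isCont M \<psi>" for \<psi>
  proof -
    have "isCont M (N (M \<psi>))"
      by (rule isCont_inverse_function[where d = 1]) (auto simp: MN NisC)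
    then show ?thesis by (simp add: NM)
  qed
  have M: "(M has_real_derivative inverse (\<kappa> (M \<psi>))) (at \<psi>)" for \<psi>
    by (rule DERIV_inverse_function[where f = N and a = "\<psi> - 1" and b = "\<psi> + 1"])
       (use N \<kappa>[of "M \<psi>"] NM MisC in auto)
  define g where "g = (\<lambda>\<psi>. \<gamma> (M \<psi>))"
  define \<rho> where "\<rho> = (\<lambda>\<psi>. inverse (\<kappa> (M \<psi>)))"
  have Mc: "continuous_on UNIV M" using MisC by (auto intro: continuous_at_imp_continuous_on)
  have "convex_curve g \<rho>"
  proof
    fix t
    have "(M has_vector_derivative \<rho> t) (at t)"
      using M[of t] by (simp add: \<rho>_def has_real_derivative_iff_has_vector_derivative)
    from vector_diff_chain_at[OF this \<gamma>v]
    show "(g has_vector_derivative \<rho> t *\<^sub>R (\<i> * cis t)) (at t)"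
      by (simp add: g_def comp_def vN NM)
    show "\<rho> t > 0" using \<kappa> by (simp add: \<rho>_def)
    have "M (t + 2 * pi) = M t + L" using NL[of "M t"] MN[of "M t + L"] by (simp add: NM)
    then show "g (t + 2 * pi) = g t" by (simp add: g_def per)
  next
    have "continuous_on UNIV (\<lambda>\<psi>. \<kappa> (M \<psi>))" by (rule continuous_on_compose2[OF \<kappa>c Mc]) auto
    then show "continuous_on UNIV \<rho>" unfolding \<rho>_def using \<kappa> by (intro continuous_intros) (auto simp: less_imp_neq[symmetric])
  qed
  then show thesis
    by (rule that) (use vN \<gamma>v Nmono Nc NL surj in \<open>auto simp: g_def MN v_def\<close>)
qed

subsection \<open>The phase cylinder in coordinates\<close>

definition line_of :: "real \<times> real \<Rightarrow> oriented_line" where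
  "line_of z = (cis (fst z), snd z)"

lemma line_of_eqD:
  assumes "line_of z = line_of w"
  obtains k :: int where "z = w + (2 * pi * of_int k, 0)"
proof -
  have "cis (fst z) = cis (fst w)" "snd z = snd w" using assms by (auto simp: line_of_def)
  then show thesis using cis_eq_imp_diff[of "fst z" "fst w"] that by (metis add.right_neutral fst_add prod.collapse snd_add fst_conv snd_conv)
qed

context convex_curve
begin

lemma line_mem_incoming:
  "line_of z \<in> line_of ` incoming ` strip \<longleftrightarrow> z \<in> incoming ` strip"
proof
  assume "line_of z \<in> line_of ` incoming ` strip"
  then obtain y where y: "y \<in> strip" "line_of z = line_of (incoming y)" by blast
  from y(2) obtain k :: int where "z = incoming y + (2 * pi * of_int k, 0)" by (rule line_of_eqD)
  then have "z = incoming (y + (2 * pi * of_int k, 0))" by (simp only: incoming_shift_int)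
  moreover have "y + (2 * pi * of_int k, 0) \<in> strip" using y(1) by (simp add: mem_strip)
  ultimately show "z \<in> incoming ` strip" by blast
qed blast

section \<open>The domain as an intersection of half-planes\<close>

definition hull_body :: "complex set" where
  "hull_body = {z. \<forall>\<psi>. z \<bullet> cis \<psi> \<le> g \<psi> \<bullet> cis \<psi>}"

definition hull_interior :: "complex set" where
  "hull_interior = {z. \<forall>\<psi>. z \<bullet> cis \<psi> < g \<psi> \<bullet> cis \<psi>}"

lemma closed_hull_body: "closed hull_body"
proof -
  have "hull_body = (\<Inter>\<psi>. {z. z \<bullet> cis \<psi> \<le> g \<psi> \<bullet> cis \<psi>})" by (auto simp: hull_body_def)
  then show ?thesis by (auto intro!: closed_INT closed_Collect_le continuous_intros)
qed

lemma convex_hull_body: "convex hull_body"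
proof -
  have "hull_body = (\<Inter>\<psi>. {z. cis \<psi> \<bullet> z \<le> g \<psi> \<bullet> cis \<psi>})" by (auto simp: hull_body_def inner_commute)
  then show ?thesis by (auto intro!: convex_INT convex_halfspace_le)
qed

lemma open_hull_interior: "open hull_interior"
  unfolding open_dist
proof
  fix z assume z: "z \<in> hull_interior"
  have "\<exists>t\<in>{0..2 * pi}. \<forall>s\<in>{0..2 * pi}. g t \<bullet> cis t - z \<bullet> cis t \<le> g s \<bullet> cis s - z \<bullet> cis s"
    by (intro continuous_attains_inf continuous_intros) auto
  then obtain t where t: "\<And>s. s \<in> {0..2 * pi} \<Longrightarrow> g t \<bullet> cis t - z \<bullet> cis t \<le> g s \<bullet> cis s - z \<bullet> cis s" by blast
  define m where "m = g t \<bullet> cis t - z \<bullet> cis t"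
  have "m > 0" using z by (simp add: m_def hull_interior_def)
  moreover have "w \<in> hull_interior" if w: "dist w z < m" for w
    unfolding hull_interior_def
  proof (intro CollectI allI)
    fix \<psi>
    obtain k :: int where k: "0 \<le> \<psi> + 2 * pi * of_int k" "\<psi> + 2 * pi * of_int k < 0 + 2 * pi"
      using reduce_mod_2pi by blast
    have c: "cis (\<psi> + 2 * pi * of_int k) = cis \<psi>" by (simp add: cis_add_2pi_int)
    have "m \<le> g \<psi> \<bullet> cis \<psi> - z \<bullet> cis \<psi>"
      using t[of "\<psi> + 2 * pi * of_int k"] k by (simp add: m_def g_periodic_int c)
    moreover have "(w - z) \<bullet> cis \<psi> \<le> norm (w - z) * norm (cis \<psi>)" by (rule norm_cauchy_schwarz)
    then have "w \<bullet> cis \<psi> - z \<bullet> cis \<psi> < m" using w by (simp add: inner_diff_left dist_norm)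
    ultimately show "w \<bullet> cis \<psi> < g \<psi> \<bullet> cis \<psi>" by linarith
  qed
  ultimately show "\<exists>e>0. \<forall>w. dist w z < e \<longrightarrow> w \<in> hull_interior" by blast
qed

text \<open>At an angle of equality, \<open>(z - g t) \<bullet> cis t\<close> attains its maximum 0.
  Its derivative there says that \<open>z\<close> also agrees with the contact point in the
  tangential direction.\<close>

lemma hull_boundary: "hull_body - hull_interior \<subseteq> range g"
proof
  fix z assume "z \<in> hull_body - hull_interior"
  then have le: "\<And>t. z \<bullet> cis t \<le> g t \<bullet> cis t" and "\<not> (\<forall>t. z \<bullet> cis t < g t \<bullet> cis t)"
    by (auto simp: hull_body_def hull_interior_def)
  then obtain \<psi> where "\<not> z \<bullet> cis \<psi> < g \<psi> \<bullet> cis \<psi>" by blast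
  then have eq: "z \<bullet> cis \<psi> = g \<psi> \<bullet> cis \<psi>" using le[of \<psi>] by simp
  have "((\<lambda>t. (z - g t) \<bullet> cis t) has_vector_derivative
     (z - g \<psi>) \<bullet> (\<i> * cis \<psi>) + (0 - \<rho> \<psi> *\<^sub>R (\<i> * cis \<psi>)) \<bullet> cis \<psi>) (at \<psi>)"
    by (rule bounded_bilinear.has_vector_derivative[OF bounded_bilinear_inner
          has_vector_derivative_diff[OF has_vector_derivative_const g_deriv]
          cis_has_vector_derivative])
  then have D: "((\<lambda>t. (z - g t) \<bullet> cis t) has_real_derivative (z - g \<psi>) \<bullet> (\<i> * cis \<psi>)) (at \<psi>)"
    by (simp add: has_real_derivative_iff_has_vector_derivative)
  have "(z - g \<psi>) \<bullet> (\<i> * cis \<psi>) = 0"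
    by (rule DERIV_local_max[OF D, of 1]) (use le eq in \<open>auto simp: inner_diff_left\<close>)
  then have "z - g \<psi> = 0" using orthogonal_to_cis[of "z - g \<psi>" \<psi>] eq by (simp add: inner_diff_left)
  then show "z \<in> range g" by auto
qed

lemma hull_interior_disjoint: "hull_interior \<inter> range g = {}"
  by (auto simp: hull_interior_def)

lemma bounded_hull_body: "bounded hull_body"
proof -
  have "bounded (g ` {0..2 * pi})"
    by (intro compact_imp_bounded compact_continuous_image g_cont) auto
  then obtain B where "\<forall>x\<in>g ` {0..2 * pi}. norm x \<le> B" unfolding bounded_iff by blast
  then have B: "\<And>t. t \<in> {0..2 * pi} \<Longrightarrow> norm (g t) \<le> B" by blast
  have "norm z \<le> B" if z: "z \<in> hull_body" for z
  proof -
    obtain k :: int where k: "0 \<le> Arg z + 2 * pi * of_int k" "Arg z + 2 * pi * of_int k < 0 + 2 * pi"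
      using reduce_mod_2pi by blast
    have "z = norm z *\<^sub>R cis (Arg z)" using rcis_cmod_Arg[of z] by (simp add: rcis_def scaleR_conv_of_real)
    then have "norm z = z \<bullet> cis (Arg z)" by (metis cis_dot_cis cos_zero diff_self inner_scaleR_left mult.right_neutral)
    also have "\<dots> \<le> g (Arg z) \<bullet> cis (Arg z)" using z by (simp add: hull_body_def)
    also have "\<dots> \<le> norm (g (Arg z)) * norm (cis (Arg z))" by (rule norm_cauchy_schwarz)
    also have "\<dots> \<le> B" using B[of "Arg z + 2 * pi * of_int k"] k by (simp add: g_periodic_int)
    finally show ?thesis .
  qed
  then show ?thesis unfolding bounded_iff by blast
qed

lemma hull_interior_subset: "hull_interior \<subseteq> hull_body"
  by (auto simp: hull_interior_def hull_body_def less_imp_le)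

text \<open>Within \<open>hull_body\<close> one leaves \<open>hull_interior\<close> only through the
  curve, so the complementary component of an interior point is bounded. Conversely, points off a
  convex set that contains the curve are outside.\<close>

lemma inside_eq_hull_interior: "inside (range g) = hull_interior"
proof (intro equalityI subsetI)
  fix z assume z: "z \<in> hull_interior"
  let ?C = "connected_component_set (- range g) z"
  have znot: "z \<notin> range g" using z hull_interior_disjoint by blast
  have "?C \<subseteq> hull_interior"
  proof (rule connected_subset_open[OF _ open_hull_interior closed_hull_body _ hull_interior_subset])
    show "?C \<inter> hull_body \<subseteq> hull_interior" using hull_boundary connected_component_subset by blast
    show "?C \<inter> hull_interior \<noteq> {}" using z znot connected_component_refl by blast
  qed auto
  then have "bounded ?C" using bounded_hull_body hull_interior_subset by (meson bounded_subset)
  then show "z \<in> inside (range g)" using znot by (simp add: inside_def)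
next
  fix z assume z: "z \<in> inside (range g)"
  have sub: "range g \<subseteq> hull_body" by (auto simp: hull_body_def support_le)
  have "inside (range g) \<subseteq> hull_body"
    using outside_subset_convex[OF convex_hull_body sub] inside_Int_outside by blast
  then have zb: "z \<in> hull_body" using z by blast
  then show "z \<in> hull_interior" using hull_boundary z by (auto simp: inside_def)
qed

text \<open>Equality at the midpoint would require equality at both ends, and a supporting line
  touches the curve only once.\<close>

lemma chord_midpoint_inside:
  assumes "chord a \<phi> b"
  shows "(g a + g b) /\<^sub>R 2 \<in> hull_interior"
  unfolding hull_interior_def
proof (intro CollectI allI)
  fix \<psi>
  have "g a \<bullet> cis \<psi> \<noteq> g \<psi> \<bullet> cis \<psi> \<or> g b \<bullet> cis \<psi> \<noteq> g \<psi> \<bullet> cis \<psi>"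
  proof (rule ccontr)
    assume "\<not> ?thesis"
    then obtain k l :: int where "a = \<psi> + 2 * pi * of_int k" "b = \<psi> + 2 * pi * of_int l" using support_eqD by metis
    then have "g a = g b" by (simp add: g_periodic_int)
    then show False using g_eq_close[of a b] assms by (auto simp: chord_def)
  qed
  then have "g a \<bullet> cis \<psi> + g b \<bullet> cis \<psi> < 2 * (g \<psi> \<bullet> cis \<psi>)"
    using support_le[of a \<psi>] support_le[of b \<psi>] by linarith
  then show "((g a + g b) /\<^sub>R 2) \<bullet> cis \<psi> < g \<psi> \<bullet> cis \<psi>" by (simp add: inner_add_left)
qed

end

text \<open>Ties the arclength parametrization, in which the definitions are stated, to
  \<open>g\<close> through the normal angle \<open>N\<close>.\<close>

locale billiard_table = convex_curve +
  fixes \<gamma> :: "real \<Rightarrow> complex" and L :: real and N :: "real \<Rightarrow> real"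
  assumes \<gamma>_eq: "\<gamma> s = g (N s)" and velocity_eq: "velocity \<gamma> s = \<i> * cis (N s)"
    and \<gamma>_deriv: "(\<gamma> has_vector_derivative velocity \<gamma> s) (at s)"
    and N_mono: "strict_mono N" and N_shift: "N (s + L) = N s + 2 * pi" and N_surj: "\<exists>s. N s = \<psi>"
begin

lemma range_\<gamma>: "range \<gamma> = range g"
proof (intro equalityI subsetI)
  fix z assume "z \<in> range g"
  then obtain \<psi> where "z = g \<psi>" by blast
  moreover obtain s where "N s = \<psi>" using N_surj by blast
  ultimately show "z \<in> range \<gamma>" using \<gamma>_eq[of s] by (metis rangeI)
qed (auto simp: \<gamma>_eq)

lemma velocity_at: "\<gamma> s = g \<psi> \<Longrightarrow> velocity \<gamma> s = \<i> * cis \<psi>"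
proof -
  assume "\<gamma> s = g \<psi>"
  then have "g (N s) = g \<psi>" by (simp add: \<gamma>_eq)
  then obtain k :: int where "N s = \<psi> + 2 * pi * of_int k" by (rule g_eqD)
  then show ?thesis by (simp add: velocity_eq cis_add_2pi_int)
qed

lemma tangent_at_g: "tangent_at \<gamma> (g \<psi>) = \<i> * cis \<psi>"
  unfolding tangent_at_def
proof (rule the_equality)
  obtain s where "N s = \<psi>" using N_surj by blast
  then show "\<exists>s. \<gamma> s = g \<psi> \<and> \<i> * cis \<psi> = velocity \<gamma> s" using \<gamma>_eq velocity_eq by auto
qed (auto dest: velocity_at)

lemma points_of_line: "points_of (line_of z) = {w. w \<bullet> cis (fst z) = snd z}"
  by (simp add: points_of_def line_of_def)

lemma direction_line: "direction (line_of z) = \<i> * cis (fst z)"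
  by (simp add: direction_def line_of_def)

lemma along_line:
  assumes "w \<bullet> cis \<phi> = z \<bullet> cis \<phi>"
  shows "z - w = (z \<bullet> (\<i> * cis \<phi>) - w \<bullet> (\<i> * cis \<phi>)) *\<^sub>R (\<i> * cis \<phi>)"
  using orthogonal_to_cis[of "z - w" \<phi>] assms by (simp add: inner_diff_left)

text \<open>The displacement along the line from another point of the curve to the impact, paired
  with the outer normal at the impact, gets the factor \<open>sin (snd y) > 0\<close>; the support
  property makes the product nonnegative.\<close>

lemma exit_point_incoming:
  assumes y: "y \<in> strip"
  shows "exit_point \<gamma> (line_of (incoming y)) = g (fst y)"
proof -
  define \<phi> where "\<phi> = fst y - snd y"
  have s: "sin (snd y) > 0" using y by (intro sin_gt_zero) (auto simp: mem_strip)
  have ex: "w \<bullet> (\<i> * cis \<phi>) \<le> g (fst y) \<bullet> (\<i> * cis \<phi>)" if "w \<in> range g" "w \<bullet> cis \<phi> = g (fst y) \<bullet> cis \<phi>" for w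
  proof -
    from \<open>w \<in> range g\<close> obtain t where t: "w = g t" by blast
    have "(g (fst y) - w) \<bullet> cis (fst y) \<ge> 0" using support_le[of t "fst y"] by (simp add: t inner_diff_left)
    then have "(g (fst y) \<bullet> (\<i> * cis \<phi>) - w \<bullet> (\<i> * cis \<phi>)) * sin (snd y) \<ge> 0"
      unfolding along_line[OF that(2)] by (simp add: \<phi>_def)
    then show ?thesis using s by (simp add: zero_le_mult_iff)
  qed
  show ?thesis unfolding exit_point_def range_\<gamma> points_of_line direction_line
  proof (rule the_equality)
    show "g (fst y) \<in> range g \<inter> {w. w \<bullet> cis (fst (incoming y)) = snd (incoming y)} \<and>
      (\<forall>w\<in>range g \<inter> {w. w \<bullet> cis (fst (incoming y)) = snd (incoming y)}.
        w \<bullet> (\<i> * cis (fst (incoming y))) \<le> g (fst y) \<bullet> (\<i> * cis (fst (incoming y))))"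
      using ex by (auto simp: incoming_def \<phi>_def)
  next
    fix z assume z: "z \<in> range g \<inter> {w. w \<bullet> cis (fst (incoming y)) = snd (incoming y)} \<and>
      (\<forall>w\<in>range g \<inter> {w. w \<bullet> cis (fst (incoming y)) = snd (incoming y)}.
        w \<bullet> (\<i> * cis (fst (incoming y))) \<le> z \<bullet> (\<i> * cis (fst (incoming y))))"
    then have z1: "z \<in> range g" "z \<bullet> cis \<phi> = g (fst y) \<bullet> cis \<phi>" by (auto simp: incoming_def \<phi>_def)
    moreover have "g (fst y) \<bullet> (\<i> * cis \<phi>) \<le> z \<bullet> (\<i> * cis \<phi>)" using z by (auto simp: incoming_def \<phi>_def)
    ultimately have "g (fst y) \<bullet> (\<i> * cis \<phi>) = z \<bullet> (\<i> * cis \<phi>)" using ex[OF z1] by simp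
    then show "z = g (fst y)" using along_line[OF z1(2)] by simp
  qed
qed

lemma entry_point_outgoing:
  assumes y: "y \<in> strip"
  shows "entry_point \<gamma> (line_of (outgoing y)) = g (fst y)"
proof -
  define \<phi> where "\<phi> = fst y + snd y"
  have s: "sin (snd y) > 0" using y by (intro sin_gt_zero) (auto simp: mem_strip)
  have ex: "g (fst y) \<bullet> (\<i> * cis \<phi>) \<le> w \<bullet> (\<i> * cis \<phi>)" if "w \<in> range g" "w \<bullet> cis \<phi> = g (fst y) \<bullet> cis \<phi>" for w
  proof -
    from \<open>w \<in> range g\<close> obtain t where t: "w = g t" by blast
    have "(g (fst y) - w) \<bullet> cis (fst y) \<ge> 0" using support_le[of t "fst y"] by (simp add: t inner_diff_left)
    then have "(w \<bullet> (\<i> * cis \<phi>) - g (fst y) \<bullet> (\<i> * cis \<phi>)) * sin (snd y) \<ge> 0"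
      unfolding along_line[OF that(2)] by (simp add: \<phi>_def algebra_simps)
    then show ?thesis using s by (simp add: zero_le_mult_iff)
  qed
  show ?thesis unfolding entry_point_def range_\<gamma> points_of_line direction_line
  proof (rule the_equality)
    show "g (fst y) \<in> range g \<inter> {w. w \<bullet> cis (fst (outgoing y)) = snd (outgoing y)} \<and>
      (\<forall>w\<in>range g \<inter> {w. w \<bullet> cis (fst (outgoing y)) = snd (outgoing y)}.
        g (fst y) \<bullet> (\<i> * cis (fst (outgoing y))) \<le> w \<bullet> (\<i> * cis (fst (outgoing y))))"
      using ex by (auto simp: outgoing_def \<phi>_def)
  next
    fix z assume z: "z \<in> range g \<inter> {w. w \<bullet> cis (fst (outgoing y)) = snd (outgoing y)} \<and>
      (\<forall>w\<in>range g \<inter> {w. w \<bullet> cis (fst (outgoing y)) = snd (outgoing y)}.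
        z \<bullet> (\<i> * cis (fst (outgoing y))) \<le> w \<bullet> (\<i> * cis (fst (outgoing y))))"
    then have z1: "z \<in> range g" "z \<bullet> cis \<phi> = g (fst y) \<bullet> cis \<phi>" by (auto simp: outgoing_def \<phi>_def)
    moreover have "z \<bullet> (\<i> * cis \<phi>) \<le> g (fst y) \<bullet> (\<i> * cis \<phi>)" using z by (auto simp: outgoing_def \<phi>_def)
    ultimately have "g (fst y) \<bullet> (\<i> * cis \<phi>) = z \<bullet> (\<i> * cis \<phi>)" using ex[OF z1] by simp
    then show "z = g (fst y)" using along_line[OF z1(2)] by simp
  qed
qed

lemma reflect_cis: "reflect (\<i> * cis \<psi>) (\<i> * cis (\<psi> - e)) = \<i> * cis (\<psi> + e)"
proof -
  have "2 * cos e * cos \<psi> = cos (\<psi> - e) + cos (\<psi> + e)" "2 * cos e * sin \<psi> = sin (\<psi> - e) + sin (\<psi> + e)"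
    by (simp_all add: cos_add cos_diff sin_add sin_diff)
  then show ?thesis by (simp add: reflect_def complex_eq_iff)
qed

lemma billiard_map_incoming:
  "y \<in> strip \<Longrightarrow> billiard_map \<gamma> (line_of (incoming y)) = line_of (outgoing y)"
  unfolding billiard_map_def Let_def exit_point_incoming tangent_at_g direction_line
  by (simp add: incoming_def reflect_cis line_through_def line_of_def outgoing_def)

text \<open>A line that meets the interior lies strictly between the two parallel supporting lines,
  which \<open>mem_incoming_image\<close> characterizes; in the other direction the midpoint of its
  chord is an interior point.\<close>

lemma phase_cylinder_eq: "phase_cylinder \<gamma> = line_of ` incoming ` strip"
proof (intro equalityI subsetI)
  fix x assume "x \<in> phase_cylinder \<gamma>"
  then obtain z where n: "norm (fst x) = 1" and z: "z \<bullet> fst x = snd x" "z \<in> hull_interior"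
    by (auto simp: phase_cylinder_def range_\<gamma> inside_eq_hull_interior points_of_def)
  obtain \<phi> where \<phi>: "fst x = cis \<phi>" using n by (rule cis_norm_1)
  have "z \<bullet> cis \<phi> < g \<phi> \<bullet> cis \<phi>" "z \<bullet> cis (\<phi> + pi) < g (\<phi> + pi) \<bullet> cis (\<phi> + pi)"
    using z(2) unfolding hull_interior_def by blast+
  then have "(\<phi>, snd x) \<in> incoming ` strip"
    unfolding mem_incoming_image using z(1) by (simp add: \<phi> cis_add_pi)
  moreover have "x = line_of (\<phi>, snd x)" by (simp add: line_of_def \<phi>[symmetric])
  ultimately show "x \<in> line_of ` incoming ` strip" by (metis image_eqI)
next
  fix x assume "x \<in> line_of ` incoming ` strip"
  then obtain y where y: "y \<in> strip" "x = line_of (incoming y)" by blast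
  have ch: "chord (fst (unbounce y)) (fst y - snd y) (fst y)" by (rule unbounce_props(1)[OF y(1)])
  have "(g (fst (unbounce y)) + g (fst y)) /\<^sub>R 2 \<in> inside (range \<gamma>)"
    unfolding range_\<gamma> inside_eq_hull_interior by (rule chord_midpoint_inside[OF ch])
  moreover have "(g (fst (unbounce y)) + g (fst y)) /\<^sub>R 2 \<in> points_of x"
    unfolding y(2) points_of_line using ch by (simp add: chord_def incoming_def inner_add_left)
  moreover have "norm (fst x) = 1" by (simp add: y(2) line_of_def)
  ultimately show "x \<in> phase_cylinder \<gamma>" by (auto simp: phase_cylinder_def)
qed

lemma boundary_eq: "boundary_delta_0 \<gamma> = range (\<lambda>\<psi>. line_of (\<psi>, g \<psi> \<bullet> cis \<psi>))"
proof -
  have "line_through (\<gamma> s) (velocity \<gamma> s) = line_of (N s, g (N s) \<bullet> cis (N s))" for s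
    by (simp add: line_through_def line_of_def \<gamma>_eq velocity_eq)
  moreover have "range N = UNIV" using N_surj by (metis surjI)
  ultimately show ?thesis unfolding boundary_delta_0_def by (metis (no_types, lifting) image_cong image_image)
qed

lemma iterate_billiard_map:
  "y \<in> strip \<Longrightarrow> (billiard_map \<gamma> ^^ k) (line_of (incoming y)) = line_of (incoming ((bounce ^^ k) y))"
  by (induction k) (auto simp: billiard_map_incoming iter_strip incoming_bounce)

end

subsection \<open>Structure of the invariant curve\<close>

lemma periodic_extension_continuous:
  fixes f :: "real \<Rightarrow> 'a::real_normed_vector"
  assumes f: "continuous_on {0..1} f" and step: "f 1 = f 0 + w"
  shows "continuous_on UNIV (\<lambda>t. f (frac t) + of_int \<lfloor>t\<rfloor> *\<^sub>R w)" (is "continuous_on UNIV ?F")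
proof (intro continuous_at_imp_continuous_on ballI)
  have piece: "continuous_on {of_int k..of_int k + 1} ?F" for k :: int
  proof (rule continuous_on_eq[where f = "\<lambda>t. f (t - of_int k) + of_int k *\<^sub>R w"])
    show "continuous_on {of_int k..of_int k + 1} (\<lambda>t. f (t - of_int k) + of_int k *\<^sub>R w)"
      by (intro continuous_intros continuous_on_compose2[OF f]) auto
    fix t :: real assume t: "t \<in> {of_int k..of_int k + 1}"
    show "f (t - of_int k) + of_int k *\<^sub>R w = ?F t"
    proof (cases "t = of_int k + 1")
      case True
      then have "\<lfloor>t\<rfloor> = k + 1" "frac t = 0" by (auto simp: frac_def)
      then show ?thesis using True by (simp add: step scaleR_left_distrib)
    next
      case False
      then have "\<lfloor>t\<rfloor> = k" using t by (intro floor_unique) auto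
      then show ?thesis by (simp add: frac_def)
    qed
  qed
  fix t :: real
  define k where "k = \<lfloor>t\<rfloor>"
  have tk: "of_int k \<le> t" "t < of_int k + 1" by (auto simp: k_def)
  have "continuous_on ({of_int (k - 1)..of_int (k - 1) + 1} \<union> {of_int k..of_int k + 1}) ?F"
    by (intro continuous_on_closed_Un piece) auto
  moreover have "({of_int (k - 1)..of_int (k - 1) + 1} \<union> {of_int k..of_int k + 1} :: real set) = {of_int k - 1..of_int k + 1}"
    by auto
  ultimately have "continuous_on {of_int k - 1..of_int k + 1} ?F" by simp
  moreover have "t \<in> interior {of_int k - 1..of_int k + 1}" using tk by simp
  ultimately show "isCont ?F t" using continuous_on_interior by blast
qed

lemma rotational_curve_winding_1:
  assumes "rotational_curve \<gamma> \<alpha>"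
  obtains c where "simple_path c" "pathfinish c = pathstart c" "path_image c = \<alpha>" "winding_number (fst \<circ> c) 0 = 1"
proof -
  obtain c where c: "simple_path c" "pathfinish c = pathstart c" "path_image c = \<alpha>"
    "\<alpha> \<subseteq> phase_cylinder \<gamma>" "winding_number (fst \<circ> c) 0 \<in> {1, - 1}"
    using assms unfolding rotational_curve_def by blast
  show thesis
  proof (cases "winding_number (fst \<circ> c) 0 = 1")
    case True
    then show ?thesis using that c by blast
  next
    case False
    then have w: "winding_number (fst \<circ> c) 0 = - 1" using c(5) by auto
    have p: "path (fst \<circ> c)" using c(1) unfolding path_def simple_path_def comp_def by (auto intro: continuous_intros)
    have "norm z = 1" if "z \<in> path_image (fst \<circ> c)" for z
      using that c(3,4) unfolding path_image_compose phase_cylinder_def by auto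
    then have nz: "0 \<notin> path_image (fst \<circ> c)" by force
    have "fst \<circ> reversepath c = reversepath (fst \<circ> c)" by (simp add: reversepath_def fun_eq_iff)
    then have "winding_number (fst \<circ> reversepath c) 0 = 1"
      using winding_number_reversepath[OF p nz] w by simp
    then show ?thesis using that[of "reversepath c"] c by (simp add: simple_path_reversepath)
  qed
qed

context billiard_table
begin

text \<open>A continuous logarithm of the normal along the loop supplies the angle. Winding number 1
  makes one traversal a shift by \<open>2 * pi\<close>, so the periodic extension is continuous; it
  inherits injectivity from the simple loop.\<close>

lemma rotational_curve_lift:
  assumes "rotational_curve \<gamma> \<alpha>"
  obtains z :: "real \<Rightarrow> real \<times> real" where "continuous_on UNIV z" "\<And>t. z (t + 1) = z t + (2 * pi, 0)" "inj z"
    "\<And>t. z t \<in> incoming ` strip" "\<alpha> = line_of ` range z"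
proof -
  obtain c where c: "simple_path c" "pathfinish c = pathstart c" "path_image c = \<alpha>" "winding_number (fst \<circ> c) 0 = 1"
    using rotational_curve_winding_1[OF assms] by blast
  have sub: "\<alpha> \<subseteq> phase_cylinder \<gamma>" using assms by (auto simp: rotational_curve_def)
  have cc: "continuous_on {0..1} c" using c(1) by (simp add: simple_path_def path_def)
  have p: "path (fst \<circ> c)" using cc unfolding path_def comp_def by (auto intro: continuous_intros)
  have unit: "norm (fst (c t)) = 1" if "t \<in> {0..1}" for t
  proof -
    have "c t \<in> phase_cylinder \<gamma>" using that sub c(3) by (auto simp: path_image_def)
    then show ?thesis by (simp add: phase_cylinder_def)
  qed
  have nz: "0 \<notin> path_image (fst \<circ> c)" using unit by (force simp: path_image_def)
  obtain q where q: "path q" "pathfinish q - pathstart q = 2 * of_real pi * \<i> * winding_number (fst \<circ> c) 0"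
    "\<And>t. t \<in> {0..1} \<Longrightarrow> (fst \<circ> c) t = 0 + exp (q t)"
    using winding_number_as_continuous_log[OF p nz] by blast
  define f where "f = (\<lambda>t. (Im (q t), snd (c t)))"
  have cisf: "cis (Im (q t)) = fst (c t)" if "t \<in> {0..1}" for t
    unfolding cis_Im_eq_sgn using q(3)[OF that] unit[OF that] by (simp add: sgn_div_norm)
  have lf: "line_of (f t) = c t" if "t \<in> {0..1}" for t
    using cisf[OF that] by (simp add: line_of_def f_def)
  have fc: "continuous_on {0..1} f" unfolding f_def
    using q(1) by (intro continuous_intros cc) (simp add: path_def)
  have "q 1 - q 0 = 2 * of_real pi * \<i>" using q(2) c(4) by (simp add: pathfinish_def pathstart_def)
  then have "Im (q 1) - Im (q 0) = 2 * pi" by (metis Im_complex_of_real Im_i_times minus_complex.simps(2) mult.commute Re_complex_of_real of_real_mult of_real_numeral)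
  moreover have "c 1 = c 0" using c(2) by (simp add: pathfinish_def pathstart_def)
  ultimately have f1: "f 1 = f 0 + (2 * pi, 0)" by (simp add: f_def)
  define z where "z = (\<lambda>t. f (frac t) + of_int \<lfloor>t\<rfloor> *\<^sub>R (2 * pi, 0))"
  have fr: "frac t \<in> {0..1}" for t :: real using frac_lt_1[of t] by (simp add: less_imp_le)
  have lz: "line_of (z t) = c (frac t)" for t
  proof -
    have "fst (z t) = fst (f (frac t)) + 2 * pi * of_int \<lfloor>t\<rfloor>" "snd (z t) = snd (f (frac t))"
      by (simp_all add: z_def)
    then have "line_of (z t) = line_of (f (frac t))"
      by (simp add: line_of_def cis_add_2pi_int)
    then show ?thesis using lf[OF fr] by simp
  qed
  show thesis
  proof (rule that)
    show "continuous_on UNIV z" unfolding z_def by (rule periodic_extension_continuous[OF fc f1])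
    show "z (t + 1) = z t + (2 * pi, 0)" for t
      unfolding z_def frac_1_eq by (simp add: algebra_simps)
    show \<alpha>: "\<alpha> = line_of ` range z"
    proof -
      have "\<alpha> \<subseteq> line_of ` range z"
      proof
        fix x assume "x \<in> \<alpha>"
        then obtain t where t: "t \<in> {0..1}" "x = c t" using c(3) by (auto simp: path_image_def)
        show "x \<in> line_of ` range z"
        proof (cases "t = 1")
          case True
          then have "x = c (frac 0)" using t \<open>c 1 = c 0\<close> by simp
          then show ?thesis using lz[of 0] by (metis imageI rangeI)
        next
          case False
          then have "frac t = t" using t by (simp add: frac_eq)
          then show ?thesis using lz[of t] t by (metis imageI rangeI)
        qed
      qed
      moreover have "line_of ` range z \<subseteq> \<alpha>" using lz fr c(3) by (auto simp: path_image_def)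
      ultimately show ?thesis by blast
    qed
    show "z t \<in> incoming ` strip" for t
      using sub \<alpha> line_mem_incoming[of "z t"] unfolding phase_cylinder_eq by blast
    show "inj z"
    proof (rule injI)
      fix s t assume st: "z s = z t"
      then have "c (frac s) = c (frac t)" using lz by metis
      then have "frac s = frac t"
        using c(1) fr[of s] fr[of t] frac_lt_1[of s] frac_lt_1[of t] unfolding simple_path_def loop_free_def
        by (metis less_irrefl)
      moreover have "of_int \<lfloor>s\<rfloor> *\<^sub>R (2 * pi, 0::real) = of_int \<lfloor>t\<rfloor> *\<^sub>R (2 * pi, 0)"
        using st \<open>frac s = frac t\<close> by (simp add: z_def)
      then have "\<lfloor>s\<rfloor> = \<lfloor>t\<rfloor>" by simp
      ultimately show "s = t" by (simp add: frac_def)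
    qed
  qed
qed

text \<open>Returning after four bounces and \<open>m\<close> turns means rotation number
  \<open>m / 4\<close>, read off along the indices \<open>4 * n + 1\<close>.\<close>

lemma rotation_number_quarter:
  assumes y: "y \<in> strip" and ret: "(bounce ^^ 4) y = y + (2 * pi * of_int m, 0)"
    and rot: "has_rotation_number \<gamma> L (line_of (incoming y)) (1 / 4)" and L: "L > 0"
  shows "m = 1"
proof -
  obtain s where s: "\<And>k. \<gamma> (s k) = entry_point \<gamma> ((billiard_map \<gamma> ^^ k) (line_of (incoming y)))"
    "\<And>k. s k < s (Suc k)" "\<And>k. s (Suc k) < s k + L" and lim: "(\<lambda>k. (s k - s 0) / (real k * L)) \<longlonglongrightarrow> 1 / 4"
    using rot unfolding has_rotation_number_def by blast
  \<comment> \<open>A line enters at the impact of the previous reflection; hence the index shift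
    between \<open>s\<close> and \<open>impact\<close>.\<close>
  have gs: "g (N (s (Suc k))) = g (impact k y)" for k
  proof -
    have "(billiard_map \<gamma> ^^ Suc k) (line_of (incoming y)) = line_of (outgoing ((bounce ^^ k) y))"
      using iterate_billiard_map[OF y, of "Suc k"] incoming_bounce[OF iter_strip[OF y, of k]] by simp
    then show ?thesis using s(1)[of "Suc k"] entry_point_outgoing[OF iter_strip[OF y, of k]] by (simp add: \<gamma>_eq)
  qed
  obtain j :: int where j: "N (s (Suc 0)) = impact 0 y + 2 * pi * of_int j" using gs[of 0] by (rule g_eqD)
  \<comment> \<open>Both sequences advance by less than one turn at each step, so the multiple
    \<open>j\<close> found at the start never changes.\<close>
  have Ns: "N (s (Suc k)) = impact k y + 2 * pi * of_int j" for k
  proof (induction k)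
    case (Suc k)
    have 1: "N (s (Suc k)) < N (s (Suc (Suc k)))" "N (s (Suc (Suc k))) < N (s (Suc k)) + 2 * pi"
      using strict_monoD[OF N_mono s(2)[of "Suc k"]] strict_monoD[OF N_mono s(3)[of "Suc k"]] by (simp_all add: N_shift)
    have b: "chord (impact k y) (impact k y + snd ((bounce ^^ k) y)) (impact (Suc k) y)"
      using bounce_props(1)[OF iter_strip[OF y, of k]] by simp
    have "g (N (s (Suc (Suc k)))) = g (impact (Suc k) y + 2 * pi * of_int j)" unfolding g_periodic_int by (rule gs)
    then show ?case
      by (rule g_eq_close) (use 1 b Suc in \<open>auto simp: chord_def abs_less_iff\<close>)
  qed (rule j)
  have ch: "chord (a + 2 * pi * of_int k) (\<phi> + 2 * pi * of_int k) (b + 2 * pi * of_int k) \<longleftrightarrow> chord a \<phi> b" for a \<phi> b and k :: int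
    by (simp add: chord_def g_periodic_int cis_add_2pi_int)
  have it: "(bounce ^^ (4 * n)) y = y + (2 * pi * of_int (m * int n), 0)" for n
  proof (induction n)
    case (Suc n)
    have "(bounce ^^ (4 * Suc n)) y = (bounce ^^ 4) ((bounce ^^ (4 * n)) y)" by (simp only: mult_Suc_right funpow_add comp_apply)
    also have "\<dots> = (bounce ^^ 4) y + (2 * pi * of_int (m * int n), 0)" unfolding Suc by (rule iter_shift[OF ch y])
    also have "\<dots> = y + (2 * pi * of_int (m * int (Suc n)), 0)" unfolding ret by (simp add: algebra_simps)
    finally show ?case .
  qed (simp add: zero_prod_def[symmetric])
  have Nint: "N (t + L * of_int n) = N t + 2 * pi * of_int n" for t and n :: int
    by (rule shift_int[where f = N and T = L and w = "2 * pi", OF N_shift])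
  have sn: "s (4 * n + 1) = s 1 + L * of_int (m * int n)" for n
  proof -
    have "N (s (4 * n + 1)) = N (s 1 + L * of_int (m * int n))"
      unfolding Nint using Ns[of "4 * n"] Ns[of 0] it[of n] by simp
    then show ?thesis using strict_mono_imp_inj_on[OF N_mono] by (simp add: inj_eq)
  qed
  have sub: "strict_mono (\<lambda>n::nat. 4 * n + 1)" by (auto simp: strict_mono_def)
  have "(\<lambda>n. (s (4 * n + 1) - s 0) / (real (4 * n + 1) * L)) \<longlonglongrightarrow> 1 / 4"
    using LIMSEQ_subseq_LIMSEQ[OF lim sub] by (simp add: comp_def)
  then have "(\<lambda>n. (s (4 * n + 1) - s 0) / (real (4 * n + 1) * L) - of_int m / 4) \<longlonglongrightarrow> 1 / 4 - of_int m / 4"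
    by (rule tendsto_diff[OF _ tendsto_const])
  moreover have "(s (4 * n + 1) - s 0) / (real (4 * n + 1) * L) - of_int m / 4
      = ((s 1 - s 0) / L - of_int m / 4) / real (4 * n + 1)" for n
  proof -
    define X D where "X = (s 1 - s 0) / L" and "D = real (4 * n + 1)"
    have D: "D > 0" "D = 4 * real n + 1" by (simp_all add: D_def)
    have "s 1 + L * of_int (m * int n) - s 0 = (X + of_int m * real n) * L"
      using L by (simp add: X_def field_simps)
    then have "(s (4 * n + 1) - s 0) / (D * L) = (X + of_int m * real n) / D" unfolding sn using L by simp
    also have "\<dots> - of_int m / 4 = (X - of_int m / 4) / D"
    proof -
      have "X + of_int m * real n = (X - of_int m / 4) + of_int m / 4 * D" using D(2) by (simp add: algebra_simps)
      then have "(X + of_int m * real n) / D = (X - of_int m / 4) / D + of_int m / 4 * D / D"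
        by (simp only: add_divide_distrib)
      then show ?thesis using D(1) by simp
    qed
    finally show ?thesis unfolding X_def D_def .
  qed
  ultimately have "(\<lambda>n. ((s 1 - s 0) / L - of_int m / 4) / real (4 * n + 1)) \<longlonglongrightarrow> 1 / 4 - of_int m / 4" by simp
  moreover have "(\<lambda>n. ((s 1 - s 0) / L - of_int m / 4) / real (4 * n + 1)) \<longlonglongrightarrow> 0"
    using LIMSEQ_subseq_LIMSEQ[OF lim_const_over_n sub] by (simp add: comp_def)
  ultimately have "1 / 4 - of_int m / 4 = (0::real)" by (rule LIMSEQ_unique)
  then show "m = 1" by simp
qed

end

locale symmetric_table = billiard_table + symmetric_curve
begin

text \<open>The lifted curve is an injective family as in \<open>periodic_family_ordered\<close>.
  Each orbit is compared with its own half turn; once they coincide, \<open>half_turn_orbit\<close>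
  fixes the angle, and since the impacts cover all normal angles the curve is the whole graph of
  \<open>d\<close>.\<close>

lemma invariant_curve_structure:
  assumes \<alpha>: "rotational_curve \<gamma> \<alpha>" and rot: "\<And>x. x \<in> \<alpha> \<Longrightarrow> has_rotation_number \<gamma> L x (1 / 4)"
    and ret: "\<And>x. x \<in> \<alpha> \<Longrightarrow> (billiard_map \<gamma> ^^ 4) x = x" and L: "L > 0"
  shows "\<alpha> = line_of ` incoming ` range (\<lambda>t. (t, d t))" "quarter_curve g \<rho> c"
proof -
  obtain z :: "real \<Rightarrow> real \<times> real" where z: "continuous_on UNIV z" "\<And>t. z (t + 1) = z t + (2 * pi, 0)" "inj z"
    "\<And>t. z t \<in> incoming ` strip" "\<alpha> = line_of ` range z"
    using rotational_curve_lift[OF \<alpha>] by blast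
  define x where "x = (\<lambda>t. inv_into strip incoming (z t))"
  have xs: "x t \<in> strip" and ix: "incoming (x t) = z t" for t
    unfolding x_def by (rule inv_into_into[OF z(4)] f_inv_into_f[OF z(4)])+
  have xc: "continuous_on UNIV x" unfolding x_def
    by (rule continuous_on_compose2[OF continuous_on_inv_incoming z(1)]) (use z(4) in blast)
  have x1: "x (t + 1) = x t + (2 * pi, 0)" for t
  proof -
    have "incoming (x (t + 1)) = incoming (x t + (2 * pi, 0))"
      using incoming_shift_int[of "x t" 1] by (simp add: ix z(2))
    moreover have "x t + (2 * pi, 0) \<in> strip" using xs by (simp add: mem_strip)
    ultimately show ?thesis using inj_onD[OF inj_on_incoming] xs by blast
  qed
  have xinj: "inj x" using z(3) ix by (metis injD injI)
  have x\<alpha>: "line_of (incoming (x t)) \<in> \<alpha>" for t by (simp add: ix z(5))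
  have per: "four_periodic (x t)" for t
  proof -
    have "line_of (incoming ((bounce ^^ 4) (x t))) = line_of (incoming (x t))"
      using ret[OF x\<alpha>] iterate_billiard_map[OF xs] by metis
    then obtain m :: int where "incoming ((bounce ^^ 4) (x t)) = incoming (x t) + (2 * pi * of_int m, 0)" by (rule line_of_eqD)
    then have "incoming ((bounce ^^ 4) (x t)) = incoming (x t + (2 * pi * of_int m, 0))" by (simp only: incoming_shift_int)
    moreover have "x t + (2 * pi * of_int m, 0) \<in> strip" using xs by (simp add: mem_strip)
    ultimately have m: "(bounce ^^ 4) (x t) = x t + (2 * pi * of_int m, 0)"
      using inj_onD[OF inj_on_incoming] iter_strip[OF xs] by blast
    have "m = 1" by (rule rotation_number_quarter[OF xs m rot[OF x\<alpha>] L])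
    then show ?thesis using m xs by (simp add: four_periodic_def)
  qed
  have half: "(bounce ^^ 2) (x t) = x t + (pi, 0)" for t
  proof -
    define w where "w = (bounce ^^ 2) (x t)"
    \<comment> \<open>The orbit turned by \<open>pi\<close>: it is started two impacts later and
      lowered by \<open>pi\<close>, so that it is comparable with the original.\<close>
    define m where "m = w + (- pi, 0)"
    have ws: "w \<in> strip" unfolding w_def by (rule iter_strip[OF xs])
    have chm: "chord (a + (- pi)) (\<phi> + (- pi)) (b + (- pi)) \<longleftrightarrow> chord a \<phi> b" for a \<phi> b
      using chord_antipode[of "a + - pi" "\<phi> + - pi" "b + - pi"] by simp
    have itm: "(bounce ^^ k) m = (bounce ^^ (k + 2)) (x t) + (- pi, 0)" for k
      using iter_shift[OF chm ws, of k] unfolding m_def w_def by (simp only: funpow_add comp_apply)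
    have it4: "(bounce ^^ (k + 4)) (x t) = (bounce ^^ k) (x t) + (2 * pi, 0)" for k
      by (rule four_periodic_iter[OF per])
    have "four_periodic m"
      unfolding four_periodic_def
    proof
      show "m \<in> strip" using ws by (simp add: m_def mem_strip)
      have "(bounce ^^ 4) m = (bounce ^^ (2 + 4)) (x t) + (- pi, 0)" using itm[of 4] by simp
      also have "\<dots> = m + (2 * pi, 0)" unfolding it4 by (simp add: m_def w_def)
      finally show "(bounce ^^ 4) m = m + (2 * pi, 0)" .
    qed
    then obtain \<tau> where \<tau>: "x \<tau> = m" "\<And>t k. t < \<tau> \<Longrightarrow> k < 4 \<Longrightarrow> impact k (x t) < impact k m"
      "\<And>t k. t > \<tau> \<Longrightarrow> k < 4 \<Longrightarrow> impact k (x t) > impact k m"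
      using periodic_family_ordered[OF xc x1 per xinj] by blast
    have m0: "impact 0 m = impact 2 (x t) - pi" using itm[of 0] by (simp add: numeral_2_eq_2)
    have m2: "impact 2 m = impact 0 (x t) + pi" using itm[of 2] it4[of 0] by simp
    \<comment> \<open>For \<open>t < \<tau>\<close>, index 0 says that impacts 0 and 2 are more than
      \<open>pi\<close> apart, while index 2 says that they are less than \<open>pi\<close> apart;
      for \<open>t > \<tau>\<close> the two roles are exchanged.\<close>
    have "t = \<tau>"
    proof (rule linorder_cases[of t \<tau>])
      assume "t < \<tau>"
      then show ?thesis using \<tau>(2)[of t 0] \<tau>(2)[of t 2] unfolding m0 m2 by simp
    next
      assume "t > \<tau>"
      then show ?thesis using \<tau>(3)[of t 0] \<tau>(3)[of t 2] unfolding m0 m2 by simp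
    qed
    then show ?thesis using \<tau>(1) by (simp add: m_def w_def prod_eq_iff)
  qed
  have xd: "x t = (\<psi>, d \<psi>)" if "fst (x t) = \<psi>" for t \<psi>
    using half_turn_orbit(1)[OF xs half, of t] that by (simp add: prod_eq_iff)
  have onto: "\<exists>t. fst (x t) = \<psi>" for \<psi>
  proof -
    have fc: "continuous_on UNIV (\<lambda>t. fst (x t))" by (intro continuous_intros xc)
    have f1: "fst (x (t + 1)) = fst (x t) + 2 * pi" for t by (simp add: x1)
    obtain T1 where T1: "\<forall>t\<le>T1. fst (x t) < \<psi>" using periodic_curve_unbounded(1)[OF fc f1] by blast
    obtain T2 where T2: "\<forall>t\<ge>T2. fst (x t) > \<psi>" using periodic_curve_unbounded(2)[OF fc f1] by blast
    have "T1 \<le> T2" using T1 T2 by (meson linorder_le_cases order_less_asym)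
    moreover have "fst (x T1) \<le> \<psi>" "\<psi> \<le> fst (x T2)" using T1 T2 by (simp_all add: less_imp_le)
    ultimately show ?thesis using IVT'[of "\<lambda>t. fst (x t)" T1 \<psi> T2] continuous_on_subset[OF fc] by blast
  qed
  have rx: "range x = range (\<lambda>t. (t, d t))"
  proof (intro equalityI subsetI)
    fix y assume "y \<in> range (\<lambda>t. (t, d t))"
    then obtain \<psi> where "y = (\<psi>, d \<psi>)" by blast
    moreover obtain t where "fst (x t) = \<psi>" using onto by blast
    ultimately show "y \<in> range x" using xd[of t \<psi>] by (metis rangeI)
  next
    fix y assume "y \<in> range x"
    then obtain t where "y = x t" by blast
    have "x t = (fst (x t), d (fst (x t)))" by (rule xd) (rule refl)
    then show "y \<in> range (\<lambda>t. (t, d t))"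
      unfolding \<open>y = x t\<close> by (rule range_eqI[where x = "fst (x t)"])
  qed
  have "range z = incoming ` range x" unfolding image_image ix ..
  then show "\<alpha> = line_of ` incoming ` range (\<lambda>t. (t, d t))" using z(5) rx by simp
  have hd: "(bounce ^^ 2) (\<psi>, d \<psi>) = (\<psi>, d \<psi>) + (pi, 0)" for \<psi>
  proof -
    obtain t where "fst (x t) = \<psi>" using onto by blast
    then have "x t = (\<psi>, d \<psi>)" by (rule xd)
    then show ?thesis using half[of t] by simp
  qed
  show "quarter_curve g \<rho> c"
  proof
    fix t
    note ho = half_turn_orbit[OF d_mem_strip hd, of t]
    have "(bounce ^^ 2) (bounce (t, d t)) = bounce ((bounce ^^ 2) (t, d t))" by (simp add: numeral_2_eq_2)
    also have "\<dots> = bounce (t, d t) + (pi, 0)" unfolding hd by (rule bounce_shift[OF chord_antipode d_mem_strip])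
    finally have "snd (bounce (t, d t)) = d (fst (bounce (t, d t)))"
      by (rule half_turn_orbit(1)[OF bounce_props(3)[OF d_mem_strip]])
    then show "bounce (t, d t) = (t + pi / 2, d (t + pi / 2))" using ho(2) by simp
    show "h1 (t + pi / 2) * cos (d t) = - h1 t * sin (d t)" using ho(3) by simp
  qed
qed

end

subsection \<open>Invariant line fields\<close>

context billiard_table
begin

text \<open>Differential of the chart by incoming lines. The change of \<open>p\<close> splits into
  the motion of the impact along the curve and the turning of the line about the impact.\<close>

definition d_incoming :: "real \<times> real \<Rightarrow> real \<times> real \<Rightarrow> complex \<times> real" where
  "d_incoming y k = ((fst k - snd k) *\<^sub>R (\<i> * cis (fst y - snd y)),
     - (\<rho> (fst y) * sin (snd y)) * fst k + (fst k - snd k) * (g (fst y) \<bullet> (\<i> * cis (fst y - snd y))))"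

definition d_outgoing :: "real \<times> real \<Rightarrow> real \<times> real \<Rightarrow> complex \<times> real" where
  "d_outgoing y k = ((fst k + snd k) *\<^sub>R (\<i> * cis (fst y + snd y)),
     \<rho> (fst y) * sin (snd y) * fst k + (fst k + snd k) * (g (fst y) \<bullet> (\<i> * cis (fst y + snd y))))"

lemma g_fst_derivative:
  "((\<lambda>y :: real \<times> real. g (fst y)) has_derivative (\<lambda>k. fst k *\<^sub>R (\<rho> (fst y) *\<^sub>R (\<i> * cis (fst y))))) (at y)"
proof -
  have "(g has_derivative (\<lambda>k. k *\<^sub>R (\<rho> (fst y) *\<^sub>R (\<i> * cis (fst y))))) (at (fst y))"
    using g_deriv[of "fst y"] by (simp only: has_vector_derivative_def)
  from has_derivative_compose[OF has_derivative_fst[OF has_derivative_ident] this] show ?thesis .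
qed

lemma incoming_derivative: "((\<lambda>y. line_of (incoming y)) has_derivative d_incoming y) (at y)"
proof -
  have 1: "((\<lambda>y. cis (fst y - snd y)) has_derivative (\<lambda>k. (fst k - snd k) *\<^sub>R (\<i> * cis (fst y - snd y)))) (at y)"
    by (rule has_derivative_cis) (intro derivative_intros)
  show ?thesis unfolding line_of_def incoming_def fst_conv snd_conv
    by (rule has_derivative_eq_rhs[OF has_derivative_Pair[OF 1 has_derivative_inner[OF g_fst_derivative 1]]])
       (auto simp: d_incoming_def fun_eq_iff algebra_simps)
qed

lemma outgoing_derivative: "((\<lambda>y. line_of (outgoing y)) has_derivative d_outgoing y) (at y)"
proof -
  have 1: "((\<lambda>y. cis (fst y + snd y)) has_derivative (\<lambda>k. (fst k + snd k) *\<^sub>R (\<i> * cis (fst y + snd y)))) (at y)"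
    by (rule has_derivative_cis) (intro derivative_intros)
  show ?thesis unfolding line_of_def outgoing_def fst_conv snd_conv
    by (rule has_derivative_eq_rhs[OF has_derivative_Pair[OF 1 has_derivative_inner[OF g_fst_derivative 1]]])
       (auto simp: d_outgoing_def fun_eq_iff algebra_simps)
qed

lemma phase_cylinder_eq': "phase_cylinder \<gamma> = line_of ` outgoing ` strip"
  by (simp add: phase_cylinder_eq incoming_image_eq)

text \<open>\<open>D\<close> is not unique on the ambient space, but the chain rule through the
  chart determines it on the tangent vectors that the chart produces.\<close>

lemma billiard_map_differential:
  assumes y: "y \<in> strip" and D: "(billiard_map \<gamma> has_derivative D) (at (line_of (incoming y)) within phase_cylinder \<gamma>)"
  shows "D (d_incoming y k) = d_outgoing y k"
proof -
  have "((\<lambda>y. line_of (incoming y)) has_derivative d_incoming y) (at y within strip)"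
    using incoming_derivative by (rule has_derivative_at_withinI)
  moreover have "(billiard_map \<gamma> has_derivative D) (at (line_of (incoming y)) within (\<lambda>y. line_of (incoming y)) ` strip)"
    using D by (simp add: phase_cylinder_eq image_image)
  ultimately have "((\<lambda>y. billiard_map \<gamma> (line_of (incoming y))) has_derivative (\<lambda>k. D (d_incoming y k))) (at y within strip)"
    by (rule has_derivative_in_compose)
  then have "((\<lambda>y. billiard_map \<gamma> (line_of (incoming y))) has_derivative (\<lambda>k. D (d_incoming y k))) (at y)"
    using at_within_open[OF y open_strip] by simp
  then have "((\<lambda>y. line_of (outgoing y)) has_derivative (\<lambda>k. D (d_incoming y k))) (at y)"
    by (rule has_derivative_transform_within_open[OF _ open_strip y]) (rule billiard_map_incoming)
  from has_derivative_unique[OF this outgoing_derivative] show ?thesis by metis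
qed

text \<open>In the chart \<open>E\<close> the branch \<theta> satisfies
  \<open>\<eta> (\<theta> (E z)) = \<kappa> z\<close> near \<open>y\<close>; differentiating there
  evaluates the differential. One argument serves for both coordinates, \<open>s\<close> and
  \<phi>.\<close>

lemma circle_differential_chart:
  fixes E :: "real \<times> real \<Rightarrow> oriented_line" and \<kappa> :: "real \<times> real \<Rightarrow> complex"
  assumes cd: "circle_differential \<gamma> \<eta> f (E y) (M k) r" and y: "y \<in> strip"
    and E: "(E has_derivative M) (at y)" and Ec: "continuous_on strip E" and EP: "E ` strip \<subseteq> phase_cylinder \<gamma>"
    and \<kappa>: "(\<kappa> has_derivative K) (at y)" and f: "\<And>z. z \<in> strip \<Longrightarrow> f (E z) = \<kappa> z"
    and \<eta>: "\<And>\<tau>. \<eta> \<tau> = f (E y) \<Longrightarrow> (\<eta> has_vector_derivative e) (at \<tau>)"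
  shows "r *\<^sub>R e = K k"
proof -
  obtain \<theta> D where \<theta>: "\<eta> (\<theta> (E y)) = f (E y)" "\<forall>\<^sub>F x in at (E y) within phase_cylinder \<gamma>. \<eta> (\<theta> x) = f x"
    "(\<theta> has_derivative D) (at (E y) within phase_cylinder \<gamma>)" "D (M k) = r"
    using cd unfolding circle_differential_def by blast
  obtain S where S: "open S" "E y \<in> S" "\<And>x. x \<in> S \<Longrightarrow> x \<noteq> E y \<Longrightarrow> x \<in> phase_cylinder \<gamma> \<Longrightarrow> \<eta> (\<theta> x) = f x"
    using \<theta>(2) unfolding eventually_at_topological by blast
  define V where "V = strip \<inter> E -` S"
  have V: "open V" "y \<in> V" "V \<subseteq> strip"
    using continuous_on_open_vimage[OF open_strip, of E] Ec S y by (auto simp: V_def Int_commute)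
  have loc: "\<eta> (\<theta> (E z)) = \<kappa> z" if "z \<in> V" for z
  proof -
    have "z \<in> strip" "E z \<in> S" "E z \<in> phase_cylinder \<gamma>" using that EP by (auto simp: V_def)
    then show ?thesis using S(3)[of "E z"] \<theta>(1) f[of z] by (cases "E z = E y") auto
  qed
  have "(\<theta> has_derivative D) (at (E y) within E ` strip)"
    by (rule has_derivative_subset[OF \<theta>(3) EP])
  with has_derivative_at_withinI[OF E]
  have "((\<lambda>z. \<theta> (E z)) has_derivative (\<lambda>k. D (M k))) (at y within strip)"
    by (rule has_derivative_in_compose)
  then have "((\<lambda>z. \<theta> (E z)) has_derivative (\<lambda>k. D (M k))) (at y)"
    using at_within_open[OF y open_strip] by simp
  moreover have "(\<eta> has_derivative (\<lambda>r. r *\<^sub>R e)) (at (\<theta> (E y)))"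
    using \<eta>[OF \<theta>(1)] by (simp add: has_vector_derivative_def)
  ultimately have "((\<lambda>z. \<eta> (\<theta> (E z))) has_derivative (\<lambda>k. D (M k) *\<^sub>R e)) (at y)"
    by (rule has_derivative_compose)
  then have "(\<kappa> has_derivative (\<lambda>k. D (M k) *\<^sub>R e)) (at y)"
    by (rule has_derivative_transform_within_open[OF _ V(1,2)]) (rule loc)
  from has_derivative_unique[OF this \<kappa>] have "D (M k) *\<^sub>R e = K k" by metis
  then show ?thesis using \<theta>(4) by simp
qed

lemma dphi_incoming:
  assumes "dphi \<gamma> (line_of (incoming y)) (d_incoming y k) r" and y: "y \<in> strip"
  shows "r = fst k - snd k"
proof -
  have 1: "((\<lambda>y. cis (fst y - snd y)) has_derivative (\<lambda>k. (fst k - snd k) *\<^sub>R (\<i> * cis (fst y - snd y)))) (at y)"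
    by (rule has_derivative_cis) (intro derivative_intros)
  have "r *\<^sub>R (\<i> * cis (fst y - snd y)) = (fst k - snd k) *\<^sub>R (\<i> * cis (fst y - snd y))"
  proof (rule circle_differential_chart[OF assms(1)[unfolded dphi_def] y incoming_derivative _ _ 1])
    show "continuous_on strip (\<lambda>y. line_of (incoming y))"
      unfolding line_of_def by (intro continuous_intros continuous_on_incoming)
    show "(\<lambda>y. line_of (incoming y)) ` strip \<subseteq> phase_cylinder \<gamma>" by (auto simp: phase_cylinder_eq)
    show "fst (line_of (incoming z)) = cis (fst z - snd z)" for z by (simp add: line_of_def incoming_def)
    show "(cis has_vector_derivative \<i> * cis (fst y - snd y)) (at \<tau>)" if "cis \<tau> = fst (line_of (incoming y))" for \<tau>
      using cis_has_vector_derivative[of \<tau>] that by (simp add: line_of_def incoming_def)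
  qed
  then show ?thesis by simp
qed

lemma ds_outgoing:
  assumes "ds \<gamma> (line_of (outgoing y)) (d_outgoing y k) r" and y: "y \<in> strip"
  shows "r = \<rho> (fst y) * fst k"
proof -
  have "r *\<^sub>R (\<i> * cis (fst y)) = fst k *\<^sub>R (\<rho> (fst y) *\<^sub>R (\<i> * cis (fst y)))"
  proof (rule circle_differential_chart[OF assms(1)[unfolded ds_def] y outgoing_derivative _ _ g_fst_derivative])
    show "continuous_on strip (\<lambda>y. line_of (outgoing y))"
      unfolding line_of_def by (intro continuous_intros continuous_on_outgoing)
    show "(\<lambda>y. line_of (outgoing y)) ` strip \<subseteq> phase_cylinder \<gamma>" by (auto simp: phase_cylinder_eq')
    show "entry_point \<gamma> (line_of (outgoing z)) = g (fst z)" if "z \<in> strip" for z by (rule entry_point_outgoing[OF that])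
    show "(\<gamma> has_vector_derivative \<i> * cis (fst y)) (at \<tau>)" if "\<gamma> \<tau> = entry_point \<gamma> (line_of (outgoing y))" for \<tau>
      using \<gamma>_deriv[of \<tau>] velocity_at[of \<tau> "fst y"] that by (simp add: entry_point_outgoing[OF y])
  qed
  then have "r *\<^sub>R (\<i> * cis (fst y)) = (fst k * \<rho> (fst y)) *\<^sub>R (\<i> * cis (fst y))" by simp
  then have "r = fst k * \<rho> (fst y)" by (simp only: scaleR_cancel_right) simp
  then show ?thesis by simp
qed

text \<open>Once the turning is prescribed, the change of \<open>p\<close> can still be adjusted by
  moving the impact, because \<open>\<rho> * sin \<delta>\<close> is positive.\<close>

lemma d_incoming_onto:
  assumes y: "y \<in> strip" and v: "fst v = a *\<^sub>R (\<i> * cis (fst y - snd y))"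
  obtains k where "d_incoming y k = v" "fst k - snd k = a"
proof -
  define u where "u = (a * (g (fst y) \<bullet> (\<i> * cis (fst y - snd y))) - snd v) / (\<rho> (fst y) * sin (snd y))"
  have "\<rho> (fst y) * sin (snd y) > 0" using y rho_pos[of "fst y"] by (auto simp: mem_strip intro!: mult_pos_pos sin_gt_zero)
  then have "\<rho> (fst y) * sin (snd y) * u = a * (g (fst y) \<bullet> (\<i> * cis (fst y - snd y))) - snd v"
    unfolding u_def by (metis less_irrefl nonzero_mult_div_cancel_left times_divide_eq_right)
  then have "d_incoming y (u, u - a) = v" using v by (simp add: d_incoming_def prod_eq_iff)
  then show thesis by (rule that) simp
qed

lemma d_outgoing_onto:
  assumes y: "y \<in> strip" and v: "fst v = a *\<^sub>R (\<i> * cis (fst y + snd y))"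
  obtains k where "d_outgoing y k = v" "fst k + snd k = a"
proof -
  define u where "u = (snd v - a * (g (fst y) \<bullet> (\<i> * cis (fst y + snd y)))) / (\<rho> (fst y) * sin (snd y))"
  have "\<rho> (fst y) * sin (snd y) > 0" using y rho_pos[of "fst y"] by (auto simp: mem_strip intro!: mult_pos_pos sin_gt_zero)
  then have "\<rho> (fst y) * sin (snd y) * u = snd v - a * (g (fst y) \<bullet> (\<i> * cis (fst y + snd y)))"
    unfolding u_def by (metis less_irrefl nonzero_mult_div_cancel_left times_divide_eq_right)
  then have "d_outgoing y (u, a - u) = v" using v by (simp add: d_outgoing_def prod_eq_iff)
  then show thesis by (rule that) simp
qed

lemma d_outgoing_scale: "d_outgoing y (r *\<^sub>R k) = r *\<^sub>R d_outgoing y k"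
  by (simp add: d_outgoing_def prod_eq_iff algebra_simps)

end

section \<open>The line field below the invariant curve\<close>

locale quarter_table = symmetric_table + quarter_curve
begin

text \<open>The region is connected, avoids the curve and has every positively oriented tangent line
  in its closure, so it lies in the component adherent to \<delta> = 0.\<close>

lemma lower_subset_lower_domain:
  assumes \<alpha>: "\<alpha> = line_of ` incoming ` range (\<lambda>t. (t, d t))"
  shows "line_of ` incoming ` lower \<subseteq> lower_domain \<gamma> \<alpha>"
proof -
  let ?U = "line_of ` incoming ` lower"
  have disj: "?U \<inter> \<alpha> = {}"
  proof (rule ccontr)
    assume "?U \<inter> \<alpha> \<noteq> {}"
    then obtain x where x: "x \<in> ?U" "x \<in> \<alpha>" by blast
    from x(1) obtain y where y: "y \<in> lower" "x = line_of (incoming y)" by blast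
    from x(2) obtain t where "x = line_of (incoming (t, d t))" unfolding \<alpha> by blast
    then have "line_of (incoming y) = line_of (incoming (t, d t))" using y(2) by simp
    then obtain k :: int where "incoming y = incoming (t, d t) + (2 * pi * of_int k, 0)" by (rule line_of_eqD)
    then have "incoming y = incoming ((t, d t) + (2 * pi * of_int k, 0))" by (simp only: incoming_shift_int)
    moreover have "(t, d t) + (2 * pi * of_int k, 0) \<in> strip" using d_mem_strip[of t] by (simp add: mem_strip)
    ultimately have "y = (t, d t) + (2 * pi * of_int k, 0)"
      using inj_onD[OF inj_on_incoming] y(1) lower_subset_strip by blast
    then show False using y(1) by (simp add: lower_def d_periodic_int)
  qed
  have sub: "?U \<subseteq> phase_cylinder \<gamma> - \<alpha>"
    using disj lower_subset_strip unfolding phase_cylinder_eq by blast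
  have "lower = (\<lambda>z. (fst z, snd z * d (fst z))) ` (UNIV \<times> {0<..<1})"
  proof (intro equalityI subsetI)
    fix y assume y: "y \<in> lower"
    have "y = (\<lambda>z. (fst z, snd z * d (fst z))) (fst y, snd y / d (fst y))" using d_bounds(1)[of "fst y"] by (simp add: prod_eq_iff)
    moreover have "(fst y, snd y / d (fst y)) \<in> UNIV \<times> {0<..<1}"
      using y d_bounds(1)[of "fst y"] by (simp add: lower_def)
    ultimately show "y \<in> (\<lambda>z. (fst z, snd z * d (fst z))) ` (UNIV \<times> {0<..<1})" by (rule image_eqI)
  next
    fix y assume "y \<in> (\<lambda>z. (fst z, snd z * d (fst z))) ` (UNIV \<times> {0<..<1})"
    then obtain z where "y = (fst z, snd z * d (fst z))" "0 < snd z" "snd z < 1" by force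
    then show "y \<in> lower"
      using d_bounds(1)[of "fst z"] mult_strict_right_mono[of "snd z" 1 "d (fst z)"] by (simp add: lower_def)
  qed
  moreover have "connected ((\<lambda>z. (fst z, snd z * d (fst z))) ` (UNIV \<times> {0<..<1 :: real}))"
    by (intro connected_continuous_image continuous_intros continuous_on_compose2[OF d_cont[of UNIV]] connected_Times) auto
  ultimately have "connected lower" by simp
  then have conn: "connected ?U"
    unfolding image_image line_of_def
    by (intro connected_continuous_image continuous_intros continuous_on_incoming)
  have bd: "boundary_delta_0 \<gamma> \<subseteq> closure ?U"
    unfolding boundary_eq
  proof
    fix x assume "x \<in> range (\<lambda>\<psi>. line_of (\<psi>, g \<psi> \<bullet> cis \<psi>))"
    then obtain \<psi> where x: "x = line_of (incoming (\<psi>, 0))" by (auto simp: incoming_def)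
    define f where "f = (\<lambda>e. line_of (incoming (\<psi>, e)))"
    have fc: "continuous_on S f" for S unfolding f_def line_of_def
      by (intro continuous_intros continuous_on_compose2[OF continuous_on_incoming[of UNIV]]) auto
    have "f ` closure {0<..<d \<psi>} \<subseteq> closure ?U"
      by (rule image_closure_subset[OF fc closed_closure])
         (auto simp: f_def lower_def intro!: subsetD[OF closure_subset])
    moreover have "0 \<in> closure {0<..<d \<psi>}" using d_bounds(1)[of \<psi>] by simp
    ultimately show "x \<in> closure ?U" unfolding x f_def by blast
  qed
  show ?thesis
  proof
    fix x assume x: "x \<in> ?U"
    have "?U \<subseteq> connected_component_set (phase_cylinder \<gamma> - \<alpha>) x"
      by (rule connected_component_maximal[OF x conn sub])
    then have "boundary_delta_0 \<gamma> \<subseteq> closure (connected_component_set (phase_cylinder \<gamma> - \<alpha>) x)"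
      using bd closure_mono by blast
    then show "x \<in> lower_domain \<gamma> \<alpha>" using x sub by (auto simp: lower_domain_def)
  qed
qed

text \<open>Either notion of monotonicity yields \<open>d\<phi> > 0\<close> along the field. The
  slope \<open>W\<close> is then finite, and the two increments of \<phi> at an impact are positive,
  as \<open>slope_inequality\<close> demands.\<close>

theorem ellipse_of_invariant_bundle:
  assumes UM: "line_of ` incoming ` lower \<subseteq> M" and tangent: "oriented_line_bundle M l"
    and meas: "measurable_bundle M l" and inv: "invariant_bundle \<gamma> M l"
    and mono: "s_monotone \<gamma> M l \<or> phi_monotone \<gamma> M l"
  shows "is_ellipse (range g)"
proof -
  define a where "a = (\<lambda>x. fst (l x) \<bullet> (\<i> * fst x))"
  have inM: "line_of (incoming y) \<in> M" "line_of (outgoing y) \<in> M" if "y \<in> lower" for y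
    using UM that outgoing_lower by blast+
  have fl: "fst (l (line_of z)) = a (line_of z) *\<^sub>R (\<i> * cis (fst z))" if "line_of z \<in> M" for z
  proof -
    have "fst (l (line_of z)) \<bullet> fst (line_of z) = 0"
      using tangent that by (simp add: oriented_line_bundle_def tangent_plane_def)
    moreover have "fst (line_of z) = cis (fst z)" by (simp add: line_of_def)
    ultimately have "fst (l (line_of z)) \<bullet> cis (fst z) = 0" by simp
    from orthogonal_to_cis[OF this] show ?thesis by (simp add: a_def line_of_def)
  qed
  have step: "\<exists>k r. d_incoming y k = l (line_of (incoming y)) \<and> fst k - snd k = a (line_of (incoming y)) \<and>
      r > 0 \<and> d_outgoing y k = r *\<^sub>R l (line_of (outgoing y))" if y: "y \<in> lower" for y
  proof -
    have ys: "y \<in> strip" using y lower_subset_strip by blast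
    obtain D r where D: "(billiard_map \<gamma> has_derivative D) (at (line_of (incoming y)) within phase_cylinder \<gamma>)"
      "r > 0" "D (l (line_of (incoming y))) = r *\<^sub>R l (billiard_map \<gamma> (line_of (incoming y)))"
      using inv inM(1)[OF y] unfolding invariant_bundle_def by blast
    have "fst (l (line_of (incoming y))) = a (line_of (incoming y)) *\<^sub>R (\<i> * cis (fst y - snd y))"
      using fl[OF inM(1)[OF y]] by (simp add: incoming_def)
    then obtain k where k: "d_incoming y k = l (line_of (incoming y))" "fst k - snd k = a (line_of (incoming y))"
      using d_incoming_onto[OF ys] by blast
    have "d_outgoing y k = r *\<^sub>R l (line_of (outgoing y))"
      using billiard_map_differential[OF ys D(1), of k] D(3) by (simp add: k(1) billiard_map_incoming[OF ys])
    then show ?thesis using k D(2) by blast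
  qed
  have apos: "a (line_of (incoming y)) > 0" if y: "y \<in> lower" for y
  proof -
    have ys: "y \<in> strip" using y lower_subset_strip by blast
    obtain k r where k: "d_incoming y k = l (line_of (incoming y))" "fst k - snd k = a (line_of (incoming y))"
      "r > 0" "d_outgoing y k = r *\<^sub>R l (line_of (outgoing y))" using step[OF y] by blast
    show ?thesis
    proof (cases "phi_monotone \<gamma> M l")
      case True
      then obtain r' where "r' > 0" "dphi \<gamma> (line_of (incoming y)) (l (line_of (incoming y))) r'"
        using inM(1)[OF y] unfolding phi_monotone_def by blast
      then show ?thesis using dphi_incoming[of y k r'] ys k(1,2) by simp
    next
      case False
      then have sm: "s_monotone \<gamma> M l" using mono by blast
      \<comment> \<open>In this case the field is only known to move both ends of the line forward.
        Computing the change of \<open>p\<close> at either end and subtracting, the chord length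
        times \<open>d\<phi>\<close> equals a sum of two positive terms.\<close>
      define y0 where "y0 = unbounce y"
      have y0: "y0 \<in> lower" unfolding y0_def by (rule unbounce_lower[OF y])
      have y0s: "y0 \<in> strip" using y0 lower_subset_strip by blast
      have eq: "outgoing y0 = incoming y" unfolding y0_def by (rule outgoing_unbounce[OF ys])
      have \<phi>: "fst y0 + snd y0 = fst y - snd y" using eq by (simp add: outgoing_def incoming_def)
      have "fst (l (line_of (incoming y))) = a (line_of (incoming y)) *\<^sub>R (\<i> * cis (fst y0 + snd y0))"
        using fl[OF inM(1)[OF y]] by (simp add: incoming_def \<phi>)
      then obtain k0 where k0: "d_outgoing y0 k0 = l (line_of (incoming y))" "fst k0 + snd k0 = a (line_of (incoming y))"
        using d_outgoing_onto[OF y0s] by blast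
      obtain r0 where "r0 > 0" "ds \<gamma> (line_of (outgoing y0)) (d_outgoing y0 k0) r0"
        using sm inM(1)[OF y] unfolding s_monotone_def k0(1) eq by blast
      then have "\<rho> (fst y0) * fst k0 > 0" using ds_outgoing[of y0 k0 r0] y0s by simp
      then have u0: "fst k0 > 0" using rho_pos[of "fst y0"] by (simp add: zero_less_mult_iff)
      obtain r2 where "r2 > 0" "ds \<gamma> (line_of (outgoing y)) (l (line_of (outgoing y))) r2"
        using sm inM(2)[OF y] unfolding s_monotone_def by blast
      moreover have "l (line_of (outgoing y)) = d_outgoing y ((1 / r) *\<^sub>R k)"
        unfolding d_outgoing_scale k(4) using k(3) by simp
      ultimately have "\<rho> (fst y) * (fst k / r) > 0" using ds_outgoing[of y "(1 / r) *\<^sub>R k" r2] ys by simp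
      then have u: "fst k > 0" using rho_pos[of "fst y"] k(3) by (simp add: zero_less_mult_iff zero_less_divide_iff)
      have "chord (fst y0) (fst y - snd y) (fst y)" unfolding y0_def by (rule unbounce_props(1)[OF ys])
      then obtain t where t: "t > 0" "g (fst y) - g (fst y0) = t *\<^sub>R (\<i> * cis (fst y - snd y))"
        using chord_length by blast
      have "snd (d_incoming y k) = snd (d_outgoing y0 k0)" using k(1) k0(1) by simp
      then have "a (line_of (incoming y)) * ((g (fst y) - g (fst y0)) \<bullet> (\<i> * cis (fst y - snd y)))
          = \<rho> (fst y) * sin (snd y) * fst k + \<rho> (fst y0) * sin (snd y0) * fst k0"
        unfolding d_incoming_def d_outgoing_def \<phi> k(2) k0(2) snd_conv by (simp add: inner_diff_left algebra_simps)
      moreover have "\<rho> (fst y) * sin (snd y) * fst k > 0" "\<rho> (fst y0) * sin (snd y0) * fst k0 > 0"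
        using rho_pos u u0 ys y0s by (auto simp: mem_strip intro!: mult_pos_pos sin_gt_zero)
      ultimately have "a (line_of (incoming y)) * t > 0" unfolding t(2) by simp
      then show ?thesis using t(1) by (simp add: zero_less_mult_iff)
    qed
  qed
  have apos': "a (line_of (outgoing y)) > 0" if "y \<in> lower" for y
    using apos outgoing_lower that by (metis image_iff)
  \<comment> \<open>The slope of \<open>offset\<close> instead of \<open>p\<close>: the subtracted
    term is the derivative of \<open>c \<bullet> cis \<phi>\<close>.\<close>
  define W where "W = (\<lambda>z. snd (l (line_of z)) / a (line_of z) - c \<bullet> (\<i> * cis (fst z)))"
  have slopes: "\<exists>p q. p > 0 \<and> q > 0 \<and>
      W (incoming y) = - \<rho> (fst y) * sin (snd y) * (1 + q / p) / 2 + (g (fst y) - c) \<bullet> (\<i> * cis (fst y - snd y)) \<and>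
      W (outgoing y) = \<rho> (fst y) * sin (snd y) * (1 + p / q) / 2 + (g (fst y) - c) \<bullet> (\<i> * cis (fst y + snd y))"
    if y: "y \<in> lower" for y
  proof -
    obtain k r where k: "d_incoming y k = l (line_of (incoming y))" "fst k - snd k = a (line_of (incoming y))"
      "r > 0" "d_outgoing y k = r *\<^sub>R l (line_of (outgoing y))" using step[OF y] by blast
    \<comment> \<open>The increments of \<phi> before and after the reflection; their mean is the
      increment of the normal angle.\<close>
    define p q where "p = fst k - snd k" and "q = fst k + snd k"
    have "(fst k + snd k) *\<^sub>R (\<i> * cis (fst y + snd y)) = r *\<^sub>R (a (line_of (outgoing y)) *\<^sub>R (\<i> * cis (fst y + snd y)))"
      using k(4) fl[OF inM(2)[OF y]] by (simp add: d_outgoing_def prod_eq_iff outgoing_def)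
    then have qa: "q = r * a (line_of (outgoing y))" by (simp add: q_def)
    have p: "p > 0" using apos[OF y] k(2) by (simp add: p_def)
    have q: "q > 0" using apos'[OF y] k(3) by (simp add: qa)
    have k1: "fst k = (p + q) / 2" by (simp add: p_def q_def)
    have "snd (l (line_of (incoming y))) = - (\<rho> (fst y) * sin (snd y)) * ((p + q) / 2) + p * (g (fst y) \<bullet> (\<i> * cis (fst y - snd y)))"
      unfolding k(1)[symmetric] d_incoming_def snd_conv k1[symmetric] by (simp add: p_def)
    then have "W (incoming y) = - \<rho> (fst y) * sin (snd y) * (1 + q / p) / 2 + (g (fst y) - c) \<bullet> (\<i> * cis (fst y - snd y))"
      using p k(2) unfolding W_def p_def[symmetric] by (simp add: incoming_def inner_diff_left field_simps p_def)
    moreover have "r * snd (l (line_of (outgoing y))) = \<rho> (fst y) * sin (snd y) * ((p + q) / 2) + q * (g (fst y) \<bullet> (\<i> * cis (fst y + snd y)))"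
    proof -
      have "r * snd (l (line_of (outgoing y))) = snd (d_outgoing y k)" unfolding k(4) by simp
      then show ?thesis unfolding d_outgoing_def snd_conv k1[symmetric] by (simp add: q_def)
    qed
    then have "snd (l (line_of (outgoing y))) / a (line_of (outgoing y))
        = (\<rho> (fst y) * sin (snd y) * ((p + q) / 2) + q * (g (fst y) \<bullet> (\<i> * cis (fst y + snd y)))) / q"
      using k(3) unfolding qa by (metis less_irrefl mult_divide_mult_cancel_left)
    then have "W (outgoing y) = \<rho> (fst y) * sin (snd y) * (1 + p / q) / 2 + (g (fst y) - c) \<bullet> (\<i> * cis (fst y + snd y))"
      using q unfolding W_def by (simp add: outgoing_def inner_diff_left field_simps)
    ultimately show ?thesis using p q by blast
  qed
  obtain Q where Q: "\<And>t. norm (g t - c) \<le> Q" using centred_bounded by blast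
  have GQ: "\<bar>(g t - c) \<bullet> (\<i> * cis s)\<bar> \<le> Q" for t s
    using Cauchy_Schwarz_ineq2[of "g t - c" "\<i> * cis s"] Q[of t] by (simp add: norm_mult)
  have rs: "\<rho> (fst y) * sin (snd y) > 0" if "y \<in> lower" for y
    using that lower_subset_strip rho_pos by (auto simp: mem_strip intro!: mult_pos_pos sin_gt_zero)
  \<comment> \<open>The curvature term is negative in the formula for an incoming line and positive
    for an outgoing one, giving one bound each; every line of the region is both.\<close>
  have upper: "W (incoming y) \<le> Q" if y: "y \<in> lower" for y
  proof -
    obtain p q where pq: "p > 0" "q > 0" "W (incoming y) = - \<rho> (fst y) * sin (snd y) * (1 + q / p) / 2 + (g (fst y) - c) \<bullet> (\<i> * cis (fst y - snd y))"
      using slopes[OF y] by blast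
    define E where "E = \<rho> (fst y) * sin (snd y) * (1 + q / p)"
    have "E > 0" unfolding E_def by (rule mult_pos_pos[OF rs[OF y]]) (use pq in \<open>auto intro: add_pos_pos\<close>)
    moreover have "W (incoming y) = - E / 2 + (g (fst y) - c) \<bullet> (\<i> * cis (fst y - snd y))"
      using pq(3) by (simp add: E_def)
    ultimately show ?thesis using GQ[of "fst y" "fst y - snd y"] by linarith
  qed
  have lower_bd: "- Q \<le> W (outgoing y)" if y: "y \<in> lower" for y
  proof -
    obtain p q where pq: "p > 0" "q > 0" "W (outgoing y) = \<rho> (fst y) * sin (snd y) * (1 + p / q) / 2 + (g (fst y) - c) \<bullet> (\<i> * cis (fst y + snd y))"
      using slopes[OF y] by blast
    define E where "E = \<rho> (fst y) * sin (snd y) * (1 + p / q)"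
    have "E > 0" unfolding E_def by (rule mult_pos_pos[OF rs[OF y]]) (use pq in \<open>auto intro: add_pos_pos\<close>)
    moreover have "W (outgoing y) = E / 2 + (g (fst y) - c) \<bullet> (\<i> * cis (fst y + snd y))"
      using pq(3) by (simp add: E_def)
    ultimately show ?thesis using GQ[of "fst y" "fst y + snd y"] by linarith
  qed
  have "integral {0..2 * pi} (\<lambda>t. integral {0..d t} (\<lambda>e. energy t e * (\<rho> t * sin e))) \<le> 0"
  proof (rule energy_nonpos[where W = W and C = Q])
    have lm: "(\<lambda>z. l (line_of z)) \<in> borel_measurable (lebesgue_on (incoming ` lower))"
    proof (rule measurable_restrict_mono)
      show "(\<lambda>z. l (line_of z)) \<in> borel_measurable (lebesgue_on {(\<phi>, p). (cis \<phi>, p) \<in> M})"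
        using meas by (simp add: measurable_bundle_def line_of_def split_beta')
      show "incoming ` lower \<subseteq> {(\<phi>, p). (cis \<phi>, p) \<in> M}"
        using inM(1) by (auto simp: line_of_def split_beta')
    qed
    have cm: "(\<lambda>z. \<i> * cis (fst z)) \<in> borel_measurable (lebesgue_on (incoming ` lower))"
      by (intro measurable_restrict_space1 measurable_completion)
         (auto intro!: borel_measurable_continuous_onI continuous_intros)
    have "(\<lambda>z. fst (l (line_of z))) \<in> borel_measurable (lebesgue_on (incoming ` lower))"
      by (rule measurable_compose[OF lm]) (intro borel_measurable_continuous_onI continuous_intros)
    then have am: "(\<lambda>z. a (line_of z)) \<in> borel_measurable (lebesgue_on (incoming ` lower))"
      unfolding a_def using cm by (simp add: line_of_def borel_measurable_inner)
    have sm: "(\<lambda>z. snd (l (line_of z))) \<in> borel_measurable (lebesgue_on (incoming ` lower))"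
      by (rule measurable_compose[OF lm]) (intro borel_measurable_continuous_onI continuous_intros)
    show "W \<in> borel_measurable (lebesgue_on (incoming ` lower))"
      unfolding W_def by (intro borel_measurable_diff borel_measurable_divide sm am borel_measurable_inner cm borel_measurable_const)
    show "W (\<phi> + 2 * pi * of_int k, p) = W (\<phi>, p)" for \<phi> p k
    proof -
      have "cis (\<phi> + 2 * pi * of_int k) = cis \<phi>" by (simp add: cis_add_2pi_int)
      then show ?thesis by (simp add: W_def line_of_def)
    qed
    show "\<bar>W (incoming y)\<bar> \<le> Q" if y: "y \<in> lower" for y
    proof -
      obtain y0 where "y0 \<in> lower" "incoming y = outgoing y0" using y outgoing_lower by (metis image_iff)
      then show ?thesis using upper[OF y] lower_bd[of y0] by (simp add: abs_le_iff)
    qed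
    show "energy (fst y) (snd y) \<le> W (outgoing y) * (offset (outgoing y))\<^sup>2 - W (incoming y) * (offset (incoming y))\<^sup>2"
      if y: "y \<in> lower" for y
    proof -
      obtain p q where pq: "p > 0" "q > 0"
        "W (incoming y) = - \<rho> (fst y) * sin (snd y) * (1 + q / p) / 2 + (g (fst y) - c) \<bullet> (\<i> * cis (fst y - snd y))"
        "W (outgoing y) = \<rho> (fst y) * sin (snd y) * (1 + p / q) / 2 + (g (fst y) - c) \<bullet> (\<i> * cis (fst y + snd y))"
        using slopes[OF y] by blast
      have "y \<in> strip" using y lower_subset_strip by blast
      then have e: "0 < snd y" "snd y < pi" by (auto simp: mem_strip)
      have "offset (outgoing y) = (g (fst y) - c) \<bullet> cis (fst y + snd y)" "offset (incoming y) = (g (fst y) - c) \<bullet> cis (fst y - snd y)"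
        by (simp_all add: offset_def outgoing_def incoming_def inner_diff_left)
      then show ?thesis using slope_inequality[OF pq(1,2) e pq(3,4)] by simp
    qed
  qed
  then show ?thesis by (rule ellipse_of_energy)
qed

end

theorem theorem3p2:
  fixes \<gamma> :: "real \<Rightarrow> complex" and L :: real and \<alpha> :: "oriented_line set"
  assumes "simple_closed_arclength \<gamma> L"
    and "C2_curve \<gamma>"
    and "counterclockwise \<gamma> L"
    and "\<forall>s. curvature \<gamma> s > 0"
    and "centrally_symmetric (range \<gamma>)"
    and "rotational_curve \<gamma> \<alpha>"
    and "billiard_map \<gamma> ` \<alpha> = \<alpha>"
    and "\<forall>x\<in>\<alpha>. has_rotation_number \<gamma> L x (1 / 4)"
    and "\<forall>x\<in>\<alpha>. (billiard_map \<gamma> ^^ 4) x = x"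
    and "\<exists>l. oriented_line_bundle (lower_domain \<gamma> \<alpha>) l \<and>
             measurable_bundle (lower_domain \<gamma> \<alpha>) l \<and>
             invariant_bundle \<gamma> (lower_domain \<gamma> \<alpha>) l \<and>
             (s_monotone \<gamma> (lower_domain \<gamma> \<alpha>) l \<or> phi_monotone \<gamma> (lower_domain \<gamma> \<alpha>) l)"
  shows "is_ellipse (range \<gamma>)"
proof -
  obtain g \<rho> N where g: "convex_curve g \<rho>" "\<And>s. \<gamma> s = g (N s)" "\<And>s. velocity \<gamma> s = \<i> * cis (N s)"
    "strict_mono N" "continuous_on UNIV N" "\<And>s. N (s + L) = N s + 2 * pi" "\<And>\<psi>. \<exists>s. N s = \<psi>"
    "\<And>s. (\<gamma> has_vector_derivative velocity \<gamma> s) (at s)"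
    using normal_angle_parametrization[OF assms(1,2)] assms(4) by blast
  interpret convex_curve g \<rho> by (rule g(1))
  interpret billiard_table g \<rho> \<gamma> L N by unfold_locales (use g in auto)
  obtain c where "\<And>z. z \<in> range \<gamma> \<Longrightarrow> 2 * c - z \<in> range \<gamma>"
    using assms(5) unfolding centrally_symmetric_def by blast
  then have "g (t + pi) = 2 * c - g t" for t
    unfolding range_\<gamma> by (rule centrally_symmetric_antipode)
  then interpret symmetric_table g \<rho> \<gamma> L N c by unfold_locales
  have L: "L > 0" using assms(1) by (simp add: simple_closed_arclength_def)
  have \<alpha>: "\<alpha> = line_of ` incoming ` range (\<lambda>t. (t, d t))" and q: "quarter_curve g \<rho> c"
    using invariant_curve_structure[of \<alpha>] assms(6,8,9) L by blast+
  interpret quarter_curve g \<rho> c by (rule q)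
  interpret quarter_table g \<rho> \<gamma> L N c by unfold_locales
  show ?thesis
    using assms(10) ellipse_of_invariant_bundle[OF lower_subset_lower_domain[OF \<alpha>]] unfolding range_\<gamma> by blast
qed

end
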